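(* Assume the setting described in the context, with $\epsilon>0$, $\delta\in(0,1)$, $\epsilon_T+\epsilon_D\le\epsilon/2$, and fixed integers $r\ge1$, $n_{\max}\ge1$. Let $B_{\mathrm{RTE}}=\lambda^{-1}\langle\phi|I_D(\tilde A)|\psi\rangle-\mathbb{E}[Z_b]$ and suppose $|B_{\mathrm{RTE}}|<\epsilon/2$. Let $Z_{N_S}$ be the average of $N_S$ independent samples of $Z_b$, where, with $t_{\max}=2\tilde\kappa\ln(3\tilde\kappa/\epsilon_T)$, $$N_S=\left\lceil 1+\ln\!\left(\tfrac{2}{\delta}\right)\frac{16\left(e^{t_{\max}^2/r}N_yN_z\right)^2}{\lambda^2(\epsilon/2-|B_{\mathrm{RTE}}|)^2}\right\rceil .$$ Then $|Z_{N_S}-\langle\phi|A^{-1}|\psi\rangle|\le\epsilon$ with probability at least $1-\delta$, and each sample requires at most $N_{CP}=r$ controlled Pauli rotations (the controlled version of the sampled unitary $U$ is implementable by $r$ controlled single-qubit Pauli rotations together with Clifford gates).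
   Context: Setting. $n\ge1$; $A$ is an invertible Hermitian $2^n\times2^n$ matrix with $\|A\|\ge1$, Pauli decomposition $A=\sum_{\ell=0}^{L-1}c_\ell P_\ell$ ($c_\ell\in\mathbb{R}$, $P_\ell\in\{I,X,Y,Z\}^{\otimes n}$), Pauli weight $\lambda=\sum_\ell|c_\ell|$, known $\kappa^*\ge\|A\|\|A^{-1}\|$; unit vectors $|\psi\rangle=U_\psi|0\rangle$, $|\phi\rangle=U_\phi|0\rangle$. $\tilde A=A/\lambda$, $\tilde\kappa=\lambda\kappa^*$, $\epsilon_D>0$, $0<\epsilon_T<3\tilde\kappa$. Fourier series: $z_{\max}=\sqrt{2\ln(3\tilde\kappa/\epsilon_T)}$, $y_{\max}=\tilde\kappa z_{\max}$, $K=\lceil 1+\frac1\pi(\ln2+\frac{z_{\max}^2}{2}+2\tilde\kappa\ln(3\tilde\kappa/\epsilon_T)+\ln(2/\epsilon_D)+\ln(1+\frac{2}{z_{\max}\sqrt{2\pi}}))\rceil$, $J=\lceil\frac{1}{\ln2}(\ln\frac{K}{K-1}+\ln\frac{32y_{\max}z_{\max}^2}{\epsilon_D\sqrt{2\pi}}+\frac{3\tilde\kappa\ln(3\tilde\kappa/\epsilon_T)}{2\sqrt2})\rceil$; $\Delta z=2z_{\max}/(K-1)$, $z_k=\Delta z(k-(K-1)/2)$; $c_j$ the roots of the Legendre polynomial $P_J$, $g_j=2/((1-c_j^2)P_J'(c_j)^2)$, $y_j=y_{\max}(1+c_j)/2$, $w_y^{(j)}=\frac{y_{\max}}2g_j$;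 $\alpha_{jk}=\frac{i}{\sqrt{2\pi}}w_y^{(j)}\Delta z\,z_ke^{-z_k^2/2}$, $t_{jk}=y_jz_k$, $I_D(\tilde A)=\sum_{j,k}\alpha_{jk}e^{-i\tilde At_{jk}}$; $N_y=\frac1{\sqrt{2\pi}}\sum_j|w_y^{(j)}|$, $N_z=\sum_k|\Delta z z_ke^{-z_k^2/2}|$. Random Taylor expansion (RTE): for real $s$ and even $n\ge0$ let $\theta_n(s)=\arccos\big((1+(s/(n+1))^2)^{-1/2}\big)$ and $$T(s)=\sum_{\substack{0\le n\le n_{\max}\\ n\text{ even}}}\frac{(-is)^n}{n!}\sqrt{1+\left(\tfrac{s}{n+1}\right)^2}\Big(\sum_\ell\tfrac{c_\ell}{\lambda}P_\ell\Big)^n\sum_\ell\tfrac{c_\ell}{\lambda}e^{-i\theta_n(s)P_\ell}.$$ Expanding the powers, $T(s)=\sum_m d'_m U'_m$ with $d'_m\ge0$ and unitaries $U'_m$ of the form (phase)$\,P_{\ell_1}\cdots P_{\ell_n}e^{-i\theta_n(s)P_{\ell_{n+1}}}$; let $\alpha(s)=\sum_m d'_m$. Sampling procedure: draw $(j,k)$ with probability $|\alpha_{jk}|/(N_yN_z)$, set $\tau=t_{jk}$, $\omega=\alpha_{jk}/|\alpha_{jk}|$; draw $m_1,\dots,m_r$ independently with probabilities $d'_m/\alpha(\tau/r)$ (for $s=\tau/r$), set $U=U'_{m_1}\cdots U'_{m_r}$ and $N_{\mathrm{RTE}}=\alpha(\tau/r)^r$; run two independent Hadamard tests on $U$ giving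 $X,Y\in\{\pm1\}$ with $\mathbb{E}[X]=\mathrm{Re}\langle\phi|U|\psi\rangle$, $\mathbb{E}[Y]=\mathrm{Im}\langle\phi|U|\psi\rangle$; output $Z_b=\omega N_{\mathrm{RTE}}N_yN_z\lambda^{-1}(X+iY)$. $\mathbb{E}$ is over all randomness. *)

theory Defs
  imports "HOL-Probability.Probability_Mass_Function"
          "HOL-Computational_Algebra.Polynomial"
          "Jordan_Normal_Form.Schur_Decomposition"
begin

datatype pauli = PI | PX | PY | PZ

definition pauli1 :: "pauli \<Rightarrow> nat \<Rightarrow> nat \<Rightarrow> complex" where
  "pauli1 p a b = (case p of
      PI \<Rightarrow> (if a = b then 1 else 0)
    | PX \<Rightarrow> (if a = b then 0 else 1)
    | PY \<Rightarrow> (if a = b then 0 else if a = 0 then - \<i> else \<i>)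
    | PZ \<Rightarrow> (if a = b then (if a = 0 then 1 else -1) else 0))"

text \<open>Bit of qubit q (q = 0 is the most significant qubit) of basis index i, N qubits.\<close>
definition qbit :: "nat \<Rightarrow> nat \<Rightarrow> nat \<Rightarrow> nat" where
  "qbit N q i = (i div 2 ^ (N - 1 - q)) mod 2"

text \<open>Pauli string P_1 (x) ... (x) P_N as a 2^N x 2^N matrix (tensor product).\<close>
definition pauli_mat :: "pauli list \<Rightarrow> complex mat" where
  "pauli_mat ps = mat (2 ^ length ps) (2 ^ length ps)
     (\<lambda>(i, j). \<Prod>q<length ps. pauli1 (ps ! q) (qbit (length ps) q i) (qbit (length ps) q j))"

definition mat_sum :: "nat \<Rightarrow> ('a \<Rightarrow> complex mat) \<Rightarrow> 'a set \<Rightarrow> complex mat" where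
  "mat_sum d f S = mat d d (\<lambda>(i, j). \<Sum>x\<in>S. f x $$ (i, j))"

definition mat_prod_list :: "nat \<Rightarrow> complex mat list \<Rightarrow> complex mat" where
  "mat_prod_list d Ms = foldr (*) Ms (1\<^sub>m d)"

definition mat_exp :: "complex mat \<Rightarrow> complex mat" where
  "mat_exp M = mat (dim_row M) (dim_col M) (\<lambda>(i, j). \<Sum>k. (M ^\<^sub>m k) $$ (i, j) / of_nat (fact k))"

definition vnorm :: "complex vec \<Rightarrow> real" where
  "vnorm v = sqrt (\<Sum>i<dim_vec v. (cmod (v $ i))\<^sup>2)"

definition op_norm :: "complex mat \<Rightarrow> real" where
  "op_norm M = Sup {vnorm (M *\<^sub>v v) | v. v \<in> carrier_vec (dim_col M) \<and> vnorm v = 1}"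

definition braket :: "complex vec \<Rightarrow> complex mat \<Rightarrow> complex vec \<Rightarrow> complex" where
  "braket phi M psi = (\<Sum>i<dim_vec phi. cnj (phi $ i) * (M *\<^sub>v psi) $ i)"

text \<open>Legendre polynomials via Bonnet's recurrence (n+2) P_{n+2} = (2n+3) x P_{n+1} - (n+1) P_n.\<close>
fun legendre :: "nat \<Rightarrow> real poly" where
  "legendre 0 = 1"
| "legendre (Suc 0) = [:0, 1:]"
| "legendre (Suc (Suc n)) =
     Polynomial.smult (1 / real (n + 2))
       (Polynomial.smult (real (2 * n + 3)) ([:0, 1:] * legendre (Suc n)) - Polynomial.smult (real (n + 1)) (legendre n))"

definition legendre_root :: "nat \<Rightarrow> nat \<Rightarrow> real" where
  "legendre_root J j = sorted_list_of_set {x. poly (legendre J) x = 0} ! j"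

definition gauss_weight :: "nat \<Rightarrow> nat \<Rightarrow> real" where
  "gauss_weight J j = 2 / ((1 - (legendre_root J j)\<^sup>2) * (poly (pderiv (legendre J)) (legendre_root J j))\<^sup>2)"

text \<open>Parameters depend on kt = tilde kappa, eT = epsilon_T, eD = epsilon_D.\<close>
definition zmax :: "real \<Rightarrow> real \<Rightarrow> real" where
  "zmax kt eT = sqrt (2 * ln (3 * kt / eT))"

definition ymax :: "real \<Rightarrow> real \<Rightarrow> real" where
  "ymax kt eT = kt * zmax kt eT"

definition Kpar :: "real \<Rightarrow> real \<Rightarrow> real \<Rightarrow> nat" where
  "Kpar kt eT eD = nat \<lceil>1 + (1 / pi) * (ln 2 + (zmax kt eT)\<^sup>2 / 2 + 2 * kt * ln (3 * kt / eT)
       + ln (2 / eD) + ln (1 + 2 / (zmax kt eT * sqrt (2 * pi))))\<rceil>"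

definition Jpar :: "real \<Rightarrow> real \<Rightarrow> real \<Rightarrow> nat" where
  "Jpar kt eT eD = (let K = real (Kpar kt eT eD) in
     nat \<lceil>(1 / ln 2) * (ln (K / (K - 1))
        + ln (32 * ymax kt eT * (zmax kt eT)\<^sup>2 / (eD * sqrt (2 * pi)))
        + 3 * kt * ln (3 * kt / eT) / (2 * sqrt 2))\<rceil>)"

definition dz :: "real \<Rightarrow> real \<Rightarrow> real \<Rightarrow> real" where
  "dz kt eT eD = 2 * zmax kt eT / (real (Kpar kt eT eD) - 1)"

definition zk :: "real \<Rightarrow> real \<Rightarrow> real \<Rightarrow> nat \<Rightarrow> real" where
  "zk kt eT eD k = dz kt eT eD * (real k - (real (Kpar kt eT eD) - 1) / 2)"

definition yj :: "real \<Rightarrow> real \<Rightarrow> real \<Rightarrow> nat \<Rightarrow> real" where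
  "yj kt eT eD j = ymax kt eT * (1 + legendre_root (Jpar kt eT eD) j) / 2"

definition wy :: "real \<Rightarrow> real \<Rightarrow> real \<Rightarrow> nat \<Rightarrow> real" where
  "wy kt eT eD j = ymax kt eT / 2 * gauss_weight (Jpar kt eT eD) j"

definition fs_alpha :: "real \<Rightarrow> real \<Rightarrow> real \<Rightarrow> nat \<Rightarrow> nat \<Rightarrow> complex" where
  "fs_alpha kt eT eD j k = \<i> / complex_of_real (sqrt (2 * pi)) *
     complex_of_real (wy kt eT eD j * dz kt eT eD * zk kt eT eD k * exp (- (zk kt eT eD k)\<^sup>2 / 2))"

definition fs_t :: "real \<Rightarrow> real \<Rightarrow> real \<Rightarrow> nat \<Rightarrow> nat \<Rightarrow> real" where
  "fs_t kt eT eD j k = yj kt eT eD j * zk kt eT eD k"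

definition I_D :: "real \<Rightarrow> real \<Rightarrow> real \<Rightarrow> complex mat \<Rightarrow> complex mat" where
  "I_D kt eT eD M = mat_sum (dim_row M)
     (\<lambda>(j, k). fs_alpha kt eT eD j k \<cdot>\<^sub>m mat_exp ((- \<i> * complex_of_real (fs_t kt eT eD j k)) \<cdot>\<^sub>m M))
     ({..<Jpar kt eT eD} \<times> {..<Kpar kt eT eD})"

definition Ny :: "real \<Rightarrow> real \<Rightarrow> real \<Rightarrow> real" where
  "Ny kt eT eD = 1 / sqrt (2 * pi) * (\<Sum>j<Jpar kt eT eD. \<bar>wy kt eT eD j\<bar>)"

definition Nz :: "real \<Rightarrow> real \<Rightarrow> real \<Rightarrow> real" where
  "Nz kt eT eD = (\<Sum>k<Kpar kt eT eD. \<bar>dz kt eT eD * zk kt eT eD k * exp (- (zk kt eT eD k)\<^sup>2 / 2)\<bar>)"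

definition rte_theta :: "nat \<Rightarrow> real \<Rightarrow> real" where
  "rte_theta q s = arccos (1 / sqrt (1 + (s / real (q + 1))\<^sup>2))"

text \<open>Index set of the expanded sum T(s) = sum_m d'_m U'_m: m = (q, [l_1,...,l_q, l_{q+1}])
  with q even, q \<le> nmax, l_i < L.\<close>
definition rte_terms :: "nat \<Rightarrow> nat \<Rightarrow> (nat \<times> nat list) set" where
  "rte_terms nmax L = {(q, ls). even q \<and> q \<le> nmax \<and> length ls = Suc q \<and> set ls \<subseteq> {..<L}}"

definition rte_coef :: "(nat \<Rightarrow> real) \<Rightarrow> real \<Rightarrow> real \<Rightarrow> nat \<times> nat list \<Rightarrow> complex" where
  "rte_coef c lam s m = (case m of (q, ls) \<Rightarrow>
     (- \<i> * complex_of_real s) ^ q / of_nat (fact q)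
     * complex_of_real (sqrt (1 + (s / real (q + 1))\<^sup>2))
     * (\<Prod>l\<leftarrow>ls. complex_of_real (c l / lam)))"

definition rte_d :: "(nat \<Rightarrow> real) \<Rightarrow> real \<Rightarrow> real \<Rightarrow> nat \<times> nat list \<Rightarrow> real" where
  "rte_d c lam s m = cmod (rte_coef c lam s m)"

definition rte_U :: "nat \<Rightarrow> (nat \<Rightarrow> real) \<Rightarrow> real \<Rightarrow> (nat \<Rightarrow> pauli list) \<Rightarrow> real
     \<Rightarrow> nat \<times> nat list \<Rightarrow> complex mat" where
  "rte_U n c lam P s m = (case m of (q, ls) \<Rightarrow>
     (if rte_d c lam s m = 0 then 1 else rte_coef c lam s m / complex_of_real (rte_d c lam s m))
     \<cdot>\<^sub>m (mat_prod_list (2 ^ n) (map (\<lambda>i. pauli_mat (P (ls ! i))) [0..<q])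
          * mat_exp ((- \<i> * complex_of_real (rte_theta q s)) \<cdot>\<^sub>m pauli_mat (P (ls ! q)))))"

definition rte_alpha :: "nat \<Rightarrow> nat \<Rightarrow> (nat \<Rightarrow> real) \<Rightarrow> real \<Rightarrow> real \<Rightarrow> real" where
  "rte_alpha nmax L c lam s = (\<Sum>m\<in>rte_terms nmax L. rte_d c lam s m)"

definition finite_pmf :: "'a set \<Rightarrow> ('a \<Rightarrow> real) \<Rightarrow> 'a pmf" where
  "finite_pmf S w = embed_pmf (\<lambda>x. if x \<in> S then w x else 0)"

text \<open>A +-1 valued random variable with mean a (outcome of a Hadamard test).\<close>
definition pm1_pmf :: "real \<Rightarrow> real pmf" where
  "pm1_pmf a = map_pmf (\<lambda>b. if b then 1 else -1) (bernoulli_pmf ((1 + a) / 2))"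

definition pauli_weight :: "nat \<Rightarrow> (nat \<Rightarrow> real) \<Rightarrow> real" where
  "pauli_weight L c = (\<Sum>l<L. \<bar>c l\<bar>)"

definition sample_U :: "nat \<Rightarrow> nat \<Rightarrow> (nat \<Rightarrow> real) \<Rightarrow> (nat \<Rightarrow> pauli list)
     \<Rightarrow> real \<Rightarrow> real \<Rightarrow> real \<Rightarrow> nat \<Rightarrow> nat \<Rightarrow> (complex \<times> real \<times> complex mat) pmf" where
  "sample_U n L c P kt eT eD r nmax =
     (let lam = pauli_weight L c in
      bind_pmf
        (finite_pmf ({..<Jpar kt eT eD} \<times> {..<Kpar kt eT eD})
           (\<lambda>(j, k). cmod (fs_alpha kt eT eD j k) / (Ny kt eT eD * Nz kt eT eD)))
        (\<lambda>(j, k).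
           let tau = fs_t kt eT eD j k;
               omega = fs_alpha kt eT eD j k / complex_of_real (cmod (fs_alpha kt eT eD j k));
               s = tau / real r
           in map_pmf
                (\<lambda>ms. (omega, (rte_alpha nmax L c lam s) ^ r,
                       mat_prod_list (2 ^ n) (map (rte_U n c lam P s) ms)))
                (replicate_pmf r
                   (finite_pmf (rte_terms nmax L) (\<lambda>m. rte_d c lam s m / rte_alpha nmax L c lam s)))))"

definition Zb_pmf :: "nat \<Rightarrow> nat \<Rightarrow> (nat \<Rightarrow> real) \<Rightarrow> (nat \<Rightarrow> pauli list) \<Rightarrow> complex vec \<Rightarrow> complex vec
     \<Rightarrow> real \<Rightarrow> real \<Rightarrow> real \<Rightarrow> nat \<Rightarrow> nat \<Rightarrow> complex pmf" where
  "Zb_pmf n L c P psi phi kt eT eD r nmax =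
     bind_pmf (sample_U n L c P kt eT eD r nmax) (\<lambda>(omega, NRTE, U).
       bind_pmf (pm1_pmf (Re (braket phi U psi))) (\<lambda>X.
         bind_pmf (pm1_pmf (Im (braket phi U psi))) (\<lambda>Y.
           return_pmf (omega * complex_of_real (NRTE * Ny kt eT eD * Nz kt eT eD / pauli_weight L c)
                       * (complex_of_real X + \<i> * complex_of_real Y)))))"

definition avg_pmf :: "nat \<Rightarrow> complex pmf \<Rightarrow> complex pmf" where
  "avg_pmf N p = map_pmf (\<lambda>zs. sum_list zs / of_nat N) (replicate_pmf N p)"

text \<open>Controlled-U on 1 + n qubits, the control being the most significant qubit.\<close>
definition ctrl_mat :: "nat \<Rightarrow> complex mat \<Rightarrow> complex mat" where
  "ctrl_mat d U = mat (2 * d) (2 * d) (\<lambda>(i, j).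
     if i < d \<and> j < d then (if i = j then 1 else 0)
     else if d \<le> i \<and> d \<le> j then U $$ (i - d, j - d) else 0)"

definition is_clifford :: "nat \<Rightarrow> complex mat \<Rightarrow> bool" where
  "is_clifford N C \<longleftrightarrow> C \<in> carrier_mat (2 ^ N) (2 ^ N) \<and> C * mat_adjoint C = 1\<^sub>m (2 ^ N) \<and>
     (\<forall>p. length p = N \<longrightarrow>
        (\<exists>z p'. length p' = N \<and> C * pauli_mat p * mat_adjoint C = z \<cdot>\<^sub>m pauli_mat p'))"

definition pauli_on :: "nat \<Rightarrow> nat \<Rightarrow> pauli \<Rightarrow> complex mat" where
  "pauli_on N b sg = pauli_mat ((replicate N PI)[b := sg])"

text \<open>Controlled (control qubit a) single-qubit Pauli rotation exp(-i theta sg) on qubit b: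
  |0><0|_a (x) I + |1><1|_a (x) exp(-i theta sigma_b).\<close>
definition is_ctrl_pauli_rot :: "nat \<Rightarrow> complex mat \<Rightarrow> bool" where
  "is_ctrl_pauli_rot N G \<longleftrightarrow> (\<exists>a b sg theta. a < N \<and> b < N \<and> a \<noteq> b \<and>
     G = (1 / 2 :: complex) \<cdot>\<^sub>m (1\<^sub>m (2 ^ N) + pauli_on N a PZ)
       + ((1 / 2 :: complex) \<cdot>\<^sub>m (1\<^sub>m (2 ^ N) - pauli_on N a PZ))
         * mat_exp ((- \<i> * complex_of_real theta) \<cdot>\<^sub>m pauli_on N b sg))"

definition circuit :: "nat \<Rightarrow> complex mat \<Rightarrow> (complex mat \<times> complex mat) list \<Rightarrow> complex mat" where
  "circuit N C0 GCs = mat_prod_list (2 ^ N) (C0 # concat (map (\<lambda>(G, C). [G, C]) GCs))"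

end

theory Submission
  imports Defs "HOL-Complex_Analysis.Complex_Analysis" "HOL-Probability.Probability"
begin

text \<open>On an eigenvector of \<open>A\<close> the operator \<open>I_D\<close> acts as a scalar, so the deterministic error reduces
  to a bound on \<open>I_scalar - 1 / x\<close> for \<open>1 / kt \<le> \<bar>x\<bar> \<le> 1\<close>. There the sum over \<open>j\<close> is a Gauss--Legendre rule,
  exact on polynomials of degree below \<open>2 J\<close>, applied to an exponential; after replacing it by the exact
  integral, the sum over \<open>k\<close> becomes a difference of two trapezoidal sums of Gaussian waves. Integrating
  \<open>gauss_wave / (grid_kernel - 1)\<close> around a rectangle whose interior poles are the grid points shows
  that such a sum is exponentially close to the Gaussian integral.

  The statistical error is a Chernoff bound for the real and imaginary parts of the bounded samples. For
  the circuits, each controlled \<open>exp (- \<i> \<theta> P)\<close> is conjugated into a controlled single-qubit rotation by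
  the Clifford unitary exchanging \<open>P\<close> with a single-qubit Pauli operator anticommuting with it, and the
  remaining controlled Pauli operators are themselves Clifford.\<close>

text \<open>The parameters come from the identity expressing 1/x as i/sqrt(2 pi) times the integral
  over y \<ge> 0 of the integral over real z of z exp(-z^2/2) exp(-i x y z). Cutting y at
  \<open>ymax\<close> costs exp(-(x ymax)^2/2)/|x|, and cutting each of the two Gaussian sums at
  \<open>zmax\<close> costs exp(-zmax^2/2)/|x|. As |x| \<ge> 1/kt, the three together are at most 3
  kt exp(-zmax^2/2), which is eT by the choice of \<open>zmax\<close>. The contour runs at height
  \<open>zmax\<close>: with spacing \<open>dz\<close> = 2 zmax/(K - 1) the kernel has modulus
  exp(-pi (K - 1)) or its inverse there, and the formula for K controls exactly this exponent. J is
  such that the quadrature in y takes eD/8, which leaves 7 eD/8 for aliasing. For large tolerances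
  the logarithms in K and J can become negative, so these estimates are confined to a main regime.
  The estimator enters only through its mean, whose distance from the quadrature value is the given
  bias, and through a bound on its modulus. Each of the r Taylor factors has normalisation at most
  exp(s^2) with s = \<tau>/r, hence the constant exp(t_max^2/r).\<close>

unbundle no vec_syntax
no_notation fps_nth (infixl "$" 75)
no_notation fls_nth (infixl "$$" 75)

section \<open>Hermitian matrices\<close>

lemma index_mult_mat_vec_sum:
  "M \<in> carrier_mat N N \<Longrightarrow> v \<in> carrier_vec N \<Longrightarrow> i < N \<Longrightarrow> (M *\<^sub>v v) $ i = (\<Sum>j<N. M $$ (i, j) * v $ j)"
  by (simp add: scalar_prod_def lessThan_atLeast0)

lemma index_mult_mat_sum:
  "A \<in> carrier_mat N N \<Longrightarrow> B \<in> carrier_mat N N \<Longrightarrow> i < N \<Longrightarrow> j < N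
    \<Longrightarrow> (A * B) $$ (i, j) = (\<Sum>k<N. A $$ (i, k) * B $$ (k, j))"
  by (simp add: scalar_prod_def lessThan_atLeast0)

declare index_mult_mat_vec [simp del] index_mult_mat(1) [simp del]

lemma mult_mat_zero_vec:
  assumes "M \<in> carrier_mat N N" shows "M *\<^sub>v 0\<^sub>v N = (0\<^sub>v N :: complex vec)"
  using assms by (intro eq_vecI) (auto simp: index_mult_mat_vec_sum[OF assms])

lemma mat_adjoint_carrier [simp]: "A \<in> carrier_mat N N \<Longrightarrow> mat_adjoint A \<in> carrier_mat N N"
  unfolding mat_adjoint_def by (intro carrier_matI) auto

lemma index_mat_adjoint:
  assumes "A \<in> carrier_mat N M" "i < M" "j < N"
  shows "mat_adjoint A $$ (i, j) = cnj (A $$ (j, i))"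
  using assms by (simp add: mat_adjoint_def mat_of_rows_index)

definition cinner :: "complex vec \<Rightarrow> complex vec \<Rightarrow> complex" where
  "cinner u v = (\<Sum>i<dim_vec v. u $ i * cnj (v $ i))"

lemma cinner_self: "cinner v v = of_real ((vnorm v)\<^sup>2)"
  by (simp add: cinner_def vnorm_def sum_nonneg complex_norm_square del: of_real_power)

lemma vnorm_nonneg [simp]: "vnorm v \<ge> 0"
  by (simp add: vnorm_def sum_nonneg)

lemma vnorm_L2: "vnorm v = L2_set (\<lambda>i. cmod (v $ i)) {..<dim_vec v}"
  by (simp add: vnorm_def L2_set_def)

lemma vnorm_eq_0: "v \<in> carrier_vec N \<Longrightarrow> vnorm v = 0 \<longleftrightarrow> v = 0\<^sub>v N"
  by (auto simp: vnorm_L2 L2_set_eq_0_iff)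

lemma vnorm_smult: "vnorm (a \<cdot>\<^sub>v v) = cmod a * vnorm v"
  by (simp add: vnorm_def norm_mult power_mult_distrib real_sqrt_mult flip: sum_distrib_left)

lemma cinner_mult_adjoint:
  assumes A: "A \<in> carrier_mat N N" and u: "u \<in> carrier_vec N" and v: "v \<in> carrier_vec N"
  shows "cinner (A *\<^sub>v u) v = cinner u (mat_adjoint A *\<^sub>v v)"
proof -
  have "cinner (A *\<^sub>v u) v = (\<Sum>i<N. \<Sum>j<N. A $$ (i, j) * u $ j * cnj (v $ i))"
    using assms v by (auto simp: cinner_def index_mult_mat_vec_sum[OF A u] sum_distrib_right
        intro!: sum.cong)
  also have "\<dots> = (\<Sum>j<N. \<Sum>i<N. A $$ (i, j) * u $ j * cnj (v $ i))" by (rule sum.swap)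
  also have "\<dots> = (\<Sum>j<N. u $ j * cnj ((mat_adjoint A *\<^sub>v v) $ j))"
  proof (rule sum.cong[OF refl])
    fix j assume "j \<in> {..<N}"
    then have j: "j < N" by simp
    have "(\<Sum>i<N. A $$ (i, j) * u $ j * cnj (v $ i)) = u $ j * (\<Sum>i<N. A $$ (i, j) * cnj (v $ i))"
      by (simp add: sum_distrib_left mult_ac)
    also have "(\<Sum>i<N. A $$ (i, j) * cnj (v $ i)) = (\<Sum>i<N. cnj (mat_adjoint A $$ (j, i) * v $ i))"
      using j by (intro sum.cong refl) (simp add: index_mat_adjoint[OF A])
    also have "\<dots> = cnj ((mat_adjoint A *\<^sub>v v) $ j)"
      unfolding index_mult_mat_vec_sum[OF mat_adjoint_carrier[OF A] v j] by (simp only: cnj_sum)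
    finally show "(\<Sum>i<N. A $$ (i, j) * u $ j * cnj (v $ i)) = u $ j * cnj ((mat_adjoint A *\<^sub>v v) $ j)" .
  qed
  also have "\<dots> = cinner u (mat_adjoint A *\<^sub>v v)"
    using carrier_matD(1)[OF mat_adjoint_carrier[OF A]] by (simp only: cinner_def dim_mult_mat_vec)
  finally show ?thesis .
qed

lemma cinner_smult:
  "cinner (a \<cdot>\<^sub>v u) v = (a :: complex) * cinner u v" if "dim_vec u = dim_vec v"
  using that by (simp add: cinner_def sum_distrib_left mult_ac)

lemma cinner_smult_right: "cinner u (a \<cdot>\<^sub>v v) = cnj a * cinner u v"
  by (simp add: cinner_def sum_distrib_left mult_ac)

section \<open>Decomposition of a vector into eigenvectors of a Hermitian matrix\<close>

definition eigen_of :: "complex mat \<Rightarrow> nat \<Rightarrow> complex \<Rightarrow> complex vec \<Rightarrow> bool" where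
  "eigen_of A N e u \<longleftrightarrow> u \<in> carrier_vec N \<and> A *\<^sub>v u = e \<cdot>\<^sub>v u"

text \<open>The condition reads \<open>a \<noteq> cnj b\<close> because eigenvalues are not yet
  known to be real. Applied to u = v it shows that a non-real eigenvalue has only the zero
  eigenvector; \<open>eigen_of\<close> admits the zero vector for every \<open>e\<close>.\<close>

lemma hermitian_eigen_orthogonal:
  assumes A: "A \<in> carrier_mat N N" "mat_adjoint A = A"
    and u: "eigen_of A N a u" and v: "eigen_of A N b v" and ne: "a \<noteq> cnj b"
  shows "cinner u v = 0"
proof -
  have c: "u \<in> carrier_vec N" "v \<in> carrier_vec N" using u v by (auto simp: eigen_of_def)
  have "a * cinner u v = cinner (A *\<^sub>v u) v" using u c by (simp add: eigen_of_def cinner_smult)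
  also have "\<dots> = cinner u (A *\<^sub>v v)" using cinner_mult_adjoint[OF A(1) c] A(2) by simp
  also have "\<dots> = cnj b * cinner u v" using v by (simp add: eigen_of_def cinner_smult_right)
  finally show ?thesis using ne by simp
qed

lemma hermitian_eigen_nonreal:
  assumes A: "A \<in> carrier_mat N N" "mat_adjoint A = A" and u: "eigen_of A N a u" and "a \<noteq> cnj a"
  shows "u = 0\<^sub>v N"
  using hermitian_eigen_orthogonal[OF A u u assms(4)] u vnorm_eq_0[of u N]
  by (simp add: cinner_self eigen_of_def)

definition shift_mat :: "complex mat \<Rightarrow> nat \<Rightarrow> complex \<Rightarrow> complex vec \<Rightarrow> complex vec" where
  "shift_mat A N b v = A *\<^sub>v v - b \<cdot>\<^sub>v v"

lemma shift_zero_iff_eigen: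
  assumes "A \<in> carrier_mat N N" "v \<in> carrier_vec N"
  shows "shift_mat A N b v = 0\<^sub>v N \<longleftrightarrow> eigen_of A N b v"
proof
  assume "shift_mat A N b v = 0\<^sub>v N"
  then have "(shift_mat A N b v) $ i = 0" if "i < N" for i using that by simp
  then show "eigen_of A N b v"
    using assms by (auto simp: shift_mat_def eigen_of_def intro!: eq_vecI)
next
  assume "eigen_of A N b v" then show "shift_mat A N b v = 0\<^sub>v N"
    using assms by (auto simp: shift_mat_def eigen_of_def)
qed

text \<open>A Hermitian matrix has no Jordan block of size two. For real b and w = (A - b) v one has
  <w, w> = <(A - b) v, w> = <v, (A - b) w> = 0. For non-real b the vector w is zero already because
  it is an eigenvector.\<close>

lemma hermitian_shift_square:
  assumes A: "A \<in> carrier_mat N N" "mat_adjoint A = A" and v: "v \<in> carrier_vec N"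
    and w: "eigen_of A N b (shift_mat A N b v)"
  shows "shift_mat A N b v = 0\<^sub>v N"
proof (cases "b = cnj b")
  case True
  let ?w = "shift_mat A N b v"
  have wc: "?w \<in> carrier_vec N" using w by (simp add: eigen_of_def)
  have "cinner ?w ?w = cinner (A *\<^sub>v v) ?w - b * cinner v ?w"
    using A v by (simp add: shift_mat_def cinner_def sum_subtractf left_diff_distrib sum_distrib_left mult.assoc)
  also have "cinner (A *\<^sub>v v) ?w = cinner v (A *\<^sub>v ?w)" using cinner_mult_adjoint[OF A(1) v wc] A(2) by simp
  also have "\<dots> = b * cinner v ?w" using w True[symmetric] by (simp add: eigen_of_def cinner_smult_right)
  finally have "vnorm ?w = 0" by (simp add: cinner_self)
  then show ?thesis using vnorm_eq_0[OF wc] by simp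
next
  case False
  then show ?thesis using hermitian_eigen_nonreal[OF A w] by simp
qed

text \<open>One component per real eigenvalue instead of an orthonormal eigenbasis. Components with
  distinct indices are orthogonal automatically, and no basis has to be chosen inside an
  eigenspace.\<close>

definition eigen_decomp :: "complex mat \<Rightarrow> nat \<Rightarrow> complex vec \<Rightarrow> real set \<Rightarrow> (real \<Rightarrow> complex vec) \<Rightarrow> bool" where
  "eigen_decomp A N v E u \<longleftrightarrow> finite E \<and> (\<forall>e\<in>E. eigen_of A N (of_real e) (u e)) \<and>
     (\<forall>i<N. v $ i = (\<Sum>e\<in>E. u e $ i))"

lemma index_mult_eigen_sum:
  assumes F: "F \<in> carrier_mat N N" and v: "v \<in> carrier_vec N" and fin: "finite E"
    and F_eigen: "\<And>e. e \<in> E \<Longrightarrow> u e \<in> carrier_vec N \<and> F *\<^sub>v u e = \<phi> e \<cdot>\<^sub>v u e"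
    and sum: "\<And>i. i < N \<Longrightarrow> v $ i = (\<Sum>e\<in>E. u e $ i)" and i: "i < N"
  shows "(F *\<^sub>v v) $ i = (\<Sum>e\<in>E. \<phi> e * u e $ i)"
proof -
  have "(F *\<^sub>v v) $ i = (\<Sum>j<N. \<Sum>e\<in>E. F $$ (i, j) * u e $ j)"
    by (simp add: index_mult_mat_vec_sum[OF F v i] sum sum_distrib_left)
  also have "\<dots> = (\<Sum>e\<in>E. \<Sum>j<N. F $$ (i, j) * u e $ j)" by (rule sum.swap)
  also have "\<dots> = (\<Sum>e\<in>E. (F *\<^sub>v u e) $ i)"
  proof (rule sum.cong[OF refl])
    fix e assume "e \<in> E"
    then have "u e \<in> carrier_vec N" using F_eigen by blast
    then show "(\<Sum>j<N. F $$ (i, j) * u e $ j) = (F *\<^sub>v u e) $ i"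
      by (rule index_mult_mat_vec_sum[OF F _ i, symmetric])
  qed
  also have "\<dots> = (\<Sum>e\<in>E. \<phi> e * u e $ i)"
  proof (rule sum.cong[OF refl])
    fix e assume "e \<in> E"
    then have "u e \<in> carrier_vec N" "F *\<^sub>v u e = \<phi> e \<cdot>\<^sub>v u e" using F_eigen by blast+
    then show "(F *\<^sub>v u e) $ i = \<phi> e * u e $ i" using i by simp
  qed
  finally show ?thesis .
qed

text \<open>If (A - b) v splits into eigenvectors w_e, then dividing w_e by e - b for e \<noteq> b
  gives the corresponding components of v. What remains of v is mapped by A - b to the possible
  component at e = b, hence into the eigenspace of b, and \<open>hermitian_shift_square\<close>
  makes the remainder itself an eigenvector for b.\<close>

lemma eigen_decomp_shift:
  assumes A: "A \<in> carrier_mat N N" "mat_adjoint A = A" and v: "v \<in> carrier_vec N"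
    and D: "eigen_decomp A N (shift_mat A N b v) E w"
  shows "\<exists>E' u. eigen_decomp A N v E' u"
proof -
  define E1 where "E1 = {e \<in> E. of_real e \<noteq> b}"
  define u where "u e = (1 / (of_real e - b)) \<cdot>\<^sub>v w e" for e
  have fin: "finite E" "finite E1" and wE: "\<And>e. e \<in> E \<Longrightarrow> eigen_of A N (of_real e) (w e)"
    and wsum: "\<And>i. i < N \<Longrightarrow> shift_mat A N b v $ i = (\<Sum>e\<in>E. w e $ i)"
    using D by (auto simp: eigen_decomp_def E1_def)
  have wc: "w e \<in> carrier_vec N" if "e \<in> E" for e using wE[OF that] by (simp add: eigen_of_def)
  have uE: "eigen_of A N (of_real e) (u e)" if "e \<in> E1" for e
    using wE[of e] that A by (auto simp: eigen_of_def u_def E1_def mult_mat_vec smult_smult_assoc mult.commute)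
  define s where "s = vec N (\<lambda>i. \<Sum>e\<in>E1. u e $ i)"
  have sc: "s \<in> carrier_vec N" by (simp add: s_def)
  have As: "(A *\<^sub>v s) $ i = (\<Sum>e\<in>E1. of_real e * u e $ i)" if "i < N" for i
    using that uE by (intro index_mult_eigen_sum[OF A(1) sc fin(2)]) (auto simp: s_def eigen_of_def)
  define v' where "v' = v - s"
  have v'c: "v' \<in> carrier_vec N" using v sc by (simp add: v'_def)
  have Av': "A *\<^sub>v v' = A *\<^sub>v v - A *\<^sub>v s"
    unfolding v'_def using A v sc by (simp add: mult_minus_distrib_mat_vec)
  have sh: "shift_mat A N b v' $ i = (\<Sum>e\<in>E - E1. w e $ i)" if i: "i < N" for i
  proof -
    have "shift_mat A N b v' $ i = shift_mat A N b v $ i - ((A *\<^sub>v s) $ i - b * s $ i)"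
      using A v sc i unfolding shift_mat_def Av' by (simp add: v'_def algebra_simps)
    also have "(A *\<^sub>v s) $ i - b * s $ i = (\<Sum>e\<in>E1. (of_real e - b) * u e $ i)"
      unfolding As[OF i] using i by (simp add: s_def sum_distrib_left left_diff_distrib sum_subtractf)
    also have "\<dots> = (\<Sum>e\<in>E1. w e $ i)"
    proof (rule sum.cong[OF refl])
      fix e assume e: "e \<in> E1"
      then have "w e \<in> carrier_vec N" using wc by (auto simp: E1_def)
      then show "(of_real e - b) * u e $ i = w e $ i" using e i by (simp add: u_def E1_def)
    qed
    finally show ?thesis
      using wsum[OF i] fin by (simp add: sum_diff E1_def)
  qed
  have "eigen_of A N b (shift_mat A N b v')"
  proof (cases "\<exists>e\<in>E. of_real e = b")
    case True
    then obtain e where e: "e \<in> E" "of_real e = b" by blast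
    then have "E - E1 = {e}" by (auto simp: E1_def)
    with sh have "shift_mat A N b v' = w e"
      using wc[OF e(1)] A v'c by (intro eq_vecI) (auto simp: shift_mat_def)
    then show ?thesis using wE[OF e(1)] e(2) by simp
  next
    case False
    then have "E - E1 = {}" by (auto simp: E1_def)
    with sh have "shift_mat A N b v' = 0\<^sub>v N"
      using A v'c by (intro eq_vecI) (auto simp: shift_mat_def)
    then show ?thesis using mult_mat_zero_vec[OF A(1)] by (auto simp: eigen_of_def intro!: eq_vecI)
  qed
  from hermitian_shift_square[OF A v'c this] have v'e: "eigen_of A N b v'"
    using shift_zero_iff_eigen[OF A(1) v'c] by simp
  have vs: "v $ i = v' $ i + (\<Sum>e\<in>E1. u e $ i)" if "i < N" for i
    using that v by (simp add: v'_def s_def)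
  show ?thesis
  proof (cases "b = cnj b")
    case True
    then have b: "b = of_real (Re b)" by (simp add: complex_eq_iff)
    have nin: "Re b \<notin> E1" using b by (auto simp: E1_def)
    have "(\<Sum>e\<in>E1. ((u(Re b := v')) e) $ i) = (\<Sum>e\<in>E1. u e $ i)" for i
      using nin by (intro sum.cong) auto
    then have "eigen_decomp A N v (insert (Re b) E1) (u(Re b := v'))"
      unfolding eigen_decomp_def using uE v'e b nin fin vs by auto
    then show ?thesis by blast
  next
    case False
    then have "v' = 0\<^sub>v N" using hermitian_eigen_nonreal[OF A v'e] by simp
    then have "eigen_decomp A N v E1 u" unfolding eigen_decomp_def using uE fin vs by auto
    then show ?thesis by blast
  qed
qed

text \<open>Schur triangularisation supplies Q A = B Q with B upper triangular. If only the first k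
  + 1 coordinates of Q v can be nonzero, then after replacing v by (A - B_kk) v only the first k can
  be. Such shifts bring every vector down to zero, and \<open>eigen_decomp_shift\<close> undoes them
  one at a time.\<close>

lemma hermitian_eigen_decomp:
  assumes A: "A \<in> carrier_mat N N" "mat_adjoint A = A" and v: "v \<in> carrier_vec N"
  obtains E u where "eigen_decomp A N v E u"
proof -
  obtain es where "char_poly A = (\<Prod>a\<leftarrow>es. [:- a, 1:])" using char_poly_factorized[OF A(1)] by blast
  from schur_decomposition_exists[OF A(1) this] obtain B P Q where
    B: "B \<in> carrier_mat N N" "upper_triangular B" and sim: "similar_mat_wit A B P Q"
    by (auto simp: similar_mat_def)
  note S = similar_mat_witD2[OF A(1) sim]
  have Q: "Q \<in> carrier_mat N N" and QA: "Q * A = B * Q"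
  proof -
    show Q: "Q \<in> carrier_mat N N" using S by auto
    have "A = P * (B * Q)" using S by (simp add: assoc_mult_mat[of P N N B N Q N])
    then have "Q * A = Q * (P * (B * Q))" by simp
    also have "\<dots> = Q * P * (B * Q)"
      using S B Q by (intro assoc_mult_mat[symmetric, of Q N N P N "B * Q" N]) auto
    also have "\<dots> = 1\<^sub>m N * (B * Q)" using S by (simp only:)
    also have "\<dots> = B * Q" using B Q by (intro left_mult_one_mat) auto
    finally show "Q * A = B * Q" .
  qed
  have "\<exists>E u. eigen_decomp A N v E u" if "k \<le> N" "\<forall>i<N. i \<ge> k \<longrightarrow> (Q *\<^sub>v v) $ i = 0" "v \<in> carrier_vec N" for k v
    using that
  proof (induction k arbitrary: v)
    case 0
    then have "Q *\<^sub>v v = 0\<^sub>v N" using Q by (intro eq_vecI) auto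
    then have "P *\<^sub>v (Q *\<^sub>v v) = 0\<^sub>v N" using S mult_mat_zero_vec[of P N] by simp
    moreover have "P *\<^sub>v (Q *\<^sub>v v) = v"
      using S 0(3) Q by (simp flip: assoc_mult_mat_vec)
    ultimately have "v = 0\<^sub>v N" by simp
    then have "eigen_decomp A N v {} (\<lambda>_. 0\<^sub>v N)" by (simp add: eigen_decomp_def)
    then show ?case by blast
  next
    case (Suc k)
    let ?b = "B $$ (k, k)" and ?w = "shift_mat A N (B $$ (k, k)) v"
    have wc: "?w \<in> carrier_vec N" using A Suc(4) by (simp add: shift_mat_def)
    have Qv: "Q *\<^sub>v v \<in> carrier_vec N" using Q Suc(4) by simp
    have "Q *\<^sub>v ?w = B *\<^sub>v (Q *\<^sub>v v) - ?b \<cdot>\<^sub>v (Q *\<^sub>v v)"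
    proof -
      have "Q *\<^sub>v ?w = Q *\<^sub>v (A *\<^sub>v v) - ?b \<cdot>\<^sub>v (Q *\<^sub>v v)"
        unfolding shift_mat_def using Q A Suc(4) by (simp add: mult_minus_distrib_mat_vec mult_mat_vec)
      also have "Q *\<^sub>v (A *\<^sub>v v) = B *\<^sub>v (Q *\<^sub>v v)"
        using Q A B Suc(4) QA by (metis assoc_mult_mat_vec)
      finally show ?thesis .
    qed
    then have ind: "(Q *\<^sub>v ?w) $ i = (\<Sum>j<N. B $$ (i, j) * (Q *\<^sub>v v) $ j) - ?b * (Q *\<^sub>v v) $ i" if "i < N" for i
      using that B Qv Q by (simp add: index_mult_mat_vec_sum[OF B(1) Qv])
    have "\<forall>i<N. i \<ge> k \<longrightarrow> (Q *\<^sub>v ?w) $ i = 0"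
    proof (intro allI impI)
      fix i assume i: "i < N" "k \<le> i"
      have "(\<Sum>j<N. B $$ (i, j) * (Q *\<^sub>v v) $ j) = (\<Sum>j<N. if j = k then B $$ (i, k) * (Q *\<^sub>v v) $ k else 0)"
      proof (rule sum.cong[OF refl])
        fix j assume j: "j \<in> {..<N}"
        show "B $$ (i, j) * (Q *\<^sub>v v) $ j = (if j = k then B $$ (i, k) * (Q *\<^sub>v v) $ k else 0)"
        proof (cases "j < k")
          case True
          then have "B $$ (i, j) = 0" using upper_triangularD[OF B(2), of j i] B(1) i by auto
          then show ?thesis using True by simp
        next
          case False
          then show ?thesis using Suc(3) j by auto
        qed
      qed
      also have "\<dots> = B $$ (i, k) * (Q *\<^sub>v v) $ k" using Suc(2) by simp
      finally have e: "(Q *\<^sub>v ?w) $ i = B $$ (i, k) * (Q *\<^sub>v v) $ k - ?b * (Q *\<^sub>v v) $ i" using ind[OF i(1)] by simp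
      show "(Q *\<^sub>v ?w) $ i = 0"
      proof (cases "i = k")
        case True then show ?thesis using e by simp
      next
        case False
        then have "B $$ (i, k) = 0" using upper_triangularD[OF B(2), of k i] B(1) i by auto
        moreover have "(Q *\<^sub>v v) $ i = 0" using Suc(3) i False by auto
        ultimately show ?thesis using e by simp
      qed
    qed
    from Suc(1)[OF _ this wc] Suc(2) obtain E w where "eigen_decomp A N ?w E w" by auto
    then show ?case by (rule eigen_decomp_shift[OF A Suc(4)])
  qed
  from this[of N v] v show ?thesis using that by auto
qed

text \<open>The scalars \<phi> let one statement serve twice: with \<phi> = 1 it gives the norm of a
  vector, and with the values of a function on the spectrum it gives the norm of the image.\<close>

lemma pythagoras:
  assumes fin: "finite E" and car: "\<And>e. e \<in> E \<Longrightarrow> u e \<in> carrier_vec N"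
    and orth: "\<And>e e'. e \<in> E \<Longrightarrow> e' \<in> E \<Longrightarrow> e \<noteq> e' \<Longrightarrow> cinner (u e) (u e') = 0"
    and v: "v \<in> carrier_vec N" "\<And>i. i < N \<Longrightarrow> v $ i = (\<Sum>e\<in>E. \<phi> e * u e $ i)"
  shows "(vnorm v)\<^sup>2 = (\<Sum>e\<in>E. (cmod (\<phi> e))\<^sup>2 * (vnorm (u e))\<^sup>2)"
proof -
  have "complex_of_real ((vnorm v)\<^sup>2) = (\<Sum>i<N. (\<Sum>e\<in>E. \<phi> e * u e $ i) * cnj (\<Sum>e'\<in>E. \<phi> e' * u e' $ i))"
    unfolding cinner_self[symmetric] cinner_def using v by (intro sum.cong) auto
  also have "\<dots> = (\<Sum>i<N. \<Sum>e\<in>E. \<Sum>e'\<in>E. (\<phi> e * u e $ i) * cnj (\<phi> e' * u e' $ i))"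
    by (simp only: cnj_sum sum_product)
  also have "\<dots> = (\<Sum>e\<in>E. \<Sum>i<N. \<Sum>e'\<in>E. (\<phi> e * u e $ i) * cnj (\<phi> e' * u e' $ i))" by (rule sum.swap)
  also have "\<dots> = (\<Sum>e\<in>E. \<Sum>e'\<in>E. \<Sum>i<N. (\<phi> e * u e $ i) * cnj (\<phi> e' * u e' $ i))"
    by (intro sum.cong refl sum.swap)
  also have "\<dots> = (\<Sum>e\<in>E. \<Sum>e'\<in>E. \<phi> e * cnj (\<phi> e') * cinner (u e) (u e'))"
  proof (intro sum.cong refl)
    fix e e' assume "e \<in> E" "e' \<in> E"
    then have "dim_vec (u e') = N" using car by auto
    then show "(\<Sum>i<N. (\<phi> e * u e $ i) * cnj (\<phi> e' * u e' $ i)) = \<phi> e * cnj (\<phi> e') * cinner (u e) (u e')"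
      by (simp add: cinner_def sum_distrib_left mult_ac)
  qed
  also have "\<dots> = (\<Sum>e\<in>E. \<Sum>e'\<in>E. if e' = e then of_real ((cmod (\<phi> e))\<^sup>2 * (vnorm (u e))\<^sup>2) else 0)"
  proof (intro sum.cong refl)
    fix e e' assume ee: "e \<in> E" "e' \<in> E"
    show "\<phi> e * cnj (\<phi> e') * cinner (u e) (u e') = (if e' = e then of_real ((cmod (\<phi> e))\<^sup>2 * (vnorm (u e))\<^sup>2) else 0)"
    proof (cases "e' = e")
      case True
      then show ?thesis by (simp only: complex_norm_square[symmetric] cinner_self of_real_mult simp_thms if_True)
    next
      case False
      then show ?thesis using orth[OF ee] by simp
    qed
  qed
  also have "\<dots> = of_real (\<Sum>e\<in>E. (cmod (\<phi> e))\<^sup>2 * (vnorm (u e))\<^sup>2)" using fin by simp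
  finally show ?thesis by (simp only: of_real_eq_iff)
qed

text \<open>A substitute for a functional calculus: F need only act as a scalar on each eigenvector.
  The hypothesis is restricted to nonzero u because the zero vector counts as an eigenvector for
  every real e, also where \<phi> obeys no bound. Zero components are therefore dropped from the
  decomposition first.\<close>

lemma hermitian_function_norm_bound:
  assumes A: "A \<in> carrier_mat N N" "mat_adjoint A = A"
    and F: "F \<in> carrier_mat N N"
    and F_eigen: "\<And>e u. eigen_of A N (of_real e) u \<Longrightarrow> u \<noteq> 0\<^sub>v N \<Longrightarrow> F *\<^sub>v u = \<phi> e \<cdot>\<^sub>v u \<and> cmod (\<phi> e) \<le> \<eta>"
    and v: "v \<in> carrier_vec N" and eta: "\<eta> \<ge> 0"
  shows "vnorm (F *\<^sub>v v) \<le> \<eta> * vnorm v"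
proof -
  obtain E0 u where D0: "eigen_decomp A N v E0 u" by (rule hermitian_eigen_decomp[OF A v])
  define E where "E = {e \<in> E0. u e \<noteq> 0\<^sub>v N}"
  have D: "finite E" "\<And>e. e \<in> E \<Longrightarrow> eigen_of A N (of_real e) (u e)" "\<And>e. e \<in> E \<Longrightarrow> u e \<noteq> 0\<^sub>v N"
    using D0 by (auto simp: eigen_decomp_def E_def)
  have vs: "v $ i = (\<Sum>e\<in>E. u e $ i)" if "i < N" for i
  proof -
    have "(\<Sum>e\<in>E. u e $ i) = (\<Sum>e\<in>E0. u e $ i)"
      using D0 that by (intro sum.mono_neutral_left) (auto simp: eigen_decomp_def E_def)
    then show ?thesis using D0 that by (simp add: eigen_decomp_def)
  qed
  have car: "u e \<in> carrier_vec N" if "e \<in> E" for e using D(2)[OF that] by (simp add: eigen_of_def)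
  have orth: "cinner (u e) (u e') = 0" if "e \<in> E" "e' \<in> E" "e \<noteq> e'" for e e'
    using hermitian_eigen_orthogonal[OF A D(2)[OF that(1)] D(2)[OF that(2)]] that(3) by simp
  have "(vnorm (F *\<^sub>v v))\<^sup>2 = (\<Sum>e\<in>E. (cmod (\<phi> e))\<^sup>2 * (vnorm (u e))\<^sup>2)"
    using F v D F_eigen car vs
    by (intro pythagoras[OF D(1) car orth]) (auto intro!: index_mult_eigen_sum[OF F v D(1)])
  also have "\<dots> \<le> (\<Sum>e\<in>E. \<eta>\<^sup>2 * (vnorm (u e))\<^sup>2)"
    using F_eigen D by (intro sum_mono mult_right_mono power_mono) auto
  also have "\<dots> = \<eta>\<^sup>2 * (\<Sum>e\<in>E. (cmod 1)\<^sup>2 * (vnorm (u e))\<^sup>2)" by (simp add: sum_distrib_left)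
  also have "(\<Sum>e\<in>E. (cmod 1)\<^sup>2 * (vnorm (u e))\<^sup>2) = (vnorm v)\<^sup>2"
    using v vs by (intro pythagoras[OF D(1) car orth, symmetric]) auto
  finally have "(vnorm (F *\<^sub>v v))\<^sup>2 \<le> (\<eta> * vnorm v)\<^sup>2" by (simp add: power_mult_distrib)
  then show ?thesis using eta by (simp add: power2_le_iff_abs_le)
qed

section \<open>Operator norm\<close>

lemma braket_bound:
  assumes "phi \<in> carrier_vec N" "M \<in> carrier_mat N N" "psi \<in> carrier_vec N"
  shows "cmod (braket phi M psi) \<le> vnorm phi * vnorm (M *\<^sub>v psi)"
proof -
  have "cmod (braket phi M psi) \<le> (\<Sum>i<N. \<bar>cmod (phi $ i)\<bar> * \<bar>cmod ((M *\<^sub>v psi) $ i)\<bar>)"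
    using assms unfolding braket_def by (intro sum_norm_le order.trans[OF sum_norm_le]) (auto simp: norm_mult intro!: sum_mono)
  also have "\<dots> \<le> L2_set (\<lambda>i. cmod (phi $ i)) {..<N} * L2_set (\<lambda>i. cmod ((M *\<^sub>v psi) $ i)) {..<N}"
    by (rule L2_set_mult_ineq)
  finally show ?thesis using assms by (simp add: vnorm_L2)
qed

text \<open>The supremum in \<open>op_norm\<close> is informative only for a bounded set; the sum of
  the moduli of all entries is a crude but sufficient bound.\<close>

lemma bdd_above_op_norm:
  assumes M: "M \<in> carrier_mat N N"
  shows "bdd_above {vnorm (M *\<^sub>v v) | v. v \<in> carrier_vec (dim_col M) \<and> vnorm v = 1}"
proof (rule bdd_aboveI)
  fix x assume "x \<in> {vnorm (M *\<^sub>v v) | v. v \<in> carrier_vec (dim_col M) \<and> vnorm v = 1}"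
  then obtain v where v: "v \<in> carrier_vec N" "vnorm v = 1" and x: "x = vnorm (M *\<^sub>v v)" using M by auto
  have v1: "cmod (v $ j) \<le> 1" if "j < N" for j
    using member_le_L2_set[of "{..<N}" j "\<lambda>i. cmod (v $ i)"] v that by (simp add: vnorm_L2)
  have "x \<le> (\<Sum>i<N. cmod ((M *\<^sub>v v) $ i))"
    unfolding x vnorm_L2 using M by (simp add: L2_set_le_sum)
  also have "\<dots> \<le> (\<Sum>i<N. \<Sum>j<N. cmod (M $$ (i, j)))"
  proof (rule sum_mono)
    fix i assume "i \<in> {..<N}"
    then show "cmod ((M *\<^sub>v v) $ i) \<le> (\<Sum>j<N. cmod (M $$ (i, j)))"
      using v1 by (auto simp: index_mult_mat_vec_sum[OF M v(1)] norm_mult intro!: sum_norm_le mult_left_le)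
  qed
  finally show "x \<le> (\<Sum>i<N. \<Sum>j<N. cmod (M $$ (i, j)))" .
qed

lemma op_norm_bound:
  assumes M: "M \<in> carrier_mat N N" and v: "v \<in> carrier_vec N"
  shows "vnorm (M *\<^sub>v v) \<le> op_norm M * vnorm v"
proof (cases "vnorm v = 0")
  case True
  then have "v = 0\<^sub>v N" using vnorm_eq_0[OF v] by simp
  moreover have "M *\<^sub>v 0\<^sub>v N = 0\<^sub>v N" by (rule mult_mat_zero_vec[OF M])
  ultimately show ?thesis using vnorm_eq_0[of "0\<^sub>v N" N] by simp
next
  case False
  let ?a = "complex_of_real (1 / vnorm v)"
  have "vnorm (?a \<cdot>\<^sub>v v) = 1" using False by (simp add: vnorm_smult norm_divide)
  then have "vnorm (M *\<^sub>v (?a \<cdot>\<^sub>v v)) \<le> op_norm M"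
    unfolding op_norm_def using M v by (intro cSup_upper bdd_above_op_norm) auto
  also have "vnorm (M *\<^sub>v (?a \<cdot>\<^sub>v v)) = vnorm (M *\<^sub>v v) / vnorm v"
    using M v by (simp add: mult_mat_vec vnorm_smult norm_divide)
  finally have le: "vnorm (M *\<^sub>v v) / vnorm v \<le> op_norm M" .
  have "vnorm v > 0" using False vnorm_nonneg[of v] by (simp only: less_le) simp
  from le show ?thesis unfolding pos_divide_le_eq[OF \<open>vnorm v > 0\<close>] .
qed

lemma op_norm_le:
  assumes M: "M \<in> carrier_mat N N" and N: "N > 0"
    and bound: "\<And>v. v \<in> carrier_vec N \<Longrightarrow> vnorm v = 1 \<Longrightarrow> vnorm (M *\<^sub>v v) \<le> B"
  shows "op_norm M \<le> B"
  unfolding op_norm_def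
proof (rule cSup_least)
  have "vnorm (unit_vec N 0) = 1"
    using N by (simp add: vnorm_def unit_vec_def if_distrib[of cmod] if_distrib[of "\<lambda>x. x\<^sup>2"] cong: if_cong)
  then show "{vnorm (M *\<^sub>v v) | v. v \<in> carrier_vec (dim_col M) \<and> vnorm v = 1} \<noteq> {}"
    using M by (auto intro!: exI[of _ "unit_vec N 0"])
qed (use M bound in auto)

lemma op_norm_nonneg:
  assumes M: "M \<in> carrier_mat N N" and N: "N > 0" shows "op_norm M \<ge> 0"
proof -
  have "vnorm (unit_vec N 0) = 1"
    using N by (simp add: vnorm_def unit_vec_def if_distrib[of cmod] if_distrib[of "\<lambda>x. x\<^sup>2"] cong: if_cong)
  then have "vnorm (M *\<^sub>v unit_vec N 0) \<le> op_norm M" using op_norm_bound[OF M, of "unit_vec N 0"] by simp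
  then show ?thesis by (rule order.trans[OF vnorm_nonneg])
qed

section \<open>The matrix exponential and its action on eigenvectors\<close>

lemma mat_pow_entry_bound:
  assumes M: "M \<in> carrier_mat N N" and m: "\<And>i j. i < N \<Longrightarrow> j < N \<Longrightarrow> cmod (M $$ (i, j)) \<le> m" and m0: "m \<ge> 0"
    and "i < N" "j < N"
  shows "cmod ((M ^\<^sub>m k) $$ (i, j)) \<le> (real N * m) ^ k"
  using assms(4,5)
proof (induction k arbitrary: i j)
  case 0 then show ?case using M by simp
next
  case (Suc k)
  have "cmod ((M ^\<^sub>m Suc k) $$ (i, j)) = cmod (\<Sum>l<N. (M ^\<^sub>m k) $$ (i, l) * M $$ (l, j))"
    using Suc(2,3) by (simp add: index_mult_mat_sum[OF pow_carrier_mat[OF M] M])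
  also have "\<dots> \<le> (\<Sum>l<N. (real N * m) ^ k * m)"
    unfolding norm_mult using Suc m m0
    by (intro sum_norm_le) (auto simp: norm_mult intro!: mult_mono)
  also have "\<dots> = (real N * m) ^ Suc k" by simp
  finally show ?case .
qed

lemma mat_exp_entry_summable:
  fixes M :: "complex mat"
  assumes M: "M \<in> carrier_mat N N" and ij: "i < N" "j < N"
  shows "summable (\<lambda>k. (M ^\<^sub>m k) $$ (i, j) / of_nat (fact k))"
proof -
  define m where "m = (\<Sum>i<N. \<Sum>j<N. cmod (M $$ (i, j)))"
  have m: "cmod (M $$ (i, j)) \<le> m" if "i < N" "j < N" for i j
  proof -
    have "cmod (M $$ (i, j)) \<le> (\<Sum>j<N. cmod (M $$ (i, j)))"
      using that by (intro member_le_sum) auto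
    also have "\<dots> \<le> m" unfolding m_def
      using that by (intro member_le_sum[of i "{..<N}" "\<lambda>i. \<Sum>j<N. cmod (M $$ (i, j))"]) (auto intro: sum_nonneg)
    finally show ?thesis .
  qed
  have m0: "m \<ge> 0" by (simp add: m_def sum_nonneg)
  have "summable (\<lambda>k. inverse (fact k) * (real N * m) ^ k)" by (rule summable_exp)
  then show ?thesis
  proof (rule summable_comparison_test'[where N = 0])
    fix k :: nat
    have "cmod ((M ^\<^sub>m k) $$ (i, j) / of_nat (fact k)) = cmod ((M ^\<^sub>m k) $$ (i, j)) / fact k"
      by (simp add: norm_divide)
    also have "\<dots> \<le> (real N * m) ^ k / fact k"
      by (intro divide_right_mono mat_pow_entry_bound[OF M m m0 ij]) auto
    finally show "cmod ((M ^\<^sub>m k) $$ (i, j) / of_nat (fact k)) \<le> inverse (fact k) * (real N * m) ^ k"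
      by (simp add: field_simps)
  qed
qed

lemma mat_pow_eigen:
  fixes M :: "complex mat"
  assumes M: "M \<in> carrier_mat N N" and u: "u \<in> carrier_vec N" and e: "M *\<^sub>v u = e \<cdot>\<^sub>v u"
  shows "(M ^\<^sub>m k) *\<^sub>v u = e ^ k \<cdot>\<^sub>v u"
proof (induction k)
  case 0 then show ?case using M u by simp
next
  case (Suc k)
  have "(M ^\<^sub>m Suc k) *\<^sub>v u = (M ^\<^sub>m k) *\<^sub>v (M *\<^sub>v u)"
    using M u by (simp add: assoc_mult_mat_vec[OF pow_carrier_mat[OF M] M])
  also have "\<dots> = e ^ Suc k \<cdot>\<^sub>v u" unfolding e
    using M u Suc by (simp add: mult_mat_vec[OF pow_carrier_mat[OF M] u] smult_smult_assoc)
  finally show ?case .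
qed

lemma mat_exp_carrier [simp]: "M \<in> carrier_mat N N \<Longrightarrow> mat_exp M \<in> carrier_mat N N"
  by (auto simp: mat_exp_def)

text \<open>Since \<open>mat_exp\<close> is defined entrywise, the finite sum of the matrix-vector
  product has to be exchanged with the series; summability of every entry justifies this.\<close>

lemma mat_exp_eigen:
  assumes M: "M \<in> carrier_mat N N" and u: "u \<in> carrier_vec N" and e: "M *\<^sub>v u = e \<cdot>\<^sub>v u"
  shows "mat_exp M *\<^sub>v u = exp e \<cdot>\<^sub>v u"
proof (rule eq_vecI)
  fix i assume "i < dim_vec (exp e \<cdot>\<^sub>v u)"
  then have i: "i < N" using u by simp
  have "(mat_exp M *\<^sub>v u) $ i = (\<Sum>j<N. (\<Sum>k. (M ^\<^sub>m k) $$ (i, j) / of_nat (fact k)) * u $ j)"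
    unfolding index_mult_mat_vec_sum[OF mat_exp_carrier[OF M] u i] using M i by (simp add: mat_exp_def)
  also have "\<dots> = (\<Sum>j<N. \<Sum>k. (M ^\<^sub>m k) $$ (i, j) / of_nat (fact k) * u $ j)"
    using mat_exp_entry_summable[OF M i] by (intro sum.cong refl suminf_mult2) auto
  also have "\<dots> = (\<Sum>k. \<Sum>j<N. (M ^\<^sub>m k) $$ (i, j) / of_nat (fact k) * u $ j)"
    using mat_exp_entry_summable[OF M i] by (intro suminf_sum[symmetric] summable_mult2) auto
  also have "\<dots> = (\<Sum>k. e ^ k /\<^sub>R fact k * u $ i)"
  proof (rule suminf_cong)
    fix k
    have "(\<Sum>j<N. (M ^\<^sub>m k) $$ (i, j) / of_nat (fact k) * u $ j) = ((M ^\<^sub>m k) *\<^sub>v u) $ i / of_nat (fact k)"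
      by (simp add: index_mult_mat_vec_sum[OF pow_carrier_mat[OF M] u i] sum_divide_distrib del: of_nat_fact)
    also have "\<dots> = e ^ k /\<^sub>R fact k * u $ i"
      unfolding mat_pow_eigen[OF M u e] using u i by (simp add: scaleR_conv_of_real divide_inverse mult_ac)
    finally show "(\<Sum>j<N. (M ^\<^sub>m k) $$ (i, j) / of_nat (fact k) * u $ j) = e ^ k /\<^sub>R fact k * u $ i" .
  qed
  also have "\<dots> = (\<Sum>k. e ^ k /\<^sub>R fact k) * u $ i"
    by (rule suminf_mult2[symmetric]) (rule summable_exp_generic)
  also have "\<dots> = (exp e \<cdot>\<^sub>v u) $ i" using u i by (simp add: exp_def)
  finally show "(mat_exp M *\<^sub>v u) $ i = (exp e \<cdot>\<^sub>v u) $ i" .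
qed (use carrier_matD(1)[OF mat_exp_carrier[OF M]] u in auto)

lemma mat_sum_carrier [simp]: "mat_sum d f S \<in> carrier_mat d d"
  by (simp add: mat_sum_def)

lemma mat_sum_mult_vec:
  assumes "\<And>x. x \<in> S \<Longrightarrow> f x \<in> carrier_mat d d" and v: "v \<in> carrier_vec d" and i: "i < d"
  shows "(mat_sum d f S *\<^sub>v v) $ i = (\<Sum>x\<in>S. (f x *\<^sub>v v) $ i)"
proof -
  have "(mat_sum d f S *\<^sub>v v) $ i = (\<Sum>j<d. \<Sum>x\<in>S. f x $$ (i, j) * v $ j)"
    unfolding index_mult_mat_vec_sum[OF mat_sum_carrier v i] using i by (simp add: mat_sum_def sum_distrib_right)
  also have "\<dots> = (\<Sum>x\<in>S. \<Sum>j<d. f x $$ (i, j) * v $ j)" by (rule sum.swap)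
  also have "\<dots> = (\<Sum>x\<in>S. (f x *\<^sub>v v) $ i)"
    using assms by (intro sum.cong refl) (simp add: index_mult_mat_vec_sum[of _ d])
  finally show ?thesis .
qed

lemma smult_mat_mult_vec:
  assumes "M \<in> carrier_mat d d" "v \<in> carrier_vec d"
  shows "(a \<cdot>\<^sub>m M) *\<^sub>v v = (a :: complex) \<cdot>\<^sub>v (M *\<^sub>v v)"
  using assms by (intro eq_vecI) (auto simp: index_mult_mat_vec_sum[of _ d] sum_distrib_left mult_ac)

text \<open>The function of a real variable that \<open>I_D\<close> evaluates at a matrix.\<close>

definition I_scalar :: "real \<Rightarrow> real \<Rightarrow> real \<Rightarrow> real \<Rightarrow> complex" where
  "I_scalar kt eT eD x = (\<Sum>(j, k)\<in>{..<Jpar kt eT eD} \<times> {..<Kpar kt eT eD}.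
     fs_alpha kt eT eD j k * iexp (- (fs_t kt eT eD j k * x)))"

lemma I_D_eigen:
  assumes M: "M \<in> carrier_mat N N" and u: "eigen_of M N (of_real x) u"
  shows "I_D kt eT eD M *\<^sub>v u = I_scalar kt eT eD x \<cdot>\<^sub>v u"
proof (rule eq_vecI)
  have uc: "u \<in> carrier_vec N" and e: "M *\<^sub>v u = of_real x \<cdot>\<^sub>v u" using u by (auto simp: eigen_of_def)
  fix i assume "i < dim_vec (I_scalar kt eT eD x \<cdot>\<^sub>v u)"
  then have i: "i < N" using uc by simp
  have tm: "(fs_alpha kt eT eD j k \<cdot>\<^sub>m mat_exp ((- \<i> * complex_of_real (fs_t kt eT eD j k)) \<cdot>\<^sub>m M)) *\<^sub>v u
     = (fs_alpha kt eT eD j k * iexp (- (fs_t kt eT eD j k * x))) \<cdot>\<^sub>v u" for j k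
  proof -
    have "mat_exp ((- \<i> * complex_of_real (fs_t kt eT eD j k)) \<cdot>\<^sub>m M) *\<^sub>v u = iexp (- (fs_t kt eT eD j k * x)) \<cdot>\<^sub>v u"
      using mat_exp_eigen[of "(- \<i> * complex_of_real (fs_t kt eT eD j k)) \<cdot>\<^sub>m M" N u
          "(- \<i> * complex_of_real (fs_t kt eT eD j k)) * of_real x"] M uc
      by (simp add: smult_mat_mult_vec e smult_smult_assoc mult.assoc)
    then show ?thesis using M uc by (simp add: smult_mat_mult_vec[of _ N] smult_smult_assoc)
  qed
  define f where "f = (\<lambda>(j, k). fs_alpha kt eT eD j k \<cdot>\<^sub>m mat_exp ((- \<i> * complex_of_real (fs_t kt eT eD j k)) \<cdot>\<^sub>m M))"
  define S where "S = {..<Jpar kt eT eD} \<times> {..<Kpar kt eT eD}"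
  have f: "f p \<in> carrier_mat N N" for p using M by (auto simp: f_def split: prod.split)
  have "I_D kt eT eD M = mat_sum N f S" using M by (simp add: I_D_def f_def S_def)
  then have "(I_D kt eT eD M *\<^sub>v u) $ i = (\<Sum>p\<in>S. (f p *\<^sub>v u) $ i)"
    using mat_sum_mult_vec[OF f uc i] by simp
  also have "\<dots> = (\<Sum>(j, k)\<in>S. fs_alpha kt eT eD j k * iexp (- (fs_t kt eT eD j k * x)) * u $ i)"
    unfolding f_def split_beta tm using uc i by (intro sum.cong refl) simp
  also have "\<dots> = (I_scalar kt eT eD x \<cdot>\<^sub>v u) $ i"
    using uc i by (simp add: I_scalar_def S_def sum_distrib_right split_beta)
  finally show "(I_D kt eT eD M *\<^sub>v u) $ i = (I_scalar kt eT eD x \<cdot>\<^sub>v u) $ i" .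
qed (use M u in \<open>auto simp: I_D_def mat_sum_def eigen_of_def\<close>)

section \<open>Pauli strings and Clifford circuits\<close>

lemma smult_smult_mat: "a \<cdot>\<^sub>m (b \<cdot>\<^sub>m M) = (a * b :: complex) \<cdot>\<^sub>m M"
  by (intro eq_matI) (auto simp: mult.assoc)

lemma one_smult_mat: "(1 :: complex) \<cdot>\<^sub>m M = M"
  by (intro eq_matI) auto

lemma sq_mat_carrier [simp]: "A \<in> carrier_mat m m \<Longrightarrow> B \<in> carrier_mat m m \<Longrightarrow> A * B \<in> carrier_mat m m"
  by (rule mult_carrier_mat)

lemma sq_mat:
  fixes A B C :: "complex mat"
  assumes "A \<in> carrier_mat m m" "B \<in> carrier_mat m m"
  shows "C \<in> carrier_mat m m \<Longrightarrow> A * B * C = A * (B * C)"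
    "C \<in> carrier_mat m m \<Longrightarrow> A * (B + C) = A * B + A * C"
    "C \<in> carrier_mat m m \<Longrightarrow> (A + B) * C = A * C + B * C"
    "A * (a \<cdot>\<^sub>m B) = a \<cdot>\<^sub>m (A * B)" "(a \<cdot>\<^sub>m A) * B = a \<cdot>\<^sub>m (A * B)"
    "a \<cdot>\<^sub>m (A + B) = a \<cdot>\<^sub>m A + a \<cdot>\<^sub>m B"
  using assms by (auto intro: assoc_mult_mat mult_add_distrib_mat add_mult_distrib_mat mult_smult_distrib
      mult_smult_assoc_mat add_smult_distrib_left_mat)

section \<open>Tensor products with one-qubit matrices and the algebra of Pauli strings\<close>

definition kron2 :: "(nat \<Rightarrow> nat \<Rightarrow> complex) \<Rightarrow> complex mat \<Rightarrow> complex mat" where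
  "kron2 a Q = four_block_mat (a 0 0 \<cdot>\<^sub>m Q) (a 0 1 \<cdot>\<^sub>m Q) (a 1 0 \<cdot>\<^sub>m Q) (a 1 1 \<cdot>\<^sub>m Q)"

lemma kron2_carrier [simp]: "Q \<in> carrier_mat m m \<Longrightarrow> kron2 a Q \<in> carrier_mat (2 * m) (2 * m)"
  unfolding kron2_def mult_2 by (intro four_block_carrier_mat) auto

text \<open>A one-qubit matrix is encoded, as in \<open>pauli1\<close>, by a function on all pairs
  of natural numbers of which only four values matter. Products formed by \<open>mul2\<close> may
  differ elsewhere, so identities between such matrices are stated under
  \<open>kron2\<close>.\<close>

lemma kron2_cong:
  "a 0 0 = b 0 0 \<Longrightarrow> a 0 1 = b 0 1 \<Longrightarrow> a 1 0 = b 1 0 \<Longrightarrow> a 1 1 = b 1 1 \<Longrightarrow> kron2 a Q = kron2 b Q"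
  by (simp add: kron2_def)

definition mul2 :: "(nat \<Rightarrow> nat \<Rightarrow> complex) \<Rightarrow> (nat \<Rightarrow> nat \<Rightarrow> complex) \<Rightarrow> nat \<Rightarrow> nat \<Rightarrow> complex" where
  "mul2 a b i j = a i 0 * b 0 j + a i 1 * b 1 j"

lemma kron2_mult:
  assumes Q: "Q \<in> carrier_mat m m" and R: "R \<in> carrier_mat m m"
  shows "kron2 a Q * kron2 b R = kron2 (mul2 a b) (Q * R)"
proof -
  have "x \<cdot>\<^sub>m Q * (y \<cdot>\<^sub>m R) + z \<cdot>\<^sub>m Q * (w \<cdot>\<^sub>m R) = (x * y + z * w) \<cdot>\<^sub>m (Q * R)" for x y z w
    using Q R by (simp add: mult_smult_distrib[of _ m m _ m] mult_smult_assoc_mat[of _ m m _ m] smult_smult_mat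
        add_smult_distrib_right_mat[of _ m m] mult.commute)
  then show ?thesis using Q R
    unfolding kron2_def mul2_def by (subst mult_four_block_mat[of _ m m _ m _ m _ _ m _ m]) auto
qed

lemma kron2_smult:
  assumes "Q \<in> carrier_mat m m"
  shows "kron2 a (z \<cdot>\<^sub>m Q) = z \<cdot>\<^sub>m kron2 a Q" "kron2 (\<lambda>i j. z * a i j) Q = z \<cdot>\<^sub>m kron2 a Q"
  using assms unfolding kron2_def
  by (subst smult_four_block_mat[of _ m m _ m _ m]; simp add: smult_smult_mat mult.commute)+

lemma kron2_PI_one: "kron2 (pauli1 PI) (1\<^sub>m m) = 1\<^sub>m (2 * m)"
proof -
  have "(0::complex) \<cdot>\<^sub>m 1\<^sub>m m = 0\<^sub>m m m" by (intro eq_matI) auto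
  then show ?thesis
    unfolding kron2_def using four_block_one_mat[of m m] by (simp add: pauli1_def one_smult_mat mult_2)
qed

lemma mat_adjoint_kron2:
  assumes Q: "Q \<in> carrier_mat m m"
  shows "mat_adjoint (kron2 a Q) = kron2 (\<lambda>i j. cnj (a j i)) (mat_adjoint Q)"
proof (rule eq_matI)
  have d: "dim_row (mat_adjoint Q) = m" "dim_col (mat_adjoint Q) = m"
    using mat_adjoint_carrier[OF Q] by auto
  have k: "kron2 (\<lambda>i j. cnj (a j i)) (mat_adjoint Q) \<in> carrier_mat (2 * m) (2 * m)"
    using mat_adjoint_carrier[OF Q] by simp
  show "dim_row (mat_adjoint (kron2 a Q)) = dim_row (kron2 (\<lambda>i j. cnj (a j i)) (mat_adjoint Q))"
    "dim_col (mat_adjoint (kron2 a Q)) = dim_col (kron2 (\<lambda>i j. cnj (a j i)) (mat_adjoint Q))"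
    using mat_adjoint_carrier[OF kron2_carrier[OF Q]] k by auto
  fix i j assume "i < dim_row (kron2 (\<lambda>i j. cnj (a j i)) (mat_adjoint Q))"
    "j < dim_col (kron2 (\<lambda>i j. cnj (a j i)) (mat_adjoint Q))"
  then have ij: "i < 2 * m" "j < 2 * m" using k by auto
  show "mat_adjoint (kron2 a Q) $$ (i, j) = kron2 (\<lambda>i j. cnj (a j i)) (mat_adjoint Q) $$ (i, j)"
    unfolding index_mat_adjoint[OF kron2_carrier[OF Q] ij]
    using ij Q d by (auto simp: kron2_def index_mat_adjoint[OF Q])
qed

lemma pauli_mat_carrier [simp]: "pauli_mat ps \<in> carrier_mat (2 ^ length ps) (2 ^ length ps)"
  by (simp add: pauli_mat_def)

lemma pauli_mat_carrier': "length ps = n \<Longrightarrow> pauli_mat ps \<in> carrier_mat (2 ^ n) (2 ^ n)"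
  using pauli_mat_carrier by blast

lemma qbit_Suc: "q < n \<Longrightarrow> qbit (Suc n) (Suc q) i = qbit n q (i mod 2 ^ n)"
proof -
  assume q: "q < n"
  have "(i mod 2 ^ n) div 2 ^ (n - 1 - q) mod 2 = i div 2 ^ (n - 1 - q) mod 2"
  proof -
    have "n = (n - 1 - q) + Suc q" using q by simp
    then have "(2::nat) ^ n = 2 ^ (n - 1 - q) * 2 ^ Suc q" by (metis power_add)
    then have "(2::nat) ^ n = 2 ^ (n - 1 - q) * (2 * 2 ^ q)" by simp
    then have "i mod 2 ^ n = 2 ^ (n - 1 - q) * (i div 2 ^ (n - 1 - q) mod (2 * 2 ^ q)) + i mod 2 ^ (n - 1 - q)"
      by (simp add: mod_mult2_eq)
    then have "(i mod 2 ^ n) div 2 ^ (n - 1 - q) = i div 2 ^ (n - 1 - q) mod (2 * 2 ^ q)" by simp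
    then show ?thesis by (simp add: mod_mod_cancel)
  qed
  then show ?thesis by (simp add: qbit_def)
qed

lemma pauli_mat_Nil: "pauli_mat [] = 1\<^sub>m 1"
  by (intro eq_matI) (auto simp: pauli_mat_def)

lemma pauli_mat_Cons: "pauli_mat (p # ps) = kron2 (pauli1 p) (pauli_mat ps)"
proof (rule eq_matI)
  let ?n = "length ps" and ?m = "2 ^ length ps :: nat"
  have k: "kron2 (pauli1 p) (pauli_mat ps) \<in> carrier_mat (2 * ?m) (2 * ?m)" by (intro kron2_carrier pauli_mat_carrier)
  show "dim_row (pauli_mat (p # ps)) = dim_row (kron2 (pauli1 p) (pauli_mat ps))"
    "dim_col (pauli_mat (p # ps)) = dim_col (kron2 (pauli1 p) (pauli_mat ps))"
    using carrier_matD[OF k] carrier_matD[OF pauli_mat_carrier[of "p # ps"]] by auto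
  fix i j assume "i < dim_row (kron2 (pauli1 p) (pauli_mat ps))" "j < dim_col (kron2 (pauli1 p) (pauli_mat ps))"
  then have ij: "i < 2 * ?m" "j < 2 * ?m" using carrier_matD[OF k] by auto
  have top: "qbit (Suc ?n) 0 l = (if l < ?m then 0 else 1)" if "l < 2 * ?m" for l
  proof (cases "l < ?m")
    case False
    then have "l div ?m = 1" using that by (intro div_nat_eqI) auto
    then show ?thesis using False by (simp add: qbit_def)
  qed (simp add: qbit_def)
  have md: "l mod ?m = (if l < ?m then l else l - ?m)" if "l < 2 * ?m" for l
    using that by (simp add: mod_if)
  have "pauli_mat (p # ps) $$ (i, j) = pauli1 p (qbit (Suc ?n) 0 i) (qbit (Suc ?n) 0 j) *
      (\<Prod>q<?n. pauli1 (ps ! q) (qbit ?n q (i mod ?m)) (qbit ?n q (j mod ?m)))"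
    using ij unfolding pauli_mat_def by (simp add: prod.lessThan_Suc_shift qbit_Suc del: prod.lessThan_Suc)
  also have "(\<Prod>q<?n. pauli1 (ps ! q) (qbit ?n q (i mod ?m)) (qbit ?n q (j mod ?m))) = pauli_mat ps $$ (i mod ?m, j mod ?m)"
    by (simp add: pauli_mat_def)
  finally show "pauli_mat (p # ps) $$ (i, j) = kron2 (pauli1 p) (pauli_mat ps) $$ (i, j)"
    using ij carrier_matD[OF pauli_mat_carrier[of ps]]
    by (auto simp: kron2_def top md)
qed

text \<open>Modulo phases the Pauli operators form the Klein four-group. This is its table, and
  \<open>pauli_phase\<close> restores the lost phase.\<close>

definition pauli_prod :: "pauli \<Rightarrow> pauli \<Rightarrow> pauli" where
  "pauli_prod p q = (if p = q then PI else if p = PI then q else if q = PI then p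
     else if p \<noteq> PX \<and> q \<noteq> PX then PX else if p \<noteq> PY \<and> q \<noteq> PY then PY else PZ)"

definition pauli_phase :: "pauli \<Rightarrow> pauli \<Rightarrow> complex" where
  "pauli_phase p q = (if p = q \<or> p = PI \<or> q = PI then 1
     else if (p, q) \<in> {(PX, PY), (PY, PZ), (PZ, PX)} then \<i> else - \<i>)"

lemma kron2_pauli_mult:
  "kron2 (mul2 (pauli1 p) (pauli1 q)) Q = kron2 (\<lambda>i j. pauli_phase p q * pauli1 (pauli_prod p q) i j) Q"
  by (rule kron2_cong; cases p; cases q; simp add: mul2_def pauli1_def pauli_prod_def pauli_phase_def)

lemma pauli_prod_comm: "pauli_prod q p = pauli_prod p q"
  by (cases p; cases q; simp add: pauli_prod_def)

definition pauli_sign :: "pauli \<Rightarrow> pauli \<Rightarrow> complex" where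
  "pauli_sign p q = (if p = q \<or> p = PI \<or> q = PI then 1 else -1)"

lemma pauli_phase_comm: "pauli_phase q p = pauli_sign p q * pauli_phase p q"
  by (cases p; cases q; simp add: pauli_phase_def pauli_sign_def)

lemma pauli_sign_comm: "pauli_sign p q = pauli_sign q p"
  by (auto simp: pauli_sign_def)

lemma pauli_sign_cases: "pauli_sign p q = 1 \<or> pauli_sign p q = -1"
  by (simp add: pauli_sign_def)

text \<open>Both orders of multiplication share one string and one phase, so that s records whether
  the two strings commute or anticommute; it is the product of the signs of the single qubits. The
  later conjugation arguments rest on this sign.\<close>

lemma pauli_mat_mult:
  assumes "length ps = n" "length qs = n"
  obtains z s rs where "length rs = n" "s = 1 \<or> s = (-1 :: complex)"
    "pauli_mat ps * pauli_mat qs = z \<cdot>\<^sub>m pauli_mat rs" "pauli_mat qs * pauli_mat ps = (s * z) \<cdot>\<^sub>m pauli_mat rs"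
proof -
  have "\<exists>z s rs. length rs = n \<and> (s = 1 \<or> s = (-1 :: complex)) \<and>
    pauli_mat ps * pauli_mat qs = z \<cdot>\<^sub>m pauli_mat rs \<and> pauli_mat qs * pauli_mat ps = (s * z) \<cdot>\<^sub>m pauli_mat rs"
    using assms
  proof (induction n arbitrary: ps qs)
    case 0
    then show ?case by (intro exI[of _ 1] exI[of _ "[]"]) (simp add: pauli_mat_Nil one_smult_mat)
  next
    case (Suc n)
    then obtain p ps' q qs' where e: "ps = p # ps'" "qs = q # qs'" "length ps' = n" "length qs' = n"
      by (auto simp: length_Suc_conv)
    from Suc(1)[OF e(3,4)] obtain z s rs where IH: "length rs = n" "s = 1 \<or> s = (-1 :: complex)"
      "pauli_mat ps' * pauli_mat qs' = z \<cdot>\<^sub>m pauli_mat rs" "pauli_mat qs' * pauli_mat ps' = (s * z) \<cdot>\<^sub>m pauli_mat rs"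
      by blast
    let ?m = "2 ^ n :: nat"
    have c: "pauli_mat ps' \<in> carrier_mat ?m ?m" "pauli_mat qs' \<in> carrier_mat ?m ?m" "pauli_mat rs \<in> carrier_mat ?m ?m"
      using e IH(1) by (auto intro: pauli_mat_carrier')
    have 1: "pauli_mat ps * pauli_mat qs = (pauli_phase p q * z) \<cdot>\<^sub>m pauli_mat (pauli_prod p q # rs)"
      unfolding e pauli_mat_Cons kron2_mult[OF c(1,2)] IH(3) kron2_pauli_mult
      using c(3) by (simp add: kron2_smult[of _ ?m] smult_smult_mat)
    have 2: "pauli_mat qs * pauli_mat ps = (pauli_phase q p * (s * z)) \<cdot>\<^sub>m pauli_mat (pauli_prod p q # rs)"
      unfolding e pauli_mat_Cons kron2_mult[OF c(2,1)] IH(4) kron2_pauli_mult pauli_prod_comm[of p q]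
      using c(3) by (simp add: kron2_smult[of _ ?m] smult_smult_mat)
    show ?case
      using 1 2 IH(1,2) pauli_sign_cases[of p q]
      by (intro exI[of _ "pauli_phase p q * z"] exI[of _ "pauli_sign p q * s"] exI[of _ "pauli_prod p q # rs"])
         (auto simp: pauli_phase_comm[of q p] mult_ac)
  qed
  then show ?thesis using that by blast
qed

lemma pauli_mat_square: "pauli_mat ps * pauli_mat ps = 1\<^sub>m (2 ^ length ps)"
proof (induction ps)
  case Nil show ?case by (simp add: pauli_mat_Nil)
next
  case (Cons p ps)
  have "kron2 (mul2 (pauli1 p) (pauli1 p)) Q = kron2 (pauli1 PI) Q" for Q
    by (rule kron2_cong; cases p; simp add: mul2_def pauli1_def)
  then show ?case
    by (simp add: pauli_mat_Cons kron2_mult[OF pauli_mat_carrier pauli_mat_carrier] Cons kron2_PI_one)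
qed

lemma pauli_mat_self_adjoint: "mat_adjoint (pauli_mat ps) = pauli_mat ps"
proof (induction ps)
  case Nil
  have "mat_adjoint (1\<^sub>m 1 :: complex mat) = 1\<^sub>m 1"
    by (rule eq_matI) (auto simp: index_mat_adjoint[OF one_carrier_mat] carrier_matD[OF mat_adjoint_carrier[OF one_carrier_mat]])
  then show ?case by (simp add: pauli_mat_Nil)
next
  case (Cons p ps)
  have "kron2 (\<lambda>i j. cnj (pauli1 p j i)) Q = kron2 (pauli1 p) Q" for Q
    by (rule kron2_cong; cases p; simp add: pauli1_def)
  then show ?case unfolding pauli_mat_Cons mat_adjoint_kron2[OF pauli_mat_carrier] Cons by simp
qed

lemma pauli_mat_replicate_PI: "pauli_mat (replicate n PI) = 1\<^sub>m (2 ^ n)"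
  by (induction n) (simp_all add: pauli_mat_Nil pauli_mat_Cons kron2_PI_one)

lemma mul2_PI: "mul2 a (pauli1 PI) 0 0 = a 0 0" "mul2 a (pauli1 PI) 0 1 = a 0 1"
  "mul2 a (pauli1 PI) 1 0 = a 1 0" "mul2 a (pauli1 PI) 1 1 = a 1 1"
  "mul2 (pauli1 PI) a 0 0 = a 0 0" "mul2 (pauli1 PI) a 0 1 = a 0 1"
  "mul2 (pauli1 PI) a 1 0 = a 1 0" "mul2 (pauli1 PI) a 1 1 = a 1 1"
  by (simp_all add: mul2_def pauli1_def)

lemma kron2_mul2_PI: "kron2 (mul2 a (pauli1 PI)) Q = kron2 a Q" "kron2 (mul2 (pauli1 PI) a) Q = kron2 a Q"
  by (rule kron2_cong; simp only: mul2_PI)+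

text \<open>Qubit b is the only place where the second string can differ from the identity, so only
  the sign at b enters.\<close>

lemma pauli_anticommute_single:
  assumes "b < length ps" "pauli_sign (ps ! b) sg = -1"
  shows "pauli_mat ps * pauli_mat ((replicate (length ps) PI)[b := sg])
     = (-1) \<cdot>\<^sub>m (pauli_mat ((replicate (length ps) PI)[b := sg]) * pauli_mat ps)"
  using assms
proof (induction ps arbitrary: b)
  case (Cons p ps)
  let ?m = "2 ^ length ps :: nat"
  have c: "pauli_mat ps \<in> carrier_mat ?m ?m" by simp
  show ?case
  proof (cases b)
    case 0
    have "pauli_phase p sg = - pauli_phase sg p"
      using Cons(3) 0 pauli_phase_comm[of sg p] pauli_sign_comm[of sg p] by simp
    then have "kron2 (mul2 (pauli1 p) (pauli1 sg)) (pauli_mat ps) = (-1) \<cdot>\<^sub>m kron2 (mul2 (pauli1 sg) (pauli1 p)) (pauli_mat ps)"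
      unfolding kron2_pauli_mult pauli_prod_comm[of p sg] kron2_smult(2)[OF c] smult_smult_mat by simp
    then show ?thesis
      using 0 by (simp add: pauli_mat_Cons pauli_mat_replicate_PI kron2_mult[of _ ?m] right_mult_one_mat[OF c] left_mult_one_mat[OF c])
  next
    case (Suc b')
    let ?r = "(replicate (length ps) PI)[b' := sg]"
    have c2: "pauli_mat ?r \<in> carrier_mat ?m ?m" by (intro pauli_mat_carrier') simp
    have IH: "pauli_mat ps * pauli_mat ?r = (-1) \<cdot>\<^sub>m (pauli_mat ?r * pauli_mat ps)"
      using Cons Suc by simp
    have "kron2 (pauli1 p) (pauli_mat ps * pauli_mat ?r) = (-1) \<cdot>\<^sub>m kron2 (pauli1 p) (pauli_mat ?r * pauli_mat ps)"
      unfolding IH using c c2 by (intro kron2_smult(1)[of _ ?m]) auto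
    then show ?thesis
      using Suc c c2 by (simp add: pauli_mat_Cons kron2_mult[of _ ?m] kron2_mul2_PI)
  qed
qed simp

lemma smult_mat_pow_involution:
  fixes M :: "complex mat"
  assumes M: "M \<in> carrier_mat m m" and sq: "M * M = 1\<^sub>m m"
  shows "(c \<cdot>\<^sub>m M) ^\<^sub>m k = c ^ k \<cdot>\<^sub>m (if even k then 1\<^sub>m m else M)"
proof (induction k)
  case 0 show ?case using M by (simp add: one_smult_mat)
next
  case (Suc k)
  have "(c \<cdot>\<^sub>m M) ^\<^sub>m Suc k = (c ^ k \<cdot>\<^sub>m (if even k then 1\<^sub>m m else M)) * (c \<cdot>\<^sub>m M)"
    using Suc by simp
  also have "\<dots> = c ^ Suc k \<cdot>\<^sub>m ((if even k then 1\<^sub>m m else M) * M)"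
    using M by (simp add: mult_smult_distrib[of _ m m _ m] mult_smult_assoc_mat[of _ m m _ m] smult_smult_mat mult.commute)
  also have "(if even k then 1\<^sub>m m else M) * M = (if even (Suc k) then 1\<^sub>m m else M)"
    using M sq by simp
  finally show ?case .
qed

text \<open>The involution M has the spectral projections (1 + M)/2 and (1 - M)/2, on which it acts
  as 1 and -1. The exponential series therefore splits into the scalar series of exp c and exp (-
  c), weighted by these projections.\<close>

lemma mat_exp_involution:
  fixes M :: "complex mat"
  assumes M: "M \<in> carrier_mat m m" and sq: "M * M = 1\<^sub>m m"
  shows "mat_exp (c \<cdot>\<^sub>m M) = ((exp c + exp (- c)) / 2) \<cdot>\<^sub>m 1\<^sub>m m + ((exp c - exp (- c)) / 2) \<cdot>\<^sub>m M"
proof (rule eq_matI)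
  fix i j assume "i < dim_row (((exp c + exp (- c)) / 2) \<cdot>\<^sub>m 1\<^sub>m m + ((exp c - exp (- c)) / 2) \<cdot>\<^sub>m M)"
    "j < dim_col (((exp c + exp (- c)) / 2) \<cdot>\<^sub>m 1\<^sub>m m + ((exp c - exp (- c)) / 2) \<cdot>\<^sub>m M)"
  then have ij: "i < m" "j < m" using M by auto
  let ?d = "1\<^sub>m m $$ (i, j) :: complex" and ?M = "M $$ (i, j)"
  have "((c \<cdot>\<^sub>m M) ^\<^sub>m k) $$ (i, j) / of_nat (fact k)
      = (?d + ?M) / 2 * (c ^ k /\<^sub>R fact k) + (?d - ?M) / 2 * ((- c) ^ k /\<^sub>R fact k)" for k
    unfolding smult_mat_pow_involution[OF M sq] using M ij
    by (cases "even k") (simp_all add: scaleR_conv_of_real field_simps del: index_one_mat(1))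
  moreover have "(\<lambda>k. (?d + ?M) / 2 * (c ^ k /\<^sub>R fact k) + (?d - ?M) / 2 * ((- c) ^ k /\<^sub>R fact k))
      sums ((?d + ?M) / 2 * exp c + (?d - ?M) / 2 * exp (- c))"
    by (intro sums_add sums_mult exp_converges)
  ultimately have "(\<Sum>k. ((c \<cdot>\<^sub>m M) ^\<^sub>m k) $$ (i, j) / of_nat (fact k)) = (?d + ?M) / 2 * exp c + (?d - ?M) / 2 * exp (- c)"
    by (simp add: sums_iff)
  then show "mat_exp (c \<cdot>\<^sub>m M) $$ (i, j) = (((exp c + exp (- c)) / 2) \<cdot>\<^sub>m 1\<^sub>m m + ((exp c - exp (- c)) / 2) \<cdot>\<^sub>m M) $$ (i, j)"
    using M ij by (simp add: mat_exp_def field_simps del: index_one_mat(1))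
qed (use M in \<open>auto simp: mat_exp_def\<close>)

lemma mat_adjoint_selfI:
  assumes "M \<in> carrier_mat m m" "\<And>i j. i < m \<Longrightarrow> j < m \<Longrightarrow> cnj (M $$ (j, i)) = M $$ (i, j)"
  shows "mat_adjoint M = M"
  using assms carrier_matD[OF mat_adjoint_carrier[OF assms(1)]]
  by (intro eq_matI) (auto simp: index_mat_adjoint[OF assms(1)])

lemma self_adjoint_entry:
  assumes "M \<in> carrier_mat m m" "mat_adjoint M = M" "i < m" "j < m"
  shows "cnj (M $$ (j, i)) = M $$ (i, j)"
  using index_mat_adjoint[OF assms(1,3,4)] assms(2) by simp

lemma mat_adjoint_mult:
  fixes A B :: "complex mat"
  assumes A: "A \<in> carrier_mat m m" and B: "B \<in> carrier_mat m m"
  shows "mat_adjoint (A * B) = mat_adjoint B * mat_adjoint A"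
proof (rule eq_matI)
  have AB: "A * B \<in> carrier_mat m m" using A B by simp
  note c = mat_adjoint_carrier[OF A] mat_adjoint_carrier[OF B] mat_adjoint_carrier[OF AB]
  show "dim_row (mat_adjoint (A * B)) = dim_row (mat_adjoint B * mat_adjoint A)"
    "dim_col (mat_adjoint (A * B)) = dim_col (mat_adjoint B * mat_adjoint A)"
    using c by auto
  fix i j assume "i < dim_row (mat_adjoint B * mat_adjoint A)" "j < dim_col (mat_adjoint B * mat_adjoint A)"
  then have ij: "i < m" "j < m" using c by auto
  show "mat_adjoint (A * B) $$ (i, j) = (mat_adjoint B * mat_adjoint A) $$ (i, j)"
    unfolding index_mat_adjoint[OF AB ij] index_mult_mat_sum[OF A B ij(2,1)] index_mult_mat_sum[OF c(2,1) ij]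
    using ij by (simp add: index_mat_adjoint[OF A] index_mat_adjoint[OF B] mult.commute)
qed

section \<open>Clifford unitaries\<close>

lemma is_clifford_carrier: "is_clifford n C \<Longrightarrow> C \<in> carrier_mat (2 ^ n) (2 ^ n)"
  by (simp add: is_clifford_def)

lemma is_cliffordI:
  assumes "C \<in> carrier_mat (2 ^ n) (2 ^ n)" "mat_adjoint C = D" "C * D = 1\<^sub>m (2 ^ n)"
    and "\<And>ps. length ps = n \<Longrightarrow> \<exists>z qs. length qs = n \<and> C * pauli_mat ps * D = z \<cdot>\<^sub>m pauli_mat qs"
  shows "is_clifford n C"
  using assms unfolding is_clifford_def by blast

lemma is_clifford_mult:
  assumes C: "is_clifford n C" and D: "is_clifford n D"
  shows "is_clifford n (C * D)"
proof -
  let ?m = "2 ^ n :: nat"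
  have c: "C \<in> carrier_mat ?m ?m" "D \<in> carrier_mat ?m ?m" using C D by (auto simp: is_clifford_carrier)
  note a = mat_adjoint_carrier[OF c(1)] mat_adjoint_carrier[OF c(2)]
  let ?C = "mat_adjoint C" and ?D = "mat_adjoint D"
  have conj: "C * D * M * (?D * ?C) = C * (D * M * ?D) * ?C" if "M \<in> carrier_mat ?m ?m" for M
    using c a that by (simp add: sq_mat[where m = ?m])
  show ?thesis
  proof (rule is_cliffordI[where D = "?D * ?C"])
    show "C * D * (?D * ?C) = 1\<^sub>m ?m"
      using conj[of "1\<^sub>m ?m"] C D c a by (simp add: is_clifford_def)
    fix ps :: "pauli list" assume l: "length ps = n"
    obtain z qs where 1: "length qs = n" "D * pauli_mat ps * ?D = z \<cdot>\<^sub>m pauli_mat qs"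
      using D l unfolding is_clifford_def by blast
    obtain w rs where 2: "length rs = n" "C * pauli_mat qs * ?C = w \<cdot>\<^sub>m pauli_mat rs"
      using C 1 unfolding is_clifford_def by blast
    have "C * D * pauli_mat ps * (?D * ?C) = C * (z \<cdot>\<^sub>m pauli_mat qs) * ?C"
      using conj[OF pauli_mat_carrier'[OF l]] 1(2) by simp
    also have "\<dots> = z \<cdot>\<^sub>m (C * pauli_mat qs * ?C)"
      using c a pauli_mat_carrier'[OF 1(1)]
      by (simp add: sq_mat[where m = ?m])
    also have "\<dots> = (z * w) \<cdot>\<^sub>m pauli_mat rs" unfolding 2(2) smult_smult_mat ..
    finally show "\<exists>z qs. length qs = n \<and> C * D * pauli_mat ps * (?D * ?C) = z \<cdot>\<^sub>m pauli_mat qs"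
      using 2(1) by blast
  qed (use c mat_adjoint_mult in auto)
qed

text \<open>Conjugation by a Pauli string merely multiplies another string by their commutation
  sign.\<close>

lemma is_clifford_pauli:
  assumes "length ps = n" shows "is_clifford n (pauli_mat ps)"
proof (rule is_cliffordI[where D = "pauli_mat ps"])
  let ?m = "2 ^ n :: nat"
  note P = pauli_mat_carrier'[OF assms]
  show "pauli_mat ps * pauli_mat ps = 1\<^sub>m ?m" using pauli_mat_square[of ps] assms by simp
  fix qs :: "pauli list" assume l: "length qs = n"
  note Q = pauli_mat_carrier'[OF l]
  obtain z s rs where r: "length rs = n" "s = 1 \<or> s = (-1 :: complex)"
    "pauli_mat ps * pauli_mat qs = z \<cdot>\<^sub>m pauli_mat rs" "pauli_mat qs * pauli_mat ps = (s * z) \<cdot>\<^sub>m pauli_mat rs"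
    by (rule pauli_mat_mult[OF assms l])
  have "pauli_mat ps * pauli_mat qs = s \<cdot>\<^sub>m (pauli_mat qs * pauli_mat ps)"
    using r by (auto simp: smult_smult_mat)
  then have "pauli_mat ps * pauli_mat qs * pauli_mat ps = s \<cdot>\<^sub>m (pauli_mat qs * pauli_mat ps * pauli_mat ps)"
    using P Q by (simp add: sq_mat[where m = ?m])
  also have "pauli_mat qs * pauli_mat ps * pauli_mat ps = pauli_mat qs * (pauli_mat ps * pauli_mat ps)"
    using P Q by (intro assoc_mult_mat) auto
  also have "\<dots> = pauli_mat qs" using pauli_mat_square[of ps] assms Q by simp
  finally show "\<exists>z rs. length rs = n \<and> pauli_mat ps * pauli_mat qs * pauli_mat ps = z \<cdot>\<^sub>m pauli_mat rs"
    using l by blast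
qed (use assms pauli_mat_carrier' pauli_mat_self_adjoint in auto)

lemma is_clifford_one: "is_clifford n (1\<^sub>m (2 ^ n))"
  using is_clifford_pauli[of "replicate n PI" n] by (simp add: pauli_mat_replicate_PI)

lemma is_clifford_kron2_PI:
  assumes C: "is_clifford n C"
  shows "is_clifford (Suc n) (kron2 (pauli1 PI) C)"
proof -
  let ?m = "2 ^ n :: nat" and ?D = "mat_adjoint C"
  have c: "C \<in> carrier_mat ?m ?m" using C by (rule is_clifford_carrier)
  note d = mat_adjoint_carrier[OF c]
  show ?thesis
  proof (rule is_cliffordI[where D = "kron2 (pauli1 PI) ?D"])
    show "kron2 (pauli1 PI) C \<in> carrier_mat (2 ^ Suc n) (2 ^ Suc n)" using kron2_carrier[OF c] by simp
    show "mat_adjoint (kron2 (pauli1 PI) C) = kron2 (pauli1 PI) ?D"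
      unfolding mat_adjoint_kron2[OF c] by (rule kron2_cong) (simp_all add: pauli1_def)
    show "kron2 (pauli1 PI) C * kron2 (pauli1 PI) ?D = 1\<^sub>m (2 ^ Suc n)"
      unfolding kron2_mult[OF c d] kron2_mul2_PI using C kron2_PI_one[of ?m] by (simp add: is_clifford_def)
    fix ps :: "pauli list" assume "length ps = Suc n"
    then obtain p qs where ps: "ps = p # qs" and l: "length qs = n" by (cases ps) auto
    note q = pauli_mat_carrier'[OF l]
    obtain z rs where r: "length rs = n" "C * pauli_mat qs * ?D = z \<cdot>\<^sub>m pauli_mat rs"
      using C l unfolding is_clifford_def by blast
    have "kron2 (pauli1 PI) C * pauli_mat ps * kron2 (pauli1 PI) ?D = kron2 (pauli1 p) (C * pauli_mat qs * ?D)"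
      using c d q by (simp add: ps pauli_mat_Cons kron2_mult[of _ ?m] kron2_mul2_PI)
    also have "\<dots> = z \<cdot>\<^sub>m pauli_mat (p # rs)"
      unfolding r(2) pauli_mat_Cons by (rule kron2_smult(1)[OF pauli_mat_carrier'[OF r(1)]])
    finally show "\<exists>z qs. length qs = Suc n \<and> kron2 (pauli1 PI) C * pauli_mat ps * kron2 (pauli1 PI) ?D = z \<cdot>\<^sub>m pauli_mat qs"
      using r(1) by (intro exI[of _ z] exI[of _ "p # rs"]) simp
  qed
qed

section \<open>Controlled unitaries as block matrices\<close>

lemma ctrl_mat_carrier [simp]: "ctrl_mat d U \<in> carrier_mat (2 * d) (2 * d)"
  by (simp add: ctrl_mat_def)

lemma ctrl_mat_block:
  assumes "U \<in> carrier_mat d d"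
  shows "ctrl_mat d U = four_block_mat (1\<^sub>m d) (0\<^sub>m d d) (0\<^sub>m d d) U"
  using assms by (intro eq_matI) (auto simp: ctrl_mat_def)

lemma ctrl_mat_mult:
  assumes "U \<in> carrier_mat d d" "V \<in> carrier_mat d d"
  shows "ctrl_mat d U * ctrl_mat d V = ctrl_mat d (U * V)"
  unfolding ctrl_mat_block[OF assms(1)] ctrl_mat_block[OF assms(2)] ctrl_mat_block[OF mult_carrier_mat[OF assms]]
  using assms by (subst mult_four_block_mat[of _ d d _ d _ d _ _ d _ d]) auto

lemma ctrl_mat_one: "ctrl_mat d (1\<^sub>m d) = 1\<^sub>m (2 * d)"
  by (intro eq_matI) (auto simp: ctrl_mat_def)

lemma mat_adjoint_ctrl_mat:
  assumes U: "U \<in> carrier_mat d d" "mat_adjoint U = U"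
  shows "mat_adjoint (ctrl_mat d U) = ctrl_mat d U"
proof (rule mat_adjoint_selfI[OF ctrl_mat_carrier])
  fix i j assume "i < 2 * d" "j < 2 * d"
  then show "cnj (ctrl_mat d U $$ (j, i)) = ctrl_mat d U $$ (i, j)"
    using self_adjoint_entry[OF U, of "i - d" "j - d"] by (auto simp: ctrl_mat_def)
qed

lemma zero_smult_mat: "M \<in> carrier_mat d d \<Longrightarrow> (0 :: complex) \<cdot>\<^sub>m M = 0\<^sub>m d d"
  by (intro eq_matI) auto

lemma ctrl_conj_kron2:
  assumes P: "P \<in> carrier_mat d d" and R: "R \<in> carrier_mat d d"
  shows "ctrl_mat d P * kron2 a R * ctrl_mat d P
    = four_block_mat (a 0 0 \<cdot>\<^sub>m R) (a 0 1 \<cdot>\<^sub>m (R * P)) (a 1 0 \<cdot>\<^sub>m (P * R)) (a 1 1 \<cdot>\<^sub>m (P * R * P))"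
proof -
  have "ctrl_mat d P * kron2 a R = four_block_mat (a 0 0 \<cdot>\<^sub>m R) (a 0 1 \<cdot>\<^sub>m R) (a 1 0 \<cdot>\<^sub>m (P * R)) (a 1 1 \<cdot>\<^sub>m (P * R))"
    unfolding ctrl_mat_block[OF P] kron2_def using P R
    by (subst mult_four_block_mat[of _ d d _ d _ d _ _ d _ d]) (auto simp: mult_smult_distrib[of _ d d _ d])
  then show ?thesis unfolding ctrl_mat_block[OF P] using P R
    by (simp only:, subst mult_four_block_mat[of _ d d _ d _ d _ _ d _ d])
       (auto simp: mult_smult_assoc_mat[of _ d d _ d])
qed

text \<open>Let s be the commutation sign of P and Q, and let t act on the control. If t is
  diagonal, conjugation keeps Q, and s = -1 exchanges I with Z on the control. If t is off-diagonal,
  Q is multiplied by P, and s = -1 exchanges X with Y up to phase.\<close>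

lemma is_clifford_ctrl_pauli:
  assumes "length ps = n" shows "is_clifford (Suc n) (ctrl_mat (2 ^ n) (pauli_mat ps))"
proof -
  let ?m = "2 ^ n :: nat" and ?P = "pauli_mat ps"
  note P = pauli_mat_carrier'[OF assms]
  have sq: "?P * ?P = 1\<^sub>m ?m" using pauli_mat_square[of ps] assms by simp
  show ?thesis
  proof (rule is_cliffordI[where D = "ctrl_mat ?m ?P"])
    show "ctrl_mat ?m ?P \<in> carrier_mat (2 ^ Suc n) (2 ^ Suc n)" using ctrl_mat_carrier[of ?m ?P] by simp
    show "mat_adjoint (ctrl_mat ?m ?P) = ctrl_mat ?m ?P"
      by (rule mat_adjoint_ctrl_mat[OF P pauli_mat_self_adjoint])
    show "ctrl_mat ?m ?P * ctrl_mat ?m ?P = 1\<^sub>m (2 ^ Suc n)"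
      using P by (simp add: ctrl_mat_mult sq ctrl_mat_one)
    fix ts :: "pauli list" assume "length ts = Suc n"
    then obtain t qs where ts: "ts = t # qs" and l: "length qs = n" by (cases ts) auto
    let ?Q = "pauli_mat qs"
    note Q = pauli_mat_carrier'[OF l]
    obtain z s rs where r: "length rs = n" "s = 1 \<or> s = (-1 :: complex)"
      "?P * ?Q = z \<cdot>\<^sub>m pauli_mat rs" "?Q * ?P = (s * z) \<cdot>\<^sub>m pauli_mat rs"
      by (rule pauli_mat_mult[OF assms l])
    note Rc = pauli_mat_carrier'[OF r(1)]
    have "?P * ?Q = s \<cdot>\<^sub>m (?Q * ?P)" using r by (auto simp: smult_smult_mat)
    then have "?P * ?Q * ?P = s \<cdot>\<^sub>m (?Q * ?P * ?P)"
      using P Q by (simp add: sq_mat[where m = ?m])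
    also have "?Q * ?P * ?P = ?Q * (?P * ?P)" using P Q by (intro assoc_mult_mat) auto
    also have "\<dots> = ?Q" using sq Q by simp
    finally have PQP: "?P * ?Q * ?P = s \<cdot>\<^sub>m ?Q" .
    have main: "ctrl_mat ?m ?P * pauli_mat ts * ctrl_mat ?m ?P
        = four_block_mat (pauli1 t 0 0 \<cdot>\<^sub>m ?Q) ((pauli1 t 0 1 * s * z) \<cdot>\<^sub>m pauli_mat rs)
            ((pauli1 t 1 0 * z) \<cdot>\<^sub>m pauli_mat rs) ((pauli1 t 1 1 * s) \<cdot>\<^sub>m ?Q)"
      unfolding ts pauli_mat_Cons ctrl_conj_kron2[OF P Q] PQP
      unfolding r(3,4) smult_smult_mat mult.assoc ..
    show "\<exists>z qs. length qs = Suc n \<and> ctrl_mat ?m ?P * pauli_mat ts * ctrl_mat ?m ?P = z \<cdot>\<^sub>m pauli_mat qs"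
    proof (cases "t = PI \<or> t = PZ")
      case True
      define t' where "t' = (if s = 1 then t else if t = PI then PZ else PI)"
      have "ctrl_mat ?m ?P * pauli_mat ts * ctrl_mat ?m ?P = pauli_mat (t' # qs)"
        unfolding main pauli_mat_Cons kron2_def
        using True r(2) Q Rc by (auto simp: t'_def pauli1_def zero_smult_mat)
      then show ?thesis using l by (intro exI[of _ 1] exI[of _ "t' # qs"]) (simp add: one_smult_mat)
    next
      case False
      define t' where "t' = (if s = 1 then t else if t = PX then PY else PX)"
      define w where "w = (if s = 1 then z else if t = PX then - \<i> * z else \<i> * z)"
      have iz: "\<i> * z * \<i> = - z" by (simp add: complex_eq_iff)
      have "t = PX \<or> t = PY" using False by (cases t) auto
      then have "ctrl_mat ?m ?P * pauli_mat ts * ctrl_mat ?m ?P = w \<cdot>\<^sub>m pauli_mat (t' # rs)"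
        unfolding main pauli_mat_Cons kron2_smult(2)[OF Rc, symmetric]
        unfolding kron2_def
        using r(2) Q Rc by (auto simp: t'_def w_def pauli1_def zero_smult_mat iz)
      then show ?thesis using r(1) by (intro exI[of _ w] exI[of _ "t' # rs"]) simp
    qed
  qed
qed

text \<open>A controlled global sign acts on the control qubit alone, as the Pauli operator Z. The
  signs are those provided by \<open>rte_phase\<close>.\<close>

lemma is_clifford_ctrl_sign:
  assumes "z = 1 \<or> z = (-1 :: complex)"
  shows "is_clifford (Suc n) (ctrl_mat (2 ^ n) (z \<cdot>\<^sub>m 1\<^sub>m (2 ^ n)))"
proof (cases "z = 1")
  case True
  then show ?thesis using is_clifford_one[of "Suc n"] by (simp add: one_smult_mat ctrl_mat_one)
next
  case False
  with assms have z: "z = -1" by simp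
  have "ctrl_mat (2 ^ n) (z \<cdot>\<^sub>m 1\<^sub>m (2 ^ n)) = pauli_mat (PZ # replicate n PI)"
    unfolding pauli_mat_Cons pauli_mat_replicate_PI kron2_def z
    by (subst ctrl_mat_block) (auto simp: pauli1_def one_smult_mat zero_smult_mat[OF one_carrier_mat])
  then show ?thesis using is_clifford_pauli[of "PZ # replicate n PI" "Suc n"] by simp
qed

text \<open>If two Pauli strings anticommute, the normalised sum is a Hermitian Clifford unitary exchanging them
  (as the Hadamard gate exchanges X and Z).\<close>

lemma anticommuting_pauli_exchange:
  assumes "length ps = n" "length qs = n"
    and anti: "pauli_mat ps * pauli_mat qs = (-1) \<cdot>\<^sub>m (pauli_mat qs * pauli_mat ps)"
  obtains H where "is_clifford n H" "H * H = 1\<^sub>m (2 ^ n)" "H * pauli_mat qs * H = pauli_mat ps"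
proof -
  let ?m = "2 ^ n :: nat" and ?P = "pauli_mat ps" and ?S = "pauli_mat qs"
  note P = pauli_mat_carrier'[OF assms(1)] and S = pauli_mat_carrier'[OF assms(2)]
  have sqP: "?P * ?P = 1\<^sub>m ?m" and sqS: "?S * ?S = 1\<^sub>m ?m"
    using pauli_mat_square[of ps] pauli_mat_square[of qs] assms by simp_all
  define c where "c = complex_of_real (1 / sqrt 2)"
  have c2: "c * c = 1 / 2" unfolding c_def by (simp flip: of_real_mult)
  define H where "H = c \<cdot>\<^sub>m (?P + ?S)"
  have Hc: "H \<in> carrier_mat ?m ?m" using P S by (simp add: H_def)
  have HRH: "H * R * H = (1 / 2) \<cdot>\<^sub>m (((?P + ?S) * R) * (?P + ?S))" if "R \<in> carrier_mat ?m ?m" for R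
    unfolding H_def using P S that
    by (simp add: sq_mat[where m = ?m] smult_smult_mat c2)
  have SP: "?S * ?P = (-1) \<cdot>\<^sub>m (?P * ?S)" using anti by (simp add: smult_smult_mat one_smult_mat)
  have PS: "?P * ?S \<in> carrier_mat ?m ?m" using P S by simp
  \<comment> \<open>The cross terms cancel by anticommutation; hence the factor 1/sqrt 2 makes H an
    involution.\<close>
  have sumsq: "(?P + ?S) * (?P + ?S) = 2 \<cdot>\<^sub>m 1\<^sub>m ?m"
  proof -
    have "(?P + ?S) * (?P + ?S) = (1\<^sub>m ?m + (-1) \<cdot>\<^sub>m (?P * ?S)) + (?P * ?S + 1\<^sub>m ?m)"
      using P S by (simp add: sq_mat[where m = ?m] sqP sqS SP)
    also have "\<dots> = 2 \<cdot>\<^sub>m 1\<^sub>m ?m" using carrier_matD[OF P] carrier_matD[OF S] by (intro eq_matI) auto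
    finally show ?thesis .
  qed
  have diffsum: "(?P + (-1) \<cdot>\<^sub>m ?S) * (?P + ?S) = 2 \<cdot>\<^sub>m (?P * ?S)"
  proof -
    have "(?P + (-1) \<cdot>\<^sub>m ?S) * (?P + ?S) = (1\<^sub>m ?m + (-1) \<cdot>\<^sub>m ((-1) \<cdot>\<^sub>m (?P * ?S))) + (?P * ?S + (-1) \<cdot>\<^sub>m 1\<^sub>m ?m)"
      using P S by (simp add: sq_mat[where m = ?m] sqP sqS SP)
    also have "\<dots> = 2 \<cdot>\<^sub>m (?P * ?S)" using carrier_matD[OF P] carrier_matD[OF S] by (intro eq_matI) auto
    finally show ?thesis .
  qed
  \<comment> \<open>The case where both strings have the same commutation sign p with R, so that R
    passes through their sum.\<close>
  have conj: "H * R * H = p \<cdot>\<^sub>m R" "H * R * H = p \<cdot>\<^sub>m R" if R: "R \<in> carrier_mat ?m ?m"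
    and pr: "?P * R = p \<cdot>\<^sub>m (R * ?P)" and sr: "?S * R = p \<cdot>\<^sub>m (R * ?S)" for R p
  proof -
    have "(?P + ?S) * R = p \<cdot>\<^sub>m (R * (?P + ?S))"
      using P S R by (simp add: sq_mat[where m = ?m] pr sr
          sq_mat[where m = ?m])
    then have "((?P + ?S) * R) * (?P + ?S) = p \<cdot>\<^sub>m (R * ((?P + ?S) * (?P + ?S)))"
      using P S R by (simp add: sq_mat[where m = ?m])
    then show "H * R * H = p \<cdot>\<^sub>m R" "H * R * H = p \<cdot>\<^sub>m R"
      unfolding HRH[OF R] sumsq using R by (simp_all add: sq_mat[where m = ?m] smult_smult_mat)
  qed
  \<comment> \<open>The case of opposite signs: moving R turns P + S into P - S, and (P - S)(P + S)
    = 2 P S.\<close>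
  have conj2: "H * R * H = p \<cdot>\<^sub>m (R * (?P * ?S))" if R: "R \<in> carrier_mat ?m ?m"
    and pr: "?P * R = p \<cdot>\<^sub>m (R * ?P)" and sr: "?S * R = (- p) \<cdot>\<^sub>m (R * ?S)" for R p
  proof -
    have "(?P + ?S) * R = p \<cdot>\<^sub>m (R * (?P + (-1) \<cdot>\<^sub>m ?S))"
      using P S R by (simp add: sq_mat[where m = ?m] pr sr
          sq_mat[where m = ?m] smult_smult_mat)
    then have "((?P + ?S) * R) * (?P + ?S) = p \<cdot>\<^sub>m (R * ((?P + (-1) \<cdot>\<^sub>m ?S) * (?P + ?S)))"
      using P S R by (simp add: sq_mat[where m = ?m])
    then show ?thesis
      unfolding HRH[OF R] diffsum using R PS by (simp add: sq_mat[where m = ?m] smult_smult_mat)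
  qed
  have HH: "H * H = 1\<^sub>m ?m"
    using conj(1)[of "1\<^sub>m ?m" 1] P S Hc by (simp add: one_smult_mat)
  have HSH: "H * ?S * H = ?P"
  proof -
    have "H * ?S * H = (-1) \<cdot>\<^sub>m (?S * (?P * ?S))"
      using P S by (intro conj2[OF S]) (auto simp: anti one_smult_mat)
    also have "?S * (?P * ?S) = ?S * ?P * ?S" using P S by (intro assoc_mult_mat[symmetric]) auto
    also have "\<dots> = (-1) \<cdot>\<^sub>m (?P * (?S * ?S))" unfolding SP
      using P S by (simp add: sq_mat[where m = ?m])
    finally show ?thesis using P by (simp add: sqS smult_smult_mat one_smult_mat)
  qed
  have "is_clifford n H"
  proof (rule is_cliffordI[where D = H])
    show "mat_adjoint H = H"
    proof (rule mat_adjoint_selfI[OF Hc])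
      fix i j assume "i < ?m" "j < ?m"
      then show "cnj (H $$ (j, i)) = H $$ (i, j)"
        using P S self_adjoint_entry[OF P pauli_mat_self_adjoint] self_adjoint_entry[OF S pauli_mat_self_adjoint]
        by (simp add: H_def c_def)
    qed
    fix rs :: "pauli list" assume l: "length rs = n"
    let ?R = "pauli_mat rs"
    note R = pauli_mat_carrier'[OF l]
    obtain z p us where u: "length us = n" "p = 1 \<or> p = (-1 :: complex)"
      "?R * ?P = z \<cdot>\<^sub>m pauli_mat us" "?P * ?R = (p * z) \<cdot>\<^sub>m pauli_mat us"
      by (rule pauli_mat_mult[OF l assms(1)])
    obtain w s vs where v: "length vs = n" "s = 1 \<or> s = (-1 :: complex)"
      "?R * ?S = w \<cdot>\<^sub>m pauli_mat vs" "?S * ?R = (s * w) \<cdot>\<^sub>m pauli_mat vs"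
      by (rule pauli_mat_mult[OF l assms(2)])
    have pr: "?P * ?R = p \<cdot>\<^sub>m (?R * ?P)" unfolding u(3,4) smult_smult_mat ..
    have sr: "?S * ?R = s \<cdot>\<^sub>m (?R * ?S)" unfolding v(3,4) smult_smult_mat ..
    show "\<exists>z qs. length qs = n \<and> H * ?R * H = z \<cdot>\<^sub>m pauli_mat qs"
    proof (cases "p = s")
      case True
      then show ?thesis using conj(1)[OF R pr] sr l by blast
    next
      case False
      then have "s = - p" using u(2) v(2) by auto
      then have e: "H * ?R * H = p \<cdot>\<^sub>m (?R * (?P * ?S))" using conj2[OF R pr] sr by blast
      obtain z1 s1 w1 where 1: "length w1 = n" "?P * ?S = z1 \<cdot>\<^sub>m pauli_mat w1"
        using pauli_mat_mult[OF assms(1,2)] by metis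
      obtain z2 s2 w2 where 2: "length w2 = n" "?R * pauli_mat w1 = z2 \<cdot>\<^sub>m pauli_mat w2"
        using pauli_mat_mult[OF l 1(1)] by metis
      have "H * ?R * H = (p * (z1 * z2)) \<cdot>\<^sub>m pauli_mat w2"
        unfolding e 1(2) using R pauli_mat_carrier'[OF 1(1)]
        by (simp add: sq_mat[where m = ?m] 2(2) smult_smult_mat)
      then show ?thesis using 2(1) by blast
    qed
  qed (use Hc HH in auto)
  then show ?thesis using that HH HSH by blast
qed

text \<open>The control is prepended as qubit 0, which moves the target from b to
  \<open>Suc b\<close>. The exponential of the extended Pauli operator is again a tensor product,
  because both exponentials are the same combination of the identity and an involution.\<close>

lemma ctrl_rot_is_ctrl_pauli_rot:
  assumes b: "b < n"
  shows "is_ctrl_pauli_rot (Suc n)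
    (ctrl_mat (2 ^ n) (mat_exp ((- \<i> * complex_of_real theta) \<cdot>\<^sub>m pauli_mat ((replicate n PI)[b := sg]))))"
proof -
  let ?m = "2 ^ n :: nat" and ?S = "pauli_mat ((replicate n PI)[b := sg])"
  define x where "x = - \<i> * complex_of_real theta"
  define E where "E = mat_exp (x \<cdot>\<^sub>m ?S)"
  have S: "?S \<in> carrier_mat ?m ?m" by (intro pauli_mat_carrier') simp
  have E: "E \<in> carrier_mat ?m ?m" using S by (simp add: E_def)
  have sq: "?S * ?S = 1\<^sub>m ?m" using pauli_mat_square[of "(replicate n PI)[b := sg]"] by simp
  define e0 e1 where "e0 = (\<lambda>i j. if i = (0::nat) \<and> j = (0::nat) then 1 else 0 :: complex)"
    and "e1 = (\<lambda>i j. if i = (1::nat) \<and> j = (1::nat) then 1 else 0 :: complex)"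
  have Z: "pauli_on (Suc n) 0 PZ = kron2 (pauli1 PZ) (1\<^sub>m ?m)"
    by (simp add: pauli_on_def pauli_mat_Cons pauli_mat_replicate_PI)
  have P0: "(1 / 2 :: complex) \<cdot>\<^sub>m (1\<^sub>m (2 ^ Suc n) + pauli_on (Suc n) 0 PZ) = kron2 e0 (1\<^sub>m ?m)"
    and P1: "(1 / 2 :: complex) \<cdot>\<^sub>m (1\<^sub>m (2 ^ Suc n) - pauli_on (Suc n) 0 PZ) = kron2 e1 (1\<^sub>m ?m)"
    unfolding Z kron2_def by (intro eq_matI; auto simp: pauli1_def e0_def e1_def)+
  have sb: "pauli_on (Suc n) (Suc b) sg = kron2 (pauli1 PI) ?S"
    by (simp add: pauli_on_def pauli_mat_Cons)
  have kS: "kron2 (pauli1 PI) ?S \<in> carrier_mat (2 * ?m) (2 * ?m)" using S by (rule kron2_carrier)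
  have ksq: "kron2 (pauli1 PI) ?S * kron2 (pauli1 PI) ?S = 1\<^sub>m (2 * ?m)"
    unfolding kron2_mult[OF S S] kron2_mul2_PI sq by (rule kron2_PI_one)
  have "mat_exp (x \<cdot>\<^sub>m pauli_on (Suc n) (Suc b) sg) = kron2 (pauli1 PI) E"
    unfolding sb mat_exp_involution[OF kS ksq] E_def mat_exp_involution[OF S sq]
    unfolding kron2_def
    using carrier_matD[OF S] by (intro eq_matI) (auto simp: pauli1_def)
  then have "(1 / 2 :: complex) \<cdot>\<^sub>m (1\<^sub>m (2 ^ Suc n) + pauli_on (Suc n) 0 PZ)
       + ((1 / 2 :: complex) \<cdot>\<^sub>m (1\<^sub>m (2 ^ Suc n) - pauli_on (Suc n) 0 PZ)) * mat_exp (x \<cdot>\<^sub>m pauli_on (Suc n) (Suc b) sg)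
     = kron2 e0 (1\<^sub>m ?m) + kron2 e1 (1\<^sub>m ?m) * kron2 (pauli1 PI) E"
    unfolding P0 P1 by simp
  also have "\<dots> = kron2 e0 (1\<^sub>m ?m) + kron2 e1 E"
    using E by (simp add: kron2_mult[OF one_carrier_mat E] kron2_mul2_PI)
  also have "\<dots> = ctrl_mat ?m E"
    unfolding kron2_def ctrl_mat_block[OF E] using carrier_matD[OF E] by (intro eq_matI) (auto simp: e0_def e1_def)
  finally show ?thesis
    unfolding is_ctrl_pauli_rot_def E_def x_def using b
    by (intro exI[of _ 0] exI[of _ "Suc b"] exI[of _ sg] exI[of _ theta]) simp
qed

text \<open>H carries the string to a single-qubit operator and back. It need not be controlled
  itself: when the control is off, the two copies cancel as H H = 1. Hence a single rotation
  suffices.\<close>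

lemma ctrl_pauli_exp_decomp:
  assumes n: "n \<ge> 1" and l: "length ps = n"
  obtains C G C' where "is_clifford (Suc n) C" "is_clifford (Suc n) C'" "is_ctrl_pauli_rot (Suc n) G"
    "ctrl_mat (2 ^ n) (mat_exp ((- \<i> * complex_of_real theta) \<cdot>\<^sub>m pauli_mat ps)) = C * G * C'"
proof (cases "\<forall>b<n. ps ! b = PI")
  case True
  let ?G = "ctrl_mat (2 ^ n) (mat_exp ((- \<i> * complex_of_real theta) \<cdot>\<^sub>m pauli_mat ps))"
  \<comment> \<open>The identity string yields only a controlled phase. It is presented as a
    rotation with the operator \<open>PI\<close> on qubit 0 of the register, which exists because
    \<open>n \<ge> 1\<close>.\<close>
  have "ps = (replicate n PI)[0 := PI]" using True l by (intro nth_equalityI) (auto simp: nth_list_update)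
  then have "is_ctrl_pauli_rot (Suc n) ?G" using ctrl_rot_is_ctrl_pauli_rot[of 0 n theta PI] n by simp
  moreover have "?G = 1\<^sub>m (2 ^ Suc n) * ?G * 1\<^sub>m (2 ^ Suc n)"
    by (simp only: power_Suc left_mult_one_mat[OF ctrl_mat_carrier] right_mult_one_mat[OF ctrl_mat_carrier])
  ultimately show ?thesis using that is_clifford_one by blast
next
  case False
  then obtain b where b: "b < n" "ps ! b \<noteq> PI" by blast
  let ?m = "2 ^ n :: nat" and ?x = "- \<i> * complex_of_real theta"
  \<comment> \<open>Some Pauli operator anticommuting with the non-identity entry at b.\<close>
  define sg where "sg = (if ps ! b = PX then PZ else PX)"
  define qs where "qs = (replicate n PI)[b := sg]"
  have lq: "length qs = n" by (simp add: qs_def)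
  have "pauli_sign (ps ! b) sg = -1" using b(2) by (auto simp: pauli_sign_def sg_def)
  then have "pauli_mat ps * pauli_mat qs = (-1) \<cdot>\<^sub>m (pauli_mat qs * pauli_mat ps)"
    using pauli_anticommute_single[of b ps sg] b l by (simp add: qs_def)
  from anticommuting_pauli_exchange[OF l lq this] obtain H where
    H: "is_clifford n H" "H * H = 1\<^sub>m ?m" "H * pauli_mat qs * H = pauli_mat ps" by blast
  note P = pauli_mat_carrier'[OF l] and S = pauli_mat_carrier'[OF lq] and Hc = is_clifford_carrier[OF H(1)]
  have sqP: "pauli_mat ps * pauli_mat ps = 1\<^sub>m ?m" and sqS: "pauli_mat qs * pauli_mat qs = 1\<^sub>m ?m"
    using pauli_mat_square[of ps] pauli_mat_square[of qs] l lq by simp_all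
  let ?E = "mat_exp (?x \<cdot>\<^sub>m pauli_mat qs)" and ?K = "kron2 (pauli1 PI) H"
  have Ec: "?E \<in> carrier_mat ?m ?m" using S by simp
  have "mat_exp (?x \<cdot>\<^sub>m pauli_mat ps) = H * ?E * H"
    unfolding mat_exp_involution[OF P sqP] mat_exp_involution[OF S sqS] using Hc S
    by (simp add: sq_mat[where m = ?m] H(2) H(3)[symmetric])
  moreover have "ctrl_mat ?m (H * ?E * H) = ?K * ctrl_mat ?m ?E * ?K"
  proof -
    have z: "0 \<cdot>\<^sub>m H = 0\<^sub>m ?m ?m" by (rule zero_smult_mat[OF Hc])
    have "?K = four_block_mat H (0\<^sub>m ?m ?m) (0\<^sub>m ?m ?m) H"
      by (simp add: kron2_def pauli1_def one_smult_mat z)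
    then show ?thesis
      using Hc Ec H(2) unfolding ctrl_mat_block[OF Ec] ctrl_mat_block[OF sq_mat_carrier[OF sq_mat_carrier[OF Hc Ec] Hc]]
      by (simp add: mult_four_block_mat[of _ ?m ?m _ ?m _ ?m _ _ ?m _ ?m])
  qed
  ultimately have "ctrl_mat ?m (mat_exp (?x \<cdot>\<^sub>m pauli_mat ps)) = ?K * ctrl_mat ?m ?E * ?K" by simp
  moreover have "is_ctrl_pauli_rot (Suc n) (ctrl_mat ?m ?E)"
    unfolding qs_def by (rule ctrl_rot_is_ctrl_pauli_rot[OF b(1)])
  ultimately show ?thesis using that is_clifford_kron2_PI[OF H(1)] by blast
qed

section \<open>Circuits for the sampled products\<close>

lemma mat_prod_list_carrier:
  "(\<And>M. M \<in> set Ms \<Longrightarrow> M \<in> carrier_mat d d) \<Longrightarrow> mat_prod_list d Ms \<in> carrier_mat d d"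
  by (induction Ms) (auto simp: mat_prod_list_def)

lemma mat_prod_list_Cons: "mat_prod_list d (M # Ms) = M * mat_prod_list d Ms"
  by (simp add: mat_prod_list_def)

lemma mat_prod_list_Nil: "mat_prod_list d [] = 1\<^sub>m d"
  by (simp add: mat_prod_list_def)

lemma is_clifford_ctrl_pauli_prod:
  assumes "\<forall>ps\<in>set pss. length ps = n"
  shows "is_clifford (Suc n) (ctrl_mat (2 ^ n) (mat_prod_list (2 ^ n) (map pauli_mat pss)))"
  using assms
proof (induction pss)
  case Nil
  show ?case using is_clifford_one[of "Suc n"] by (simp add: mat_prod_list_Nil ctrl_mat_one)
next
  case (Cons ps pss)
  have c: "mat_prod_list (2 ^ n) (map pauli_mat pss) \<in> carrier_mat (2 ^ n) (2 ^ n)"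
    using Cons.prems by (intro mat_prod_list_carrier) (auto intro: pauli_mat_carrier')
  have "ctrl_mat (2 ^ n) (mat_prod_list (2 ^ n) (map pauli_mat (ps # pss)))
     = ctrl_mat (2 ^ n) (pauli_mat ps) * ctrl_mat (2 ^ n) (mat_prod_list (2 ^ n) (map pauli_mat pss))"
    using Cons.prems c by (simp add: mat_prod_list_Cons ctrl_mat_mult pauli_mat_carrier')
  then show ?case using Cons by (auto intro: is_clifford_mult is_clifford_ctrl_pauli)
qed

text \<open>For even q the power of \<open>- \<i> * s\<close> is real, hence so is the whole
  coefficient, and its phase is a sign. A vanishing coefficient gets phase 1 by convention.\<close>

lemma rte_phase:
  assumes "even q"
  shows "(if rte_d c lam s (q, ls) = 0 then 1 else rte_coef c lam s (q, ls) / complex_of_real (rte_d c lam s (q, ls)))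
    \<in> {1, -1}"
proof (cases "rte_d c lam s (q, ls) = 0")
  case False
  obtain k where q: "q = 2 * k" using assms by (rule evenE)
  have pl: "(\<Prod>l\<leftarrow>ls. complex_of_real (c l / lam)) = of_real (\<Prod>l\<leftarrow>ls. c l / lam)"
    by (induction ls) simp_all
  have "(- \<i> * complex_of_real s) ^ q = of_real ((-1) ^ k * s ^ q)"
    unfolding q power_mult by (simp add: power_mult_distrib power_minus[of "(complex_of_real s)\<^sup>2"])
  then have "rte_coef c lam s (q, ls)
      = of_real ((-1) ^ k * s ^ q / fact q * sqrt (1 + (s / real (q + 1))\<^sup>2) * (\<Prod>l\<leftarrow>ls. c l / lam))"
  proof -
    have f: "(of_nat (fact q) :: complex) = of_real (fact q)" by simp
    show ?thesis if "(- \<i> * complex_of_real s) ^ q = of_real ((-1) ^ k * s ^ q)"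
      unfolding rte_coef_def split pl f that by (simp only: of_real_mult of_real_divide)
  qed
  then obtain w where w: "rte_coef c lam s (q, ls) = complex_of_real w" by blast
  then have "rte_d c lam s (q, ls) = \<bar>w\<bar>" by (simp add: rte_d_def)
  then show ?thesis using False w by (auto simp: abs_if)
qed simp

lemma is_ctrl_pauli_rot_carrier:
  assumes "is_ctrl_pauli_rot N G" shows "G \<in> carrier_mat (2 ^ N) (2 ^ N)"
proof -
  have "pauli_on N b sg \<in> carrier_mat (2 ^ N) (2 ^ N)" for b sg
    unfolding pauli_on_def by (rule pauli_mat_carrier') simp
  then show ?thesis using assms unfolding is_ctrl_pauli_rot_def
    by (elim exE conjE) (simp only:, intro add_carrier_mat sq_mat_carrier smult_carrier_mat minus_carrier_mat mat_exp_carrier one_carrier_mat)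
qed

text \<open>When controlled, the sign and the Pauli factors of \<open>rte_U\<close> are Clifford, so
  the exponential is the only factor that costs a rotation.\<close>

lemma ctrl_rte_U_decomp:
  assumes n: "n \<ge> 1" and P: "\<forall>l<L. length (P l) = n" and m: "m \<in> rte_terms nmax L"
  obtains C G C' where "is_clifford (Suc n) C" "is_clifford (Suc n) C'" "is_ctrl_pauli_rot (Suc n) G"
    "ctrl_mat (2 ^ n) (rte_U n c lam P s m) = C * G * C'" "rte_U n c lam P s m \<in> carrier_mat (2 ^ n) (2 ^ n)"
proof -
  obtain q ls where m_eq: "m = (q, ls)" by (cases m)
  have q: "even q" "length ls = Suc q" and ls: "set ls \<subseteq> {..<L}"
    using m by (auto simp: rte_terms_def m_eq)
  have len: "length (P (ls ! i)) = n" if "i \<le> q" for i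
  proof -
    have "ls ! i \<in> set ls" using that q by (intro nth_mem) auto
    then show ?thesis using P ls by auto
  qed
  let ?m = "2 ^ n :: nat"
  define z where "z = (if rte_d c lam s (q, ls) = 0 then 1 else rte_coef c lam s (q, ls) / complex_of_real (rte_d c lam s (q, ls)))"
  define R where "R = mat_prod_list ?m (map (\<lambda>i. pauli_mat (P (ls ! i))) [0..<q])"
  define E where "E = mat_exp ((- \<i> * complex_of_real (rte_theta q s)) \<cdot>\<^sub>m pauli_mat (P (ls ! q)))"
  have z: "z = 1 \<or> z = -1" using rte_phase[OF q(1), of c lam s ls] by (auto simp: z_def)
  have R_eq: "R = mat_prod_list ?m (map pauli_mat (map (\<lambda>i. P (ls ! i)) [0..<q]))"
    unfolding R_def map_map o_def ..
  have R: "R \<in> carrier_mat ?m ?m"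
    unfolding R_def using len by (intro mat_prod_list_carrier) (auto intro!: pauli_mat_carrier')
  have E: "E \<in> carrier_mat ?m ?m" unfolding E_def using pauli_mat_carrier'[OF len[of q]] by simp
  have U: "rte_U n c lam P s m = z \<cdot>\<^sub>m (R * E)" by (simp add: rte_U_def m_eq z_def R_def E_def)
  have "z \<cdot>\<^sub>m (R * E) = (z \<cdot>\<^sub>m 1\<^sub>m ?m) * (R * E)" using R E by (simp add: sq_mat[where m = ?m])
  then have "ctrl_mat ?m (rte_U n c lam P s m) = ctrl_mat ?m (z \<cdot>\<^sub>m 1\<^sub>m ?m) * (ctrl_mat ?m R * ctrl_mat ?m E)"
    unfolding U using R E by (simp add: ctrl_mat_mult)
  moreover obtain C G C' where CGC: "is_clifford (Suc n) C" "is_clifford (Suc n) C'" "is_ctrl_pauli_rot (Suc n) G"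
    "ctrl_mat ?m E = C * G * C'" unfolding E_def by (rule ctrl_pauli_exp_decomp[OF n len[of q]]) auto
  ultimately have e: "ctrl_mat ?m (rte_U n c lam P s m) = ctrl_mat ?m (z \<cdot>\<^sub>m 1\<^sub>m ?m) * (ctrl_mat ?m R * (C * G * C'))"
    by simp
  let ?S = "ctrl_mat ?m (z \<cdot>\<^sub>m 1\<^sub>m ?m)"
  have cliffR: "is_clifford (Suc n) (ctrl_mat ?m R)"
    unfolding R_eq using len by (intro is_clifford_ctrl_pauli_prod) auto
  have cliff: "is_clifford (Suc n) (?S * ctrl_mat ?m R * C)"
    by (intro is_clifford_mult is_clifford_ctrl_sign z cliffR CGC)
  have Gc: "G \<in> carrier_mat (2 ^ Suc n) (2 ^ Suc n)" by (rule is_ctrl_pauli_rot_carrier[OF CGC(3)])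
  have cc: "?S \<in> carrier_mat (2 ^ Suc n) (2 ^ Suc n)" "ctrl_mat ?m R \<in> carrier_mat (2 ^ Suc n) (2 ^ Suc n)"
    using ctrl_mat_carrier[of ?m] by simp_all
  note CC = is_clifford_carrier[OF CGC(1)] is_clifford_carrier[OF CGC(2)]
  have "ctrl_mat ?m (rte_U n c lam P s m) = (?S * ctrl_mat ?m R * C) * G * C'"
    unfolding e using cc CC Gc by (simp add: sq_mat[where m = "2 ^ Suc n"] del: power_Suc)
  moreover have "rte_U n c lam P s m \<in> carrier_mat ?m ?m" unfolding U using R E by simp
  ultimately show ?thesis using that cliff CGC(2,3) by blast
qed

lemma circuit_Nil: "C \<in> carrier_mat (2 ^ N) (2 ^ N) \<Longrightarrow> circuit N C [] = C"
  by (simp add: circuit_def mat_prod_list_Cons mat_prod_list_Nil)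

lemma circuit_Cons: "circuit N C ((G, D) # GCs) = C * (G * circuit N D GCs)"
  by (simp add: circuit_def mat_prod_list_Cons)

lemma circuit_carrier:
  assumes "C \<in> carrier_mat (2 ^ N) (2 ^ N)"
    and "\<forall>(G, D)\<in>set GCs. G \<in> carrier_mat (2 ^ N) (2 ^ N) \<and> D \<in> carrier_mat (2 ^ N) (2 ^ N)"
  shows "circuit N C GCs \<in> carrier_mat (2 ^ N) (2 ^ N)"
  unfolding circuit_def using assms by (intro mat_prod_list_carrier) auto

lemma circuit_mult_left:
  assumes D: "D \<in> carrier_mat (2 ^ N) (2 ^ N)" and C: "C \<in> carrier_mat (2 ^ N) (2 ^ N)"
    and GCs: "\<forall>(G, D)\<in>set GCs. G \<in> carrier_mat (2 ^ N) (2 ^ N) \<and> D \<in> carrier_mat (2 ^ N) (2 ^ N)"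
  shows "D * circuit N C GCs = circuit N (D * C) GCs"
proof (cases GCs)
  case Nil then show ?thesis using D C by (simp add: circuit_Nil)
next
  case (Cons p GCs')
  obtain G E where p: "p = (G, E)" by (cases p)
  have "circuit N E GCs' \<in> carrier_mat (2 ^ N) (2 ^ N)" using GCs Cons p by (intro circuit_carrier) auto
  then show ?thesis using D C GCs Cons p by (simp add: circuit_Cons sq_mat[where m = "2 ^ N"])
qed

text \<open>Every factor has the shape Clifford, rotation, Clifford. The trailing Clifford is
  absorbed into the leading one of the next factor, so there are exactly as many rotations as
  factors.\<close>

lemma ctrl_product_circuit:
  assumes n: "n \<ge> 1" and P: "\<forall>l<L. length (P l) = n" and ms: "set ms \<subseteq> rte_terms nmax L"
  shows "\<exists>C0 GCs. length GCs = length ms \<and> is_clifford (Suc n) C0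
    \<and> (\<forall>(G, C) \<in> set GCs. is_ctrl_pauli_rot (Suc n) G \<and> is_clifford (Suc n) C)
    \<and> ctrl_mat (2 ^ n) (mat_prod_list (2 ^ n) (map (rte_U n c lam P s) ms)) = circuit (Suc n) C0 GCs"
  using ms
proof (induction ms)
  case Nil
  then show ?case
    using is_clifford_one[of "Suc n"]
    by (intro exI[of _ "1\<^sub>m (2 ^ Suc n)"] exI[of _ "[]"]) (simp add: mat_prod_list_Nil ctrl_mat_one circuit_Nil)
next
  case (Cons m ms)
  from Cons obtain C0 GCs where IH: "length GCs = length ms" "is_clifford (Suc n) C0"
    "\<forall>(G, C) \<in> set GCs. is_ctrl_pauli_rot (Suc n) G \<and> is_clifford (Suc n) C"
    "ctrl_mat (2 ^ n) (mat_prod_list (2 ^ n) (map (rte_U n c lam P s) ms)) = circuit (Suc n) C0 GCs" by auto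
  have Uc: "rte_U n c lam P s m' \<in> carrier_mat (2 ^ n) (2 ^ n)" if "m' \<in> rte_terms nmax L" for m'
    using ctrl_rte_U_decomp[OF n P that] by metis
  obtain C G C' where D: "is_clifford (Suc n) C" "is_clifford (Suc n) C'" "is_ctrl_pauli_rot (Suc n) G"
    "ctrl_mat (2 ^ n) (rte_U n c lam P s m) = C * G * C'"
    using ctrl_rte_U_decomp[OF n P, of m nmax c lam s] Cons.prems by (metis insert_subset list.simps(15))
  note cC = is_clifford_carrier[OF D(1)] is_clifford_carrier[OF D(2)] is_ctrl_pauli_rot_carrier[OF D(3)] is_clifford_carrier[OF IH(2)]
  have cG: "\<forall>(G, D)\<in>set GCs. G \<in> carrier_mat (2 ^ Suc n) (2 ^ Suc n) \<and> D \<in> carrier_mat (2 ^ Suc n) (2 ^ Suc n)"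
    using IH(3) is_clifford_carrier is_ctrl_pauli_rot_carrier by fastforce
  have Rc: "mat_prod_list (2 ^ n) (map (rte_U n c lam P s) ms) \<in> carrier_mat (2 ^ n) (2 ^ n)"
    using Uc Cons.prems by (intro mat_prod_list_carrier) auto
  have "ctrl_mat (2 ^ n) (mat_prod_list (2 ^ n) (map (rte_U n c lam P s) (m # ms)))
     = (C * G * C') * circuit (Suc n) C0 GCs"
    using Uc[of m] Cons.prems Rc by (simp add: mat_prod_list_Cons ctrl_mat_mult[symmetric] D(4) IH(4))
  also have "\<dots> = C * (G * (C' * circuit (Suc n) C0 GCs))"
    using cC circuit_carrier[OF cC(4) cG] by (simp add: sq_mat[where m = "2 ^ Suc n"] del: power_Suc)
  also have "C' * circuit (Suc n) C0 GCs = circuit (Suc n) (C' * C0) GCs"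
    by (rule circuit_mult_left[OF cC(2,4) cG])
  also have "C * (G * circuit (Suc n) (C' * C0) GCs) = circuit (Suc n) C ((G, C' * C0) # GCs)"
    by (simp add: circuit_Cons)
  finally show ?case
    using IH D is_clifford_mult by (intro exI[of _ C] exI[of _ "(G, C' * C0) # GCs"]) auto
qed

section \<open>Gauss--Legendre quadrature\<close>

definition poly_int :: "real poly \<Rightarrow> real" where
  "poly_int p = integral {-1..1} (poly p)"

lemma poly_integrable: "poly (p :: real poly) integrable_on {a..b}"
  by (intro integrable_continuous_interval continuous_intros)

lemma poly_int_add: "poly_int (p + q) = poly_int p + poly_int q"
  and poly_int_diff: "poly_int (p - q) = poly_int p - poly_int q"
  and poly_int_smult: "poly_int (Polynomial.smult a p) = a * poly_int p"
  and poly_int_0: "poly_int 0 = 0"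
  unfolding poly_int_def poly_add poly_diff poly_smult
  by (simp_all add: Henstock_Kurzweil_Integration.integral_add Henstock_Kurzweil_Integration.integral_diff poly_integrable
        fun_Compl_def cong: Henstock_Kurzweil_Integration.integral_cong)

lemma poly_int_sum: "poly_int (\<Sum>i\<in>S. f i) = (\<Sum>i\<in>S. poly_int (f i))"
  by (induction S rule: infinite_finite_induct) (simp_all add: poly_int_add poly_int_0)

lemma poly_int_pderiv: "poly_int (pderiv p) = poly p 1 - poly p (-1)"
proof -
  have "(poly (pderiv p) has_integral (poly p 1 - poly p (-1))) {-1..1}"
    by (rule fundamental_theorem_of_calculus)
       (auto intro!: DERIV_subset[OF poly_DERIV] simp: has_real_derivative_iff_has_vector_derivative[symmetric])
  then show ?thesis unfolding poly_int_def by (rule integral_unique)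
qed

section \<open>Derivative identities, differential equation and orthogonality of the Legendre
  polynomials\<close>

lemma legendre_rec:
  "real (n + 2) * poly (legendre (Suc (Suc n))) x
     = real (2 * n + 3) * x * poly (legendre (Suc n)) x - real (n + 1) * poly (legendre n) x"
  by (simp add: field_simps del: of_nat_add of_nat_Suc of_nat_mult)

lemma legendre_pderiv_rec:
  "real (n + 2) * poly (pderiv (legendre (Suc (Suc n)))) x
     = real (2 * n + 3) * (poly (legendre (Suc n)) x + x * poly (pderiv (legendre (Suc n))) x)
       - real (n + 1) * poly (pderiv (legendre n)) x"
  by (simp add: pderiv_smult pderiv_diff pderiv_mult pderiv_pCons field_simps del: of_nat_add of_nat_Suc of_nat_mult)

text \<open>The two identities are proved together because the step needs both: the second
  eliminates the derivative of \<open>legendre n\<close> from the differentiated Bonnet recurrence,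
  and the first then eliminates \<open>legendre n\<close> itself from the recurrence.\<close>

lemma legendre_pderiv:
  shows legendre_pderiv_Suc: "poly (pderiv (legendre (Suc n))) x
      = x * poly (pderiv (legendre n)) x + real (n + 1) * poly (legendre n) x"
    and legendre_pderiv_lower: "x * poly (pderiv (legendre (Suc n))) x - poly (pderiv (legendre n)) x
      = real (n + 1) * poly (legendre (Suc n)) x"
proof (induction n)
  case 0
  { case 1 show ?case by (simp add: pderiv_pCons) next
    case 2 show ?case by (simp add: pderiv_pCons) }
next
  case (Suc n)
  define p0 p1 p2 d0 d1 d2 m where "p0 = poly (legendre n) x" "p1 = poly (legendre (Suc n)) x"
    "p2 = poly (legendre (Suc (Suc n))) x" "d0 = poly (pderiv (legendre n)) x"
    "d1 = poly (pderiv (legendre (Suc n))) x" "d2 = poly (pderiv (legendre (Suc (Suc n)))) x" "m = real n"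
  note defs = this
  have a: "d1 = x * d0 + (m + 1) * p0" and b: "x * d1 - d0 = (m + 1) * p1"
    using Suc by (simp_all add: defs del: legendre.simps)
  have r: "(m + 2) * p2 = (2 * m + 3) * x * p1 - (m + 1) * p0"
    using legendre_rec[of n x] by (simp add: defs add.commute del: legendre.simps)
  have r': "(m + 2) * d2 = (2 * m + 3) * (p1 + x * d1) - (m + 1) * d0"
    using legendre_pderiv_rec[of n x] by (simp add: defs add.commute del: legendre.simps)
  have m: "m + 2 > 0" by (simp add: defs)
  have "(m + 2) * d2 = (m + 2) * (x * d1 + (m + 2) * p1)"
  proof -
    have d0: "d0 = x * d1 - (m + 1) * p1" using b by simp
    show ?thesis unfolding r' d0 by (simp add: algebra_simps)
  qed
  with m have A: "d2 = x * d1 + (m + 2) * p1" by simp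
  have B: "x * d2 - d1 = (m + 2) * p2"
  proof -
    have d0: "d0 = x * d1 - (m + 1) * p1" using b by simp
    have "(m + 1) * p0 = d1 - x * (x * d1 - (m + 1) * p1)" using a unfolding d0 by simp
    then show ?thesis unfolding r A by (simp add: algebra_simps)
  qed
  { case 1 from A show ?case by (simp add: defs del: legendre.simps) next
    case 2 from B show ?case by (simp add: defs del: legendre.simps) }
qed

declare legendre.simps(3) [simp del]

lemma legendre_ode_first:
  "[:1, 0, -1:] * pderiv (legendre (Suc n))
     = Polynomial.smult (real (n + 1)) (legendre n - [:0, 1:] * legendre (Suc n))"
proof (rule poly_eq_poly_eq_iff[THEN iffD1], rule ext)
  fix x
  have "(1 - x\<^sup>2) * poly (pderiv (legendre (Suc n))) x
      = real (n + 1) * (poly (legendre n) x - x * poly (legendre (Suc n)) x)"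
  proof -
    let ?d = "poly (pderiv (legendre (Suc n))) x" and ?p = "poly (legendre n) x" and ?q = "poly (legendre (Suc n)) x"
    have "poly (pderiv (legendre n)) x = x * ?d - real (n + 1) * ?q"
      using legendre_pderiv_lower[of x n] by simp
    with legendre_pderiv_Suc[of n x] have "?d = x * (x * ?d - real (n + 1) * ?q) + real (n + 1) * ?p"
      by simp
    then show ?thesis by (simp add: algebra_simps power2_eq_square)
  qed
  then show "poly ([:1, 0, -1:] * pderiv (legendre (Suc n))) x
     = poly (Polynomial.smult (real (n + 1)) (legendre n - [:0, 1:] * legendre (Suc n))) x"
    by (simp add: power2_eq_square algebra_simps)
qed

text \<open>Legendre's equation in divergence form. It makes \<open>legendre (Suc n)\<close> an
  eigenfunction of a symmetric operator, which is the source of orthogonality.\<close>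

lemma legendre_ode:
  "pderiv ([:1, 0, -1:] * pderiv (legendre (Suc n)))
     = Polynomial.smult (- real ((n + 1) * (n + 2))) (legendre (Suc n))"
proof (rule poly_eq_poly_eq_iff[THEN iffD1], rule ext)
  fix x
  have "poly (pderiv ([:1, 0, -1:] * pderiv (legendre (Suc n)))) x
     = real (n + 1) * (poly (pderiv (legendre n)) x - poly (legendre (Suc n)) x
         - x * poly (pderiv (legendre (Suc n))) x)"
    unfolding legendre_ode_first
    by (simp add: pderiv_smult pderiv_diff pderiv_mult pderiv_pCons algebra_simps)
  also have "\<dots> = - real ((n + 1) * (n + 2)) * poly (legendre (Suc n)) x"
    using legendre_pderiv_lower[of x n] by (simp add: algebra_simps)
  finally show "poly (pderiv ([:1, 0, -1:] * pderiv (legendre (Suc n)))) x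
     = poly (Polynomial.smult (- real ((n + 1) * (n + 2))) (legendre (Suc n))) x"
    by simp
qed

text \<open>Lagrange's identity: the boundary terms disappear because 1 - x^2 vanishes at both
  endpoints.\<close>

lemma legendre_self_adjoint:
  "real ((n + 1) * (n + 2)) * poly_int (legendre (Suc n) * q)
     = - poly_int (legendre (Suc n) * pderiv ([:1, 0, -1:] * pderiv q))"
proof -
  let ?P = "legendre (Suc n)" and ?u = "[:1, 0, -1:] :: real poly"
  have "poly_int (pderiv ((?u * pderiv ?P) * q - (?u * pderiv q) * ?P)) = 0"
    unfolding poly_int_pderiv by simp
  moreover have "pderiv ((?u * pderiv ?P) * q - (?u * pderiv q) * ?P)
      = Polynomial.smult (- real ((n + 1) * (n + 2))) (?P * q) - ?P * pderiv (?u * pderiv q)"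
    unfolding pderiv_diff pderiv_mult[of "?u * pderiv ?P" q] pderiv_mult[of "?u * pderiv q" ?P] legendre_ode
    by (simp add: algebra_simps)
  ultimately show ?thesis by (simp only: poly_int_diff poly_int_smult)
qed

lemma pderiv_monom_legendre_op:
  "pderiv ([:1, 0, -1:] * pderiv (Polynomial.monom (1::real) k))
    = Polynomial.smult (real (k * (k - 1))) (Polynomial.monom 1 (k - 2))
      - Polynomial.smult (real (k * (k + 1))) (Polynomial.monom 1 k)"
proof -
  have u: "[:1, 0, -1:] = (1 :: real poly) - Polynomial.monom 1 2"
    by (simp add: monom_altdef numeral_2_eq_2 one_pCons)
  show ?thesis
  proof (cases k)
    case 0 then show ?thesis by (simp add: pderiv_monom)
  next
    case (Suc m)
    then show ?thesis
      unfolding u by (simp add: pderiv_monom pderiv_diff mult_monom smult_monom algebra_simps)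
  qed
qed

text \<open>The Legendre operator sends x^k to -k(k+1) x^k plus a multiple of x^(k-2), whose
  integral against \<open>legendre J\<close> is zero by induction. Moving the operator to the other
  factor gives the eigenvalue -J(J+1), and k(k+1) < J(J+1) forces the integral to vanish.\<close>

lemma legendre_orthogonal_monom:
  assumes "k < J"
  shows "poly_int (legendre J * Polynomial.monom 1 k) = 0"
  using assms
proof (induction k rule: less_induct)
  case (less k)
  then obtain n where J: "J = Suc n" by (cases J) auto
  let ?I = "poly_int (legendre J * Polynomial.monom 1 k)"
  \<comment> \<open>For \<open>k < 2\<close> the truncated exponent \<open>k - 2\<close> is harmless
    because its coefficient is zero.\<close>
  have z: "real (k * (k - 1)) * poly_int (legendre J * Polynomial.monom 1 (k - 2)) = 0"
  proof (cases "k \<ge> 2")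
    case True with less show ?thesis by simp
  next
    case False then have "k = 0 \<or> k = 1" by auto
    then show ?thesis by auto
  qed
  have "real ((n + 1) * (n + 2)) * ?I = real (k * (k + 1)) * ?I"
    using legendre_self_adjoint[of n "Polynomial.monom 1 k"] z
    unfolding J[symmetric] pderiv_monom_legendre_op
    by (simp only: poly_int_diff poly_int_smult right_diff_distrib mult_smult_right)
  moreover have "real (k * (k + 1)) < real ((n + 1) * (n + 2))"
    using less.prems J by (intro of_nat_less_iff[THEN iffD2] mult_strict_mono) auto
  ultimately show ?case by simp
qed

lemma legendre_orthogonal:
  assumes "degree q < J"
  shows "poly_int (legendre J * q) = 0"
proof -
  have "poly_int (legendre J * q)
      = (\<Sum>i\<le>degree q. Polynomial.coeff q i * poly_int (legendre J * Polynomial.monom 1 i))"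
    by (subst (1) poly_as_sum_of_monoms[symmetric])
       (simp add: sum_distrib_left poly_int_sum poly_int_smult[symmetric] smult_monom flip: mult_smult_right)
  also have "\<dots> = 0" using assms by (intro sum.neutral) (auto intro!: legendre_orthogonal_monom)
  finally show ?thesis .
qed

section \<open>Endpoint values, degree and roots of the Legendre polynomials\<close>

lemma legendre_at_1: "poly (legendre n) 1 = 1"
  by (induction n rule: legendre.induct) (simp_all add: legendre.simps(3) field_simps)

lemma legendre_at_minus_1: "poly (legendre n) (-1) = (-1) ^ n"
  by (induction n rule: legendre.induct) (simp_all add: legendre.simps(3) field_simps)

lemma degree_legendre_le: "degree (legendre n) \<le> n"
proof (induction n rule: legendre.induct)
  case (3 n)
  have "degree ([:0, 1:] * legendre (Suc n)) \<le> Suc (Suc n)"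
    using degree_mult_le[of "[:0, 1:]" "legendre (Suc n)"] 3(1) by simp
  then show ?case using 3 unfolding legendre.simps(3)
    by (auto intro!: degree_diff_le order.trans[OF degree_smult_le])
qed simp_all

lemma legendre_nonzero: "legendre n \<noteq> 0"
  using legendre_at_1[of n] by auto

text \<open>S consists of the roots of odd order in the interval. Splitting off one linear factor
  changes the parity at c, so c leaves S if it was there and enters S otherwise; in the second case
  the product gains the factor (x - c)^2 and keeps its sign.\<close>

lemma sign_correcting_roots:
  fixes p :: "real poly"
  assumes "p \<noteq> 0"
  shows "\<exists>S. finite S \<and> S \<subseteq> {a<..<b} \<and> (\<forall>c\<in>S. poly p c = 0) \<and>
    ((\<forall>x\<in>{a<..<b}. poly (p * (\<Prod>c\<in>S. [:-c, 1:])) x \<ge> 0) \<or>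
     (\<forall>x\<in>{a<..<b}. poly (p * (\<Prod>c\<in>S. [:-c, 1:])) x \<le> 0))"
  using assms
proof (induction "degree p" arbitrary: p rule: less_induct)
  case less
  show ?case
  proof (cases "\<exists>c\<in>{a<..<b}. poly p c = 0")
    case False
    have "(\<forall>x\<in>{a<..<b}. poly p x \<ge> 0) \<or> (\<forall>x\<in>{a<..<b}. poly p x \<le> 0)"
    proof (rule ccontr)
      assume "\<not> ?thesis"
      then obtain x y where xy: "x \<in> {a<..<b}" "y \<in> {a<..<b}" "poly p x < 0" "0 < poly p y"
        by (auto simp: not_le)
      have cont: "continuous_on T (poly p)" for T by (intro continuous_intros)
      have "\<exists>c. min x y \<le> c \<and> c \<le> max x y \<and> poly p c = 0"
      proof (cases "x \<le> y")
        case True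
        then show ?thesis using IVT'[of "poly p" x 0 y, OF _ _ _ cont] xy by auto
      next
        case False
        then show ?thesis using IVT2'[of "poly p" x 0 y, OF _ _ _ cont] xy by auto
      qed
      then show False using False xy by (auto simp: min_def max_def split: if_splits)
    qed
    then show ?thesis by (intro exI[of _ "{}"]) simp
  next
    case True
    then obtain c where c: "c \<in> {a<..<b}" "poly p c = 0" by auto
    then obtain q where q: "p = [:-c, 1:] * q" by (metis poly_eq_0_iff_dvd dvdE)
    with less have q0: "q \<noteq> 0" by auto
    then have "degree q < degree p" unfolding q by (subst degree_mult_eq) auto
    from less(1)[OF this q0] obtain S where S: "finite S" "S \<subseteq> {a<..<b}" "\<forall>c\<in>S. poly q c = 0"
      "(\<forall>x\<in>{a<..<b}. poly (q * (\<Prod>c\<in>S. [:-c, 1:])) x \<ge> 0) \<or>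
       (\<forall>x\<in>{a<..<b}. poly (q * (\<Prod>c\<in>S. [:-c, 1:])) x \<le> 0)" by auto
    show ?thesis
    proof (cases "c \<in> S")
      case True
      have "p * (\<Prod>c\<in>S - {c}. [:-c, 1:]) = q * (\<Prod>c\<in>S. [:-c, 1:])"
        unfolding q prod.remove[OF S(1) True] by (simp only: mult_ac)
      then show ?thesis using S by (intro exI[of _ "S - {c}"]) (auto simp: q)
    next
      case False
      have "poly (p * (\<Prod>c\<in>insert c S. [:-c, 1:])) x = (x - c)\<^sup>2 * poly (q * (\<Prod>c\<in>S. [:-c, 1:])) x" for x
        unfolding q prod.insert[OF S(1) False] by (simp add: power2_eq_square algebra_simps)
      then show ?thesis using S c
        by (intro exI[of _ "insert c S"])
           (auto simp: q intro!: mult_nonneg_nonneg mult_nonneg_nonpos simp del: poly_mult poly_prod)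
    qed
  qed
qed

text \<open>A continuous function of constant sign with integral zero vanishes on the whole
  interval, which a nonzero polynomial cannot do.\<close>

lemma poly_int_signed_nonzero:
  assumes "p \<noteq> 0" and "(\<forall>x\<in>{-1<..<1}. poly p x \<ge> 0) \<or> (\<forall>x\<in>{-1<..<1}. poly p x \<le> 0)"
  shows "poly_int p \<noteq> 0"
proof -
  have main: False if p0: "p \<noteq> 0" and nn: "\<forall>x\<in>{-1<..<1}. poly p x \<ge> 0" and int: "poly_int p = 0" for p :: "real poly"
  proof -
    have "poly p x \<ge> 0" if "x \<in> {-1..1}" for x
    proof -
      have "x \<in> closure {-1<..<1::real}" using that by simp
      then show ?thesis
        by (rule continuous_ge_on_closure[rotated]) (use nn in \<open>auto intro!: continuous_intros\<close>)
    qed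
    moreover have "(poly p has_integral 0) (cbox (-1) 1)"
      using int poly_integrable[of p "-1" 1] unfolding poly_int_def
      by (metis integrable_integral box_real(2))
    moreover have "continuous_on (cbox (-1) 1) (poly p)" by (intro continuous_intros)
    ultimately have "poly p x = 0" if "x \<in> {-1..1}" for x
      using has_integral_0_cbox_imp_0[of "-1" 1 "poly p" x] that by auto
    then have "{-1..1} \<subseteq> {x. poly p x = 0}" by auto
    moreover have "\<not> finite {-1..1::real}" by (rule infinite_Icc) simp
    ultimately show False using poly_roots_finite[OF p0] finite_subset by blast
  qed
  show ?thesis
  proof (rule notI)
    assume 0: "poly_int p = 0"
    from assms(2) show False
    proof
      assume "\<forall>x\<in>{-1<..<1}. poly p x \<ge> 0" then show False using main[OF assms(1)] 0 by blast
    next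
      assume "\<forall>x\<in>{-1<..<1}. poly p x \<le> 0"
      then show False using main[of "-p"] assms(1) 0 poly_int_smult[of "-1" p] by auto
    qed
  qed
qed

text \<open>With fewer than J correcting roots, the product of their linear factors would have
  degree below J, and its product with \<open>legendre J\<close> would have constant sign, against
  orthogonality. So at least J distinct roots lie inside the interval, and the degree bound leaves
  room for no others.\<close>

lemma legendre_roots:
  shows card_legendre_roots: "card {x. poly (legendre J) x = 0} = J"
    and legendre_roots_bounds: "{x. poly (legendre J) x = 0} \<subseteq> {-1<..<1}"
    and degree_legendre: "degree (legendre J) = J"
proof -
  obtain S where S: "finite S" "S \<subseteq> {-1<..<1}" "\<forall>c\<in>S. poly (legendre J) c = 0"
    "(\<forall>x\<in>{-1<..<1}. poly (legendre J * (\<Prod>c\<in>S. [:-c, 1:])) x \<ge> 0) \<or>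
     (\<forall>x\<in>{-1<..<1}. poly (legendre J * (\<Prod>c\<in>S. [:-c, 1:])) x \<le> 0)"
    using sign_correcting_roots[OF legendre_nonzero[of J], of "-1" 1] by blast
  have "(\<Prod>c\<in>S. [:-c, 1:]) \<noteq> (0 :: real poly)" using S(1) by (subst prod_zero_iff) auto
  then have "poly_int (legendre J * (\<Prod>c\<in>S. [:-c, 1:])) \<noteq> 0"
    using S(4) legendre_nonzero by (intro poly_int_signed_nonzero) auto
  then have "\<not> degree (\<Prod>c\<in>S. [:-c, 1:] :: real poly) < J"
    using legendre_orthogonal by blast
  moreover have "degree (\<Prod>c\<in>S. [:-c, 1:] :: real poly) = card S"
    by (subst degree_prod_eq_sum_degree) auto
  ultimately have cS: "card S \<ge> J" by simp
  let ?R = "{x. poly (legendre J) x = 0}"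
  have fR: "finite ?R" by (rule poly_roots_finite[OF legendre_nonzero])
  have SR: "S \<subseteq> ?R" using S(3) by auto
  have "card ?R \<le> degree (legendre J)" by (rule card_poly_roots_bound[OF legendre_nonzero])
  with degree_legendre_le[of J] cS card_mono[OF fR SR]
  have c: "card ?R = J" "card S = card ?R" "degree (legendre J) = J" by auto
  then have "S = ?R" using card_subset_eq[OF fR SR] by simp
  with S(2) c show "card ?R = J" "?R \<subseteq> {-1<..<1}" "degree (legendre J) = J" by auto
qed

section \<open>Lagrange interpolation at the nodes and exactness of the rule\<close>

definition root_quotient :: "nat \<Rightarrow> real \<Rightarrow> real poly" where
  "root_quotient J c = legendre J div [:-c, 1:]"

lemma root_quotient:
  assumes "poly (legendre J) c = 0"
  shows legendre_root_quotient: "legendre J = [:-c, 1:] * root_quotient J c"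
    and poly_root_quotient_self: "poly (root_quotient J c) c = poly (pderiv (legendre J)) c"
    and degree_root_quotient: "degree (root_quotient J c) < J"
    and poly_root_quotient_other: "poly (legendre J) d = 0 \<Longrightarrow> d \<noteq> c \<Longrightarrow> poly (root_quotient J c) d = 0"
proof -
  show f: "legendre J = [:-c, 1:] * root_quotient J c"
    unfolding root_quotient_def using assms by (simp add: poly_eq_0_iff_dvd del: mult_pCons_left)
  show "poly (root_quotient J c) c = poly (pderiv (legendre J)) c"
  proof -
    have "pderiv (legendre J) = pderiv ([:-c, 1:] * root_quotient J c)" using f by simp
    also have "\<dots> = [:-c, 1:] * pderiv (root_quotient J c) + root_quotient J c"
      by (simp add: pderiv_mult pderiv_pCons del: mult_pCons_left)
    finally show ?thesis by simp
  qed
  have "root_quotient J c \<noteq> 0" using f legendre_nonzero[of J] by auto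
  then have "degree (legendre J) = 1 + degree (root_quotient J c)"
    by (subst f, subst degree_mult_eq) auto
  then show "degree (root_quotient J c) < J" using degree_legendre[of J] by simp
  show "poly (root_quotient J c) d = 0" if "poly (legendre J) d = 0" "d \<noteq> c"
  proof -
    have "(d - c) * poly (root_quotient J c) d = 0"
      using that(1) by (subst (asm) f) (simp add: algebra_simps)
    with that show ?thesis by simp
  qed
qed

text \<open>A multiple root c would make the nonzero quotient, of degree below J, vanish at all J
  roots.\<close>

lemma pderiv_legendre_root_nonzero:
  assumes "poly (legendre J) c = 0"
  shows "poly (pderiv (legendre J)) c \<noteq> 0"
proof
  let ?Q = "root_quotient J c"
  assume 0: "poly (pderiv (legendre J)) c = 0"
  have Q0: "?Q \<noteq> 0" using legendre_root_quotient[OF assms] legendre_nonzero[of J] by auto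
  have "{x. poly (legendre J) x = 0} \<subseteq> {x. poly ?Q x = 0}"
    using poly_root_quotient_self[OF assms] 0 poly_root_quotient_other[OF assms] by fastforce
  then have "card {x. poly (legendre J) x = 0} \<le> card {x. poly ?Q x = 0}"
    by (intro card_mono poly_roots_finite Q0)
  also have "\<dots> \<le> degree ?Q" by (rule card_poly_roots_bound[OF Q0])
  finally show False using degree_root_quotient[OF assms] card_legendre_roots[of J] by simp
qed

text \<open>\<open>gauss_weight\<close> as a function of the node instead of its index, so that sums
  can run over the set of roots without an ordering.\<close>

definition root_weight :: "nat \<Rightarrow> real \<Rightarrow> real" where
  "root_weight J c = 2 / ((1 - c\<^sup>2) * (poly (pderiv (legendre J)) c)\<^sup>2)"

definition lagrange_basis :: "nat \<Rightarrow> real \<Rightarrow> real poly" where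
  "lagrange_basis J c = Polynomial.smult (1 / poly (pderiv (legendre J)) c) (root_quotient J c)"

lemma lagrange_basis:
  assumes c: "poly (legendre J) c = 0"
  shows lagrange_basis_self: "poly (lagrange_basis J c) c = 1"
    and lagrange_basis_other: "poly (legendre J) d = 0 \<Longrightarrow> d \<noteq> c \<Longrightarrow> poly (lagrange_basis J c) d = 0"
    and degree_lagrange_basis: "degree (lagrange_basis J c) < J"
    and lagrange_basis_factor: "[:-c, 1:] * lagrange_basis J c
           = Polynomial.smult (1 / poly (pderiv (legendre J)) c) (legendre J)"
  using poly_root_quotient_self[OF c] poly_root_quotient_other[OF c] degree_root_quotient[OF c] legendre_root_quotient[OF c]
    pderiv_legendre_root_nonzero[OF c]
  by (auto simp: lagrange_basis_def mult_smult_right simp del: mult_pCons_left)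

text \<open>The squared Lagrange polynomial is integrated exactly by parts against \<open>x - c\<close>, because
  \<open>(x - c) * lagrange_basis J c\<close> is a multiple of the Legendre polynomial; this produces the closed
  form of the weights.\<close>

lemma poly_int_lagrange_basis:
  assumes c: "poly (legendre J) c = 0"
  shows "poly_int (lagrange_basis J c) = root_weight J c"
proof -
  let ?l = "lagrange_basis J c" and ?d = "poly (pderiv (legendre J)) c"
  have d0: "?d \<noteq> 0" by (rule pderiv_legendre_root_nonzero[OF c])
  have cb: "-1 < c" "c < 1" using legendre_roots_bounds[of J] c by auto
  have lx: "(x - c) * poly ?l x = poly (legendre J) x / ?d" for x
    using arg_cong[OF lagrange_basis_factor[OF c], of "\<lambda>p. poly p x"] by (simp add: algebra_simps)
  have dl: "degree ?l < J" by (rule degree_lagrange_basis[OF c])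
  \<comment> \<open>Used with a = x - c: the derivative of (x - c) l^2 is l^2 plus a multiple of
    \<open>legendre J\<close> times the derivative of l. The latter integrates to zero, so the
    integral of l^2 is given by boundary values.\<close>
  have "pderiv ((a * ?l) * ?l) = pderiv a * (?l * ?l) + Polynomial.smult 2 ((a * ?l) * pderiv ?l)" for a
    by (rule poly_eq_poly_eq_iff[THEN iffD1], rule ext) (simp add: pderiv_mult algebra_simps)
  from this[of "[:-c, 1:]"]
  have "pderiv (([:-c, 1:] * ?l) * ?l) = ?l * ?l + Polynomial.smult 2 (([:-c, 1:] * ?l) * pderiv ?l)"
    by (simp add: pderiv_pCons del: mult_pCons_left)
  then have "poly_int (pderiv (([:-c, 1:] * ?l) * ?l))
      = poly_int (?l * ?l) + 2 * (1 / ?d * poly_int (legendre J * pderiv ?l))"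
    unfolding lagrange_basis_factor[OF c] by (simp add: poly_int_add poly_int_smult)
  also have "poly_int (legendre J * pderiv ?l) = 0"
    using dl by (intro legendre_orthogonal) (simp add: degree_pderiv)
  finally have sq: "poly_int (?l * ?l) = (1 - c) * (poly ?l 1)\<^sup>2 + (1 + c) * (poly ?l (-1))\<^sup>2"
    unfolding poly_int_pderiv by (simp add: power2_eq_square algebra_simps)
  have l1: "poly ?l 1 = 1 / ((1 - c) * ?d)"
    using lx[of 1] cb d0 by (simp add: legendre_at_1 field_simps)
  have "poly ?l (-1) = (-1) ^ J / ?d / (-1 - c)"
    using lx[of "-1"] cb d0 by (simp add: legendre_at_minus_1 eq_divide_eq mult_ac)
  moreover have "((-1::real) ^ J)\<^sup>2 = 1" by (simp add: power2_eq_square flip: power_mult_distrib)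
  moreover have "(-1 - c)\<^sup>2 = (1 + c)\<^sup>2" by (simp add: power2_eq_square algebra_simps)
  ultimately have lm1: "(poly ?l (-1))\<^sup>2 = 1 / ((1 + c)\<^sup>2 * ?d\<^sup>2)"
    by (simp add: power_divide power_mult_distrib)
  have "(1 - c) * (poly ?l 1)\<^sup>2 + (1 + c) * (poly ?l (-1))\<^sup>2 = 1 / ((1 - c) * ?d\<^sup>2) + 1 / ((1 + c) * ?d\<^sup>2)"
    unfolding l1 lm1 using cb d0 by (simp add: power_divide power_mult_distrib power2_eq_square)
  also have "\<dots> = root_weight J c"
  proof -
    have "1 / (a * e) + 1 / (b * e) = (a + b) / (a * b * e)" if "a \<noteq> 0" "b \<noteq> 0" "e \<noteq> 0" for a b e :: real
      using that by (simp add: field_simps)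
    from this[of "1 - c" "1 + c" "?d\<^sup>2"] show ?thesis
      using cb d0 by (simp add: root_weight_def power2_eq_square algebra_simps)
  qed
  finally have "poly_int (?l * ?l) = root_weight J c" using sq by simp
  \<comment> \<open>The integrals of l^2 and l agree: l - 1 vanishes at c, so l^2 - l is
    \<open>legendre J\<close> times a polynomial of degree below J.\<close>
  moreover have "poly_int (?l * ?l - ?l) = 0"
  proof -
    have "poly (?l - 1) c = 0" using lagrange_basis_self[OF c] by simp
    then obtain s where s: "?l - 1 = [:-c, 1:] * s" by (metis poly_eq_0_iff_dvd dvdE)
    have "degree s < J"
    proof (cases "s = 0")
      case False
      have "degree (?l - 1) = 1 + degree s" unfolding s using False by (subst degree_mult_eq) auto
      moreover have "degree (?l - 1) \<le> degree ?l" by (rule degree_diff_le) auto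
      ultimately show ?thesis using dl by simp
    qed (use dl in auto)
    have "?l * ?l - ?l = ([:-c, 1:] * ?l) * s" using s by (metis mult.assoc mult.commute mult.right_neutral right_diff_distrib)
    then show ?thesis unfolding lagrange_basis_factor[OF c]
      using legendre_orthogonal[OF \<open>degree s < J\<close>] by (simp add: poly_int_smult)
  qed
  ultimately show ?thesis by (simp add: poly_int_diff)
qed

text \<open>Division by \<open>legendre J\<close> doubles the range of exact degrees. The multiple
  of \<open>legendre J\<close> integrates to zero by orthogonality and vanishes at the nodes, and
  the remainder equals its Lagrange interpolant.\<close>

lemma gauss_legendre_exact:
  assumes "degree p < 2 * J"
  shows "poly_int p = (\<Sum>c | poly (legendre J) c = 0. root_weight J c * poly p c)"
proof -
  let ?P = "legendre J" and ?R = "{c. poly (legendre J) c = 0}"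
  define q r where "q = p div ?P" and "r = p mod ?P"
  have J: "J > 0" using assms by simp
  have p: "p = ?P * q + r" by (simp add: q_def r_def)
  have dr: "degree r < J"
    unfolding r_def using degree_mod_less'[of ?P p] legendre_nonzero degree_legendre[of J] J
    by (cases "p mod ?P = 0") auto
  have dq: "degree q < J"
  proof (cases "q = 0")
    case False
    then have "degree (?P * q) = J + degree q"
      using legendre_nonzero degree_legendre by (simp add: degree_mult_eq)
    moreover have "degree (?P * q) < 2 * J"
    proof -
      have "?P * q = p - r" using p by simp
      then show ?thesis using degree_diff_less[of p "2 * J" r] assms dr by simp
    qed
    ultimately show ?thesis by simp
  qed (use J in auto)
  have fR: "finite ?R" by (rule poly_roots_finite[OF legendre_nonzero])
  define s where "s = (\<Sum>c\<in>?R. Polynomial.smult (poly p c) (lagrange_basis J c))"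
  have val: "poly s d = poly r d" if "d \<in> ?R" for d
  proof -
    have "poly s d = (\<Sum>c\<in>?R. if c = d then poly p d else 0)"
      unfolding s_def poly_sum
      using that lagrange_basis_self lagrange_basis_other by (intro sum.cong) auto
    also have "\<dots> = poly p d" using fR that by simp
    also have "\<dots> = poly r d" using that by (subst p) simp
    finally show ?thesis .
  qed
  have "r = s"
  proof (rule ccontr)
    assume "r \<noteq> s"
    then have n0: "r - s \<noteq> 0" by simp
    have ds: "degree s < J"
      unfolding s_def using J degree_lagrange_basis
      by (intro degree_sum_less) (auto intro: le_less_trans[OF degree_smult_le])
    have "?R \<subseteq> {x. poly (r - s) x = 0}" using val by auto
    then have "J \<le> card {x. poly (r - s) x = 0}"
      using card_mono[OF poly_roots_finite[OF n0]] card_legendre_roots[of J] by metis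
    also have "\<dots> \<le> degree (r - s)" by (rule card_poly_roots_bound[OF n0])
    also have "\<dots> < J" using dr ds by (rule degree_diff_less)
    finally show False by simp
  qed
  have "poly_int p = poly_int s"
    using legendre_orthogonal[OF dq] by (subst p) (simp add: poly_int_add \<open>r = s\<close>)
  also have "\<dots> = (\<Sum>c\<in>?R. root_weight J c * poly p c)"
    unfolding s_def poly_int_sum
    by (intro sum.cong) (auto simp: poly_int_smult poly_int_lagrange_basis)
  finally show ?thesis .
qed

lemma root_weight_pos:
  assumes "poly (legendre J) c = 0" shows "root_weight J c > 0"
proof -
  have "-1 < c" "c < 1" using legendre_roots_bounds[of J] assms by auto
  then have "c\<^sup>2 < 1" by (simp add: abs_square_less_1 abs_less_iff)
  then show ?thesis unfolding root_weight_def using pderiv_legendre_root_nonzero[OF assms] by simp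
qed

lemma sum_root_weight:
  assumes "J > 0" shows "(\<Sum>c | poly (legendre J) c = 0. root_weight J c) = 2"
proof -
  have "poly_int 1 = 2" using poly_int_pderiv[of "[:0, 1:]"] by (simp add: pderiv_pCons one_pCons)
  then show ?thesis using gauss_legendre_exact[of 1 J] assms by simp
qed

lemma bij_betw_legendre_root: "bij_betw (legendre_root J) {..<J} {c. poly (legendre J) c = 0}"
proof -
  let ?R = "{c. poly (legendre J) c = 0}"
  have fin: "finite ?R" by (rule poly_roots_finite[OF legendre_nonzero])
  have len: "length (sorted_list_of_set ?R) = J"
    using card_legendre_roots[of J] by (simp add: fin)
  show ?thesis
    unfolding legendre_root_def
    by (rule bij_betw_nth[of "sorted_list_of_set ?R"]) (auto simp: fin card_legendre_roots)
qed

lemma gauss_weight_root_weight: "gauss_weight J j = root_weight J (legendre_root J j)"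
  by (simp add: gauss_weight_def root_weight_def)

lemma legendre_root_bounds:
  assumes "j < J"
  shows "poly (legendre J) (legendre_root J j) = 0" "-1 < legendre_root J j" "legendre_root J j < 1"
    "gauss_weight J j > 0"
proof -
  have "legendre_root J j \<in> {c. poly (legendre J) c = 0}"
    using bij_betw_apply[OF bij_betw_legendre_root] assms by blast
  then show "poly (legendre J) (legendre_root J j) = 0" "-1 < legendre_root J j" "legendre_root J j < 1"
    "gauss_weight J j > 0"
    using legendre_roots_bounds[of J] root_weight_pos by (auto simp: gauss_weight_root_weight)
qed

lemma sum_gauss_weight: "J > 0 \<Longrightarrow> (\<Sum>j<J. gauss_weight J j) = 2"
  unfolding gauss_weight_root_weight
  using sum.reindex_bij_betw[OF bij_betw_legendre_root[of J], of "root_weight J"] sum_root_weight by simp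

lemma gauss_legendre_monomial:
  assumes "k < 2 * J"
  shows "((\<lambda>x. x ^ k) has_integral (\<Sum>j<J. gauss_weight J j * legendre_root J j ^ k)) {-1..1}"
proof -
  have "poly (Polynomial.monom 1 k :: real poly) = (\<lambda>x. x ^ k)" by (simp add: poly_monom fun_eq_iff)
  moreover have "degree (Polynomial.monom 1 k :: real poly) < 2 * J" using assms by (simp add: degree_monom_eq)
  note gauss_legendre_exact[OF this]
  moreover have "(\<Sum>c | poly (legendre J) c = 0. root_weight J c * c ^ k)
     = (\<Sum>j<J. gauss_weight J j * legendre_root J j ^ k)"
    unfolding gauss_weight_root_weight
    using sum.reindex_bij_betw[OF bij_betw_legendre_root[of J], of "\<lambda>c. root_weight J c * c ^ k"] by simp
  ultimately show ?thesis
    using integrable_integral[OF poly_integrable[of "Polynomial.monom 1 k" "-1" 1]]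
    by (simp add: poly_int_def)
qed

text \<open>The Taylor polynomial of degree 2J - 1 is integrated exactly. Its remainder counts once
  in the integral and once in the rule; both have total mass 2, the weights being positive, hence
  the factor 4.\<close>

lemma gauss_legendre_exp_error:
  assumes J: "J > 0"
  shows "cmod ((\<Sum>j<J. of_real (gauss_weight J j) * iexp (b * legendre_root J j))
      - integral {-1..1} (\<lambda>s. iexp (b * s))) \<le> 4 * \<bar>b\<bar> ^ (2 * J) / fact (2 * J)"
proof -
  define e where "e = \<bar>b\<bar> ^ (2 * J) / fact (2 * J)"
  define T :: "real \<Rightarrow> complex" where "T s = (\<Sum>k\<le>2 * J - 1. (\<i> * of_real (b * s)) ^ k / fact k)" for s
  have err: "cmod (iexp (b * s) - T s) \<le> e" if "\<bar>s\<bar> \<le> 1" for s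
  proof -
    have "cmod (iexp (b * s) - T s) \<le> \<bar>b * s\<bar> ^ (2 * J) / fact (2 * J)"
      using iexp_approx1[of "b * s" "2 * J - 1"] J by (simp add: T_def)
    also have "\<bar>b * s\<bar> ^ (2 * J) \<le> \<bar>b\<bar> ^ (2 * J)"
      using that by (intro power_mono) (auto simp: abs_mult mult_left_le)
    finally show ?thesis by (simp add: e_def divide_right_mono)
  qed
  have T: "T s = (\<Sum>k\<le>2 * J - 1. ((\<i> * of_real b) ^ k / fact k) * of_real (s ^ k))" for s
    by (simp add: T_def power_mult_distrib mult.assoc)
  have intT: "(T has_integral (\<Sum>k\<le>2 * J - 1. ((\<i> * of_real b) ^ k / fact k) *
      of_real (\<Sum>j<J. gauss_weight J j * legendre_root J j ^ k))) {-1..1}"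
    unfolding T[abs_def]
  proof (intro has_integral_sum finite_atMost has_integral_mult_right)
    fix k assume "k \<in> {..2 * J - 1}"
    then have "k < 2 * J" using J by auto
    from has_integral_linear[OF gauss_legendre_monomial[OF this] bounded_linear_of_real]
    show "((\<lambda>x. complex_of_real (x ^ k)) has_integral
       complex_of_real (\<Sum>j<J. gauss_weight J j * legendre_root J j ^ k)) {-1..1}"
      by (simp add: o_def)
  qed
  also have "(\<Sum>k\<le>2 * J - 1. ((\<i> * of_real b) ^ k / fact k) *
      of_real (\<Sum>j<J. gauss_weight J j * legendre_root J j ^ k))
     = (\<Sum>j<J. of_real (gauss_weight J j) * T (legendre_root J j))"
    unfolding T of_real_sum sum_distrib_left by (subst sum.swap) (simp add: mult_ac)
  finally have intT: "(T has_integral (\<Sum>j<J. of_real (gauss_weight J j) * T (legendre_root J j))) {-1..1}" .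
  have inte: "(\<lambda>s. iexp (b * s)) integrable_on {-1..1}"
    by (intro integrable_continuous_interval continuous_intros)
  have "cmod (integral {-1..1} (\<lambda>s. iexp (b * s)) - (\<Sum>j<J. of_real (gauss_weight J j) * T (legendre_root J j)))
      \<le> e * (1 - (-1))"
  proof -
    have "((\<lambda>s. iexp (b * s) - T s) has_integral
       (integral {-1..1} (\<lambda>s. iexp (b * s)) - (\<Sum>j<J. of_real (gauss_weight J j) * T (legendre_root J j)))) (cbox (-1) 1)"
      using has_integral_diff[OF integrable_integral[OF inte] intT] by simp
    from has_integral_bound[OF _ this, of e] err show ?thesis
      by (auto simp: e_def abs_le_iff)
  qed
  moreover have "cmod ((\<Sum>j<J. of_real (gauss_weight J j) * iexp (b * legendre_root J j))
      - (\<Sum>j<J. of_real (gauss_weight J j) * T (legendre_root J j))) \<le> e * 2"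
  proof -
    have "cmod ((\<Sum>j<J. of_real (gauss_weight J j) * iexp (b * legendre_root J j))
      - (\<Sum>j<J. of_real (gauss_weight J j) * T (legendre_root J j)))
     = cmod (\<Sum>j<J. of_real (gauss_weight J j) * (iexp (b * legendre_root J j) - T (legendre_root J j)))"
      by (simp add: right_diff_distrib sum_subtractf)
    also have "\<dots> \<le> (\<Sum>j<J. gauss_weight J j * e)"
    proof (intro sum_norm_le)
      fix j assume "j \<in> {..<J}"
      with legendre_root_bounds[of j J] err[of "legendre_root J j"]
      show "cmod (of_real (gauss_weight J j) * (iexp (b * legendre_root J j) - T (legendre_root J j)))
          \<le> gauss_weight J j * e"
        unfolding norm_mult by (intro mult_mono) (auto simp: abs_le_iff)
    qed
    also have "\<dots> = 2 * e" using sum_gauss_weight[OF J] by (simp flip: sum_distrib_right)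
    finally show ?thesis by simp
  qed
  ultimately show ?thesis unfolding e_def[symmetric]
    using norm_triangle_ineq4[of "(\<Sum>j<J. of_real (gauss_weight J j) * iexp (b * legendre_root J j))
      - (\<Sum>j<J. of_real (gauss_weight J j) * T (legendre_root J j))"
      "integral {-1..1} (\<lambda>s. iexp (b * s)) - (\<Sum>j<J. of_real (gauss_weight J j) * T (legendre_root J j))"]
    by (simp add: e_def)
qed

section \<open>Trapezoidal sums of Gaussian waves\<close>

definition gauss_wave :: "real \<Rightarrow> complex \<Rightarrow> complex" where
  "gauss_wave u z = exp (- z\<^sup>2 / 2 - \<i> * of_real u * z)"

text \<open>The reciprocal 1/(\<open>grid_kernel\<close> - 1) has simple poles at the grid points z0
  + h j, with residue h/(2 pi i). It is exponentially small far below the real axis and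
  exponentially close to -1 far above it.\<close>

definition grid_kernel :: "real \<Rightarrow> real \<Rightarrow> complex \<Rightarrow> complex" where
  "grid_kernel h z0 z = exp (2 * of_real pi * \<i> * (z - of_real z0) / of_real h)"

lemma norm_gauss_wave: "cmod (gauss_wave u (Complex x y)) = exp (- x\<^sup>2 / 2 + y\<^sup>2 / 2 + u * y)"
  by (simp add: gauss_wave_def Re_power2 power2_eq_square diff_divide_distrib)

lemma norm_gauss_wave_real: "cmod (gauss_wave u (of_real x)) = exp (- x\<^sup>2 / 2)"
  using norm_gauss_wave[of u x 0] by (simp add: complex_of_real_def)

lemma norm_grid_kernel: "cmod (grid_kernel h z0 (Complex x y)) = exp (- 2 * pi * y / h)"
  by (simp add: grid_kernel_def Re_divide_of_real)

lemma grid_kernel_eq_1_iff: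
  assumes "h > 0"
  shows "grid_kernel h z0 z = 1 \<longleftrightarrow> (\<exists>j::int. z = of_real (z0 + h * of_int j))"
proof -
  have "grid_kernel h z0 z = 1 \<longleftrightarrow> Im z = 0 \<and> (\<exists>j::int. (Re z - z0) / h = of_int j)"
  proof -
    define w where "w = 2 * of_real pi * \<i> * (z - of_real z0) / of_real h"
    have w: "Re w = - 2 * pi * Im z / h" "Im w = 2 * pi * ((Re z - z0) / h)"
      by (simp_all add: w_def Re_divide_of_real Im_divide_of_real)
    have "Im w = of_int (2 * j) * pi \<longleftrightarrow> (Re z - z0) / h = of_int j" for j :: int
    proof -
      have "2 * pi * t = of_int (2 * j) * pi \<longleftrightarrow> t = of_int j" for t :: real by auto
      then show ?thesis by (simp only: w(2))
    qed
    moreover have "Re w = 0 \<longleftrightarrow> Im z = 0" unfolding w using assms by simp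
    ultimately show ?thesis unfolding grid_kernel_def exp_eq_1 w_def[symmetric] by simp
  qed
  also have "\<dots> \<longleftrightarrow> (\<exists>j::int. z = of_real (z0 + h * of_int j))"
    using assms by (auto simp: complex_eq_iff field_simps)
  finally show ?thesis .
qed

lemma holomorphic_gauss_wave: "gauss_wave u holomorphic_on S"
  unfolding gauss_wave_def by (intro holomorphic_intros) auto

lemma holomorphic_grid_kernel: "h > 0 \<Longrightarrow> grid_kernel h z0 holomorphic_on S"
  unfolding grid_kernel_def by (intro holomorphic_intros) auto

lemma residue_grid_kernel:
  assumes h: "h > 0" and p: "p = of_real (z0 + h * of_int j)"
  shows "residue (\<lambda>z. gauss_wave u z / (grid_kernel h z0 z - 1)) p
    = gauss_wave u p * of_real h / (2 * of_real pi * \<i>)"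
proof -
  have E: "grid_kernel h z0 p = 1" using grid_kernel_eq_1_iff[OF h] p by blast
  have "((\<lambda>z. grid_kernel h z0 z - 1) has_field_derivative
      (grid_kernel h z0 p * (2 * of_real pi * \<i> / of_real h))) (at p)"
    unfolding grid_kernel_def using h by (auto intro!: derivative_eq_intros)
  then have D: "((\<lambda>z. grid_kernel h z0 z - 1) has_field_derivative
      (2 * of_real pi * \<i> / of_real h)) (at p)" by (simp add: E)
  have "residue (\<lambda>z. gauss_wave u z / (grid_kernel h z0 z - 1)) p
    = gauss_wave u p / (2 * of_real pi * \<i> / of_real h)"
    by (rule residue_simple_pole_deriv[where s = UNIV])
       (use h D E in \<open>auto intro!: holomorphic_intros holomorphic_gauss_wave holomorphic_grid_kernel
          simp: gauss_wave_def\<close>)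
  then show ?thesis by simp
qed

text \<open>The vertical sides lie halfway between grid points, so the contour avoids the poles and
  encloses exactly those with index from m1 to m2.\<close>

lemma rectangle_grid_sum:
  fixes m1 m2 :: int
  assumes h: "h > 0" and b: "b > 0" and m: "m1 \<le> m2"
    and R1: "R1 = z0 + h * (of_int m1 - 1/2)" and R2: "R2 = z0 + h * (of_int m2 + 1/2)"
  shows "contour_integral (rectpath (Complex R1 (-b)) (Complex R2 b))
      (\<lambda>z. gauss_wave u z / (grid_kernel h z0 z - 1))
    = of_real h * (\<Sum>j\<in>{m1..m2}. gauss_wave u (of_real (z0 + h * of_int j)))"
proof -
  let ?g = "rectpath (Complex R1 (-b)) (Complex R2 b)"
  let ?F = "\<lambda>z. gauss_wave u z / (grid_kernel h z0 z - 1)"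
  define pt where "pt j = complex_of_real (z0 + h * of_int j)" for j :: int
  \<comment> \<open>The margin h/4 makes the strip an open neighbourhood of the rectangle and still
    keeps the next grid points outside, since these are h/2 away from the sides.\<close>
  define S where "S = {z. R1 - h/4 < Re z \<and> Re z < R2 + h/4}"
  have S: "open S" "connected S"
  proof -
    have "S = {z. R1 - h/4 < Re z} \<inter> {z. Re z < R2 + h/4}" by (auto simp: S_def)
    then show "open S" "connected S"
      by (auto intro!: open_Int open_halfspace_Re_gt open_halfspace_Re_lt convex_connected convex_Int
          convex_halfspace_Re_gt convex_halfspace_Re_lt)
  qed
  have R12: "R1 < R2" using h m by (simp add: R1 R2 add_strict_mono mult_strict_left_mono)
  have between: "m1 \<le> j \<and> j \<le> m2" if "R1 - h/4 < z0 + h * of_int j" "z0 + h * of_int j < R2 + h/4" for j :: int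
  proof -
    have "h * (of_int m1 - 1) < h * of_int j" using that(1) h by (simp add: R1 algebra_simps)
    moreover have "h * of_int j < h * (of_int m2 + 1)" using that(2) h by (simp add: R2 algebra_simps)
    ultimately have "of_int m1 - 1 < (of_int j :: real)" "(of_int j :: real) < of_int m2 + 1" using h by simp_all
    then show ?thesis by linarith
  qed
  have inbox: "pt j \<in> box (Complex R1 (-b)) (Complex R2 b)" if "j \<in> {m1..m2}" for j
  proof -
    have "h * (of_int m1 - 1/2) < h * of_int j" "h * of_int j < h * (of_int m2 + 1/2)"
      using that h by (intro mult_strict_left_mono; simp; linarith)+
    then show ?thesis using b by (simp add: in_box_complex_iff pt_def R1 R2)
  qed
  have nz: "grid_kernel h z0 z \<noteq> 1" if "z \<in> S - pt ` {m1..m2}" for z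
  proof
    assume "grid_kernel h z0 z = 1"
    then obtain j :: int where j: "z = pt j" using grid_kernel_eq_1_iff[OF h] by (auto simp: pt_def)
    with that between[of j] show False by (auto simp: S_def pt_def)
  qed
  have cb: "cbox (Complex R1 (-b)) (Complex R2 b) \<subseteq> S"
    using h by (auto simp: in_cbox_complex_iff S_def)
  have pi: "path_image ?g \<subseteq> S - pt ` {m1..m2}"
  proof -
    have "path_image ?g = cbox (Complex R1 (-b)) (Complex R2 b) - box (Complex R1 (-b)) (Complex R2 b)"
      using R12 b by (intro path_image_rectpath_cbox_minus_box) auto
    then show ?thesis using cb inbox by blast
  qed
  have "contour_integral ?g ?F = complex_of_real (2 * pi) * \<i> *
      (\<Sum>p\<in>pt ` {m1..m2}. winding_number ?g p * residue ?F p)"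
  proof (rule Residue_theorem[OF S])
    show "?F holomorphic_on S - pt ` {m1..m2}"
      using h nz by (intro holomorphic_intros holomorphic_gauss_wave holomorphic_grid_kernel) auto
    show "\<forall>z. z \<notin> S \<longrightarrow> winding_number ?g z = 0"
      using cb R12 b by (auto intro!: winding_number_rectpath_outside)
  qed (use pi in auto)
  also have "(\<Sum>p\<in>pt ` {m1..m2}. winding_number ?g p * residue ?F p)
      = (\<Sum>p\<in>pt ` {m1..m2}. gauss_wave u p * of_real h / (2 * of_real pi * \<i>))"
  proof (rule sum.cong[OF refl])
    fix p assume "p \<in> pt ` {m1..m2}"
    then obtain j where "j \<in> {m1..m2}" "p = pt j" by auto
    then show "winding_number ?g p * residue ?F p = gauss_wave u p * of_real h / (2 * of_real pi * \<i>)"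
      using winding_number_rectpath[OF inbox, of j] residue_grid_kernel[OF h, of p z0 j u]
      by (simp add: pt_def)
  qed
  also have "\<dots> = (\<Sum>j\<in>{m1..m2}. gauss_wave u (pt j) * of_real h / (2 * of_real pi * \<i>))"
    using h by (subst sum.reindex) (auto simp: inj_on_def pt_def)
  also have "\<dots> = (\<Sum>j\<in>{m1..m2}. gauss_wave u (pt j)) * (of_real h / (2 * of_real pi * \<i>))"
    by (simp add: sum_distrib_right sum_divide_distrib)
  finally show ?thesis by (simp add: pt_def)
qed

section \<open>Estimates on the sides of the rectangle and Gaussian line integrals\<close>

lemma norm_divide_grid_le:
  assumes "q > 1" "cmod E = q" shows "cmod (w / (E - 1)) \<le> cmod w / (q - 1)"
proof -
  have "q - 1 \<le> cmod (E - 1)" using norm_triangle_ineq2[of E 1] assms by simp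
  then show ?thesis using assms by (simp add: norm_divide frac_le)
qed

text \<open>Adding w corrects for the limit -1 of 1/(E - 1) at small E: the sum is w E/(E - 1),
  which is as small as w/(E - 1) is for large E.\<close>

lemma norm_divide_grid_le':
  assumes q: "q > 1" and E: "cmod E = 1 / q" shows "cmod (w / (E - 1) + w) \<le> cmod w / (q - 1)"
proof -
  have E0: "E \<noteq> 0" "E \<noteq> 1" using assms by auto
  have "w / (E - 1) + w = - (w / (1 / E - 1))"
    using E0 by (simp add: field_simps)
  moreover have "cmod (1 / E) = q" using E q by (simp add: norm_divide)
  ultimately show ?thesis using norm_divide_grid_le[OF q, of "1 / E" w] by (simp only: norm_minus_cancel)
qed

lemma norm_inverse_negative_kernel:
  assumes "E = - of_real a" "a \<ge> 0" shows "cmod (w / (E - 1)) \<le> cmod w"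
proof -
  have "E - 1 = - of_real (a + 1)" using assms by simp
  then have "cmod (E - 1) = a + 1" using assms by (simp only: norm_minus_cancel norm_of_real)
  then show ?thesis using assms by (simp add: norm_divide divide_le_eq mult_left_le mult_le_cancel_left1)
qed

text \<open>On the line of height b the wave is a constant times the normal density times a
  character of frequency -(u + b). The characteristic function of the normal distribution then gives
  a value independent of b, so the line need not be moved to the real axis.\<close>

lemma has_bochner_gauss_wave_line:
  "has_bochner_integral lborel (\<lambda>x. gauss_wave u (Complex x b)) (of_real (sqrt (2 * pi) * exp (- u\<^sup>2 / 2)))"
proof -
  let ?c = "complex_of_real (sqrt (2 * pi) * exp (b\<^sup>2 / 2 + u * b))"
  have eq: "gauss_wave u (Complex x b) = ?c * (std_normal_density x *\<^sub>R iexp (- (u + b) * x))" for x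
  proof -
    have "gauss_wave u (Complex x b) = exp (of_real (b\<^sup>2 / 2 + u * b) + of_real (- x\<^sup>2 / 2) + \<i> * of_real (- (u + b) * x))"
      unfolding gauss_wave_def
      by (rule arg_cong[where f = exp]) (simp add: complex_eq_iff Re_power2 Im_power2 field_simps power2_eq_square)
    also have "\<dots> = of_real (exp (b\<^sup>2 / 2 + u * b)) * of_real (exp (- x\<^sup>2 / 2)) * iexp (- (u + b) * x)"
      by (simp only: exp_add exp_of_real)
    also have "\<dots> = ?c * (std_normal_density x *\<^sub>R iexp (- (u + b) * x))"
      by (simp add: std_normal_density_def scaleR_conv_of_real)
    finally show ?thesis .
  qed
  have int: "integrable lborel (\<lambda>x. std_normal_density x *\<^sub>R iexp (- (u + b) * x))"
    by (rule Bochner_Integration.integrable_bound[OF integrable_std_normal_moment[of 0]])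
       (auto simp: norm_mult intro!: AE_I2)
  have "(LINT x|lborel. std_normal_density x *\<^sub>R iexp (- (u + b) * x)) = char std_normal_distribution (- (u + b))"
    unfolding char_def by (subst integral_density) auto
  also have "\<dots> = of_real (exp (- (u + b)\<^sup>2 / 2))"
    by (simp add: char_std_normal_distribution power2_eq_square algebra_simps)
  finally have "has_bochner_integral lborel (\<lambda>x. std_normal_density x *\<^sub>R iexp (- (u + b) * x))
      (of_real (exp (- (u + b)\<^sup>2 / 2)))"
    using int by (simp add: has_bochner_integral_iff)
  then have "has_bochner_integral lborel (\<lambda>x. gauss_wave u (Complex x b)) (?c * of_real (exp (- (u + b)\<^sup>2 / 2)))"
    unfolding eq by (intro has_bochner_integral_mult_right)
  also have "?c * of_real (exp (- (u + b)\<^sup>2 / 2)) = of_real (sqrt (2 * pi) * (exp (b\<^sup>2 / 2 + u * b) * exp (- (u + b)\<^sup>2 / 2)))"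
    by (simp only: of_real_mult mult.assoc)
  also have "exp (b\<^sup>2 / 2 + u * b) * exp (- (u + b)\<^sup>2 / 2) = exp (- u\<^sup>2 / 2)"
    unfolding exp_add[symmetric] by (rule arg_cong[where f = exp]) (simp add: power2_eq_square field_simps)
  finally show ?thesis .
qed

lemma gauss_wave_line_norm_integral:
  "integral {-R..R} (\<lambda>x. cmod (gauss_wave u (Complex x b)))
       \<le> sqrt (2 * pi) * exp (b\<^sup>2 / 2 + u * b)"
proof -
  have ex: "cmod (gauss_wave u (Complex x b)) = (sqrt (2 * pi) * exp (b\<^sup>2 / 2 + u * b)) * std_normal_density x" for x
  proof -
    have "exp (- x\<^sup>2 / 2 + b\<^sup>2 / 2 + u * b) = exp (b\<^sup>2 / 2 + u * b) * exp (- x\<^sup>2 / 2)"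
      unfolding exp_add[symmetric] by simp
    then show ?thesis by (simp add: norm_gauss_wave std_normal_density_def)
  qed
  have ii: "integrable lborel std_normal_density" using integrable_std_normal_moment[of 0] by simp
  have "integral {-R..R} std_normal_density = (LINT x:{-R..R}|lborel. std_normal_density x)"
    by (rule set_borel_integral_eq_integral(2)[symmetric])
       (use integrable_mult_indicator[OF _ ii, of "{-R..R}"] in \<open>auto simp: set_integrable_def\<close>)
  also have "\<dots> \<le> (LINT x|lborel. std_normal_density x)"
    unfolding set_lebesgue_integral_def
    by (rule Bochner_Integration.integral_mono)
       (use ii integrable_mult_indicator[OF _ ii, of "{-R..R}"] in \<open>auto simp: indicator_def\<close>)
  also have "\<dots> = 1" using has_bochner_integral_integral_eq[OF std_normal_moment_even[of 0]] by simp
  finally have "integral {-R..R} std_normal_density \<le> 1" .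
  then show ?thesis unfolding ex by (simp add: mult_left_le)
qed

lemma gauss_wave_line_limit:
  assumes R: "\<And>N. R N \<le> R (Suc N)" and lim: "filterlim R at_top sequentially"
  shows "(\<lambda>N. integral {- R N..R N} (\<lambda>x. gauss_wave u (Complex x b)))
     \<longlonglongrightarrow> of_real (sqrt (2 * pi) * exp (- u\<^sup>2 / 2))"
proof -
  let ?f = "\<lambda>x. gauss_wave u (Complex x b)"
  have int: "integrable lborel ?f" and val: "integral\<^sup>L lborel ?f = of_real (sqrt (2 * pi) * exp (- u\<^sup>2 / 2))"
    using has_bochner_gauss_wave_line[of u b] by (simp_all add: has_bochner_integral_iff)
  have mono: "incseq R" using R by (rule incseq_SucI)
  have un: "(\<Union>N. {- R N..R N}) = UNIV"
  proof -
    have "x \<in> (\<Union>N. {- R N..R N})" for x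
    proof -
      have "eventually (\<lambda>N. R N \<ge> \<bar>x\<bar>) sequentially" using lim by (simp add: filterlim_at_top)
      then obtain N where "R N \<ge> \<bar>x\<bar>" by (auto simp: eventually_sequentially)
      then have "x \<in> {- R N..R N}" by (auto simp: abs_le_iff)
      then show ?thesis by blast
    qed
    then show ?thesis by blast
  qed
  have "(\<lambda>N. LINT x:{- R N..R N}|lborel. ?f x) \<longlonglongrightarrow> (LINT x:(\<Union>N. {- R N..R N})|lborel. ?f x)"
  proof (rule set_integral_cont_up)
    show "incseq (\<lambda>N. {- R N..R N})"
    proof (rule monoI)
      fix m n :: nat assume "m \<le> n"
      then have "R m \<le> R n" by (rule incseqD[OF mono])
      then show "{- R m..R m} \<subseteq> {- R n..R n}" by auto
    qed
  qed (use int in \<open>auto simp: un set_integrable_def\<close>)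
  moreover have "(LINT x:{- R N..R N}|lborel. ?f x) = integral {- R N..R N} ?f" for N
    by (rule set_borel_integral_eq_integral(2)) (use int in \<open>auto simp: set_integrable_def intro!: integrable_mult_indicator\<close>)
  ultimately show ?thesis unfolding un by (simp add: set_lebesgue_integral_def val)
qed

lemma contour_integral_rectpath_split:
  assumes "continuous_on (path_image (rectpath (Complex a1 b1) (Complex a2 b2))) f"
    and "a1 \<le> a2" "b1 \<le> b2"
  shows "contour_integral (rectpath (Complex a1 b1) (Complex a2 b2)) f
    = contour_integral (linepath (Complex a1 b1) (Complex a2 b1)) f
      + contour_integral (linepath (Complex a2 b1) (Complex a2 b2)) f
      - contour_integral (linepath (Complex a1 b2) (Complex a2 b2)) f
      - contour_integral (linepath (Complex a1 b1) (Complex a1 b2)) f"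
proof -
  have pi: "path_image (rectpath (Complex a1 b1) (Complex a2 b2)) =
     closed_segment (Complex a1 b1) (Complex a2 b1) \<union> closed_segment (Complex a2 b1) (Complex a2 b2)
     \<union> closed_segment (Complex a2 b2) (Complex a1 b2) \<union> closed_segment (Complex a1 b2) (Complex a1 b1)"
    by (simp add: rectpath_def Let_def path_image_join Un_assoc)
  have c: "continuous_on (closed_segment (Complex a1 b1) (Complex a2 b1)) f"
     "continuous_on (closed_segment (Complex a2 b1) (Complex a2 b2)) f"
     "continuous_on (closed_segment (Complex a2 b2) (Complex a1 b2)) f"
     "continuous_on (closed_segment (Complex a1 b2) (Complex a1 b1)) f"
    using pi by (auto intro!: continuous_on_subset[OF assms(1)])
  note ci = c[THEN contour_integrable_continuous_linepath]
  have "contour_integral (rectpath (Complex a1 b1) (Complex a2 b2)) f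
    = contour_integral (linepath (Complex a1 b1) (Complex a2 b1)) f
      + (contour_integral (linepath (Complex a2 b1) (Complex a2 b2)) f
      + (contour_integral (linepath (Complex a2 b2) (Complex a1 b2)) f
      + contour_integral (linepath (Complex a1 b2) (Complex a1 b1)) f))"
    using ci by (simp add: rectpath_def Let_def contour_integral_join contour_integrable_join valid_path_join)
  then show ?thesis
    using contour_integral_reverse_linepath[OF c(3)] contour_integral_reverse_linepath[OF c(4)] by simp
qed

text \<open>On a vertical line halfway between two grid points the kernel is a negative real number, so the
  factor \<open>1 / (grid_kernel - 1)\<close> is harmless there.\<close>

lemma grid_kernel_midpoint:
  assumes h: "h > 0" and x: "x = z0 + h * (of_int m - 1/2)"
  shows "grid_kernel h z0 (Complex x y) = - of_real (exp (- 2 * pi * y / h))"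
proof -
  have "2 * of_real pi * \<i> * (Complex x y - of_real z0) / of_real h
      = of_real (- 2 * pi * y / h) + \<i> * of_real (2 * pi * of_int m) + - (\<i> * of_real pi)"
    using h by (simp add: complex_eq_iff x Re_divide_of_real Im_divide_of_real field_simps)
  then have "grid_kernel h z0 (Complex x y) = exp (of_real (- 2 * pi * y / h)) *
      exp (\<i> * of_real (2 * pi * of_int m)) * exp (- (\<i> * of_real pi))"
    unfolding grid_kernel_def by (simp only: exp_add)
  moreover have "exp (\<i> * complex_of_real (2 * pi * of_int m)) = 1"
    using exp_2pi_1_int[of m] by (simp add: mult_ac)
  moreover have "exp (- (\<i> * complex_of_real pi)) = -1" by (simp add: exp_minus)
  ultimately show ?thesis by (simp only: exp_of_real mult_1_right mult_minus_right)
qed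

text \<open>For fixed b the bound tends to zero as |x| grows; this removes the vertical sides when
  the rectangle is widened.\<close>

lemma vertical_side_bound:
  assumes h: "h > 0" and b: "b > 0" and x: "x = z0 + h * (of_int m - 1/2)"
  shows "cmod (contour_integral (linepath (Complex x (-b)) (Complex x b))
      (\<lambda>z. gauss_wave u z / (grid_kernel h z0 z - 1))) \<le> exp (- x\<^sup>2 / 2 + b\<^sup>2 / 2 + \<bar>u\<bar> * b) * (2 * b)"
proof -
  let ?F = "\<lambda>z. gauss_wave u z / (grid_kernel h z0 z - 1)"
  have pt: "cmod (?F z) \<le> exp (- x\<^sup>2 / 2 + b\<^sup>2 / 2 + \<bar>u\<bar> * b)"
    and ne: "grid_kernel h z0 z - 1 \<noteq> 0"
    if "z \<in> closed_segment (Complex x (-b)) (Complex x b)" for z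
  proof -
    have z: "Re z = x" "\<bar>Im z\<bar> \<le> b"
      using that b by (auto simp: closed_segment_same_Re closed_segment_eq_real_ivl split: if_splits)
    then have ze: "z = Complex x (Im z)" by (simp add: complex_eq_iff)
    have E: "grid_kernel h z0 z = - of_real (exp (- 2 * pi * Im z / h))"
      by (subst ze, rule grid_kernel_midpoint[OF h x])
    then have "cmod (?F z) \<le> cmod (gauss_wave u z)" by (rule norm_inverse_negative_kernel) simp
    also have "\<dots> = exp (- x\<^sup>2 / 2 + (Im z)\<^sup>2 / 2 + u * Im z)" by (subst ze, rule norm_gauss_wave)
    also have "\<dots> \<le> exp (- x\<^sup>2 / 2 + b\<^sup>2 / 2 + \<bar>u\<bar> * b)"
    proof -
      have "(Im z)\<^sup>2 \<le> b\<^sup>2" using z(2) b by (intro abs_le_square_iff[THEN iffD1]) simp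
      moreover have "u * Im z \<le> \<bar>u\<bar> * b"
      proof -
        have "u * Im z \<le> \<bar>u\<bar> * \<bar>Im z\<bar>" unfolding abs_mult[symmetric] by (rule abs_ge_self)
        also have "\<dots> \<le> \<bar>u\<bar> * b" using z(2) by (rule mult_left_mono) simp
        finally show ?thesis .
      qed
      ultimately show ?thesis by simp
    qed
    finally show "cmod (?F z) \<le> exp (- x\<^sup>2 / 2 + b\<^sup>2 / 2 + \<bar>u\<bar> * b)" .
    have "grid_kernel h z0 z - 1 = of_real (- exp (- 2 * pi * Im z / h) - 1)" using E by simp
    moreover have "- exp (- 2 * pi * Im z / h) - 1 < 0" using exp_gt_zero[of "- 2 * pi * Im z / h"] by linarith
    ultimately show "grid_kernel h z0 z - 1 \<noteq> 0" by (metis of_real_eq_0_iff less_irrefl)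
  qed
  have "continuous_on (closed_segment (Complex x (-b)) (Complex x b)) ?F"
    using ne h by (intro continuous_intros holomorphic_on_imp_continuous_on holomorphic_gauss_wave holomorphic_grid_kernel) auto
  then have "?F contour_integrable_on linepath (Complex x (-b)) (Complex x b)"
    by (rule contour_integrable_continuous_linepath)
  then have "(?F has_contour_integral contour_integral (linepath (Complex x (-b)) (Complex x b)) ?F)
      (linepath (Complex x (-b)) (Complex x b))" by (rule has_contour_integral_integral)
  from has_contour_integral_bound_linepath[OF this _ pt]
  have "cmod (contour_integral (linepath (Complex x (-b)) (Complex x b)) ?F)
     \<le> exp (- x\<^sup>2 / 2 + b\<^sup>2 / 2 + \<bar>u\<bar> * b) * cmod (Complex x b - Complex x (-b))" by simp
  also have "Complex x b - Complex x (-b) = \<i> * of_real (2 * b)" by (simp add: complex_eq_iff)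
  also have "cmod (\<i> * of_real (2 * b)) = 2 * b" using b by (simp add: norm_mult)
  finally show ?thesis .
qed

lemma contour_integral_linepath_horizontal:
  assumes "a < b"
  shows "contour_integral (linepath (Complex a y) (Complex b y)) f = integral {a..b} (\<lambda>x. f (Complex x y))"
proof -
  have "linepath (Complex a y) (Complex b y) t = linepath (of_real a) (of_real b) t + \<i> * of_real y" for t
    by (simp add: linepath_def complex_eq_iff algebra_simps)
  moreover have "Complex b y - Complex a y = of_real b - of_real a" by (simp add: complex_eq_iff)
  ultimately have "contour_integral (linepath (Complex a y) (Complex b y)) f
      = contour_integral (linepath (of_real a) (of_real b)) (\<lambda>z. f (z + \<i> * of_real y))"
    by (simp add: contour_integral_integral)
  also have "\<dots> = integral {a..b} (\<lambda>x. f (of_real x + \<i> * of_real y))"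
    using assms by (subst contour_integral_linepath_Reals_eq) auto
  also have "(\<lambda>x. of_real x + \<i> * of_real y) = (\<lambda>x. Complex x y)" by (simp add: complex_eq_iff fun_eq_iff)
  then have "(\<lambda>x. f (of_real x + \<i> * of_real y)) = (\<lambda>x. f (Complex x y))" by (metis (mono_tags, lifting))
  finally show ?thesis .
qed

lemma continuous_gauss_wave_line: "continuous_on S (\<lambda>x. gauss_wave u (Complex x b))"
proof -
  have "(\<lambda>x. Complex x b) = (\<lambda>x. of_real x + \<i> * of_real b)" by (simp add: complex_eq_iff fun_eq_iff)
  then have c: "continuous_on S (\<lambda>x. Complex x b)" by (simp only:) (intro continuous_intros)
  show ?thesis unfolding gauss_wave_def by (intro continuous_intros c) auto
qed

lemma continuous_grid_kernel_line: "h > 0 \<Longrightarrow> continuous_on S (\<lambda>x. grid_kernel h z0 (Complex x b))"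
proof -
  assume h: "h > 0"
  have "(\<lambda>x. Complex x b) = (\<lambda>x. of_real x + \<i> * of_real b)" by (simp add: complex_eq_iff fun_eq_iff)
  then have c: "continuous_on S (\<lambda>x. Complex x b)" by (simp only:) (intro continuous_intros)
  show ?thesis unfolding grid_kernel_def using h by (intro continuous_intros c) auto
qed

text \<open>The top side, traversed backwards, contributes almost the Gaussian integral because 1/(E
  - 1) is close to -1 there; the bottom side contributes almost nothing. Both deviations carry the
  factor 1/(q - 1), and \<open>exp (u * b)\<close> and \<open>exp (- (u * b))\<close> are the growth
  of the wave at heights b and -b.\<close>

lemma symmetric_grid_sum_error:
  fixes m1 m2 :: int
  assumes h: "h > 0" and b: "b > 0" and m: "m1 \<le> m2" and R: "R > 0"
    and R1: "- R = z0 + h * (of_int m1 - 1/2)" and R2: "R = z0 + h * (of_int m2 + 1/2)"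
  shows "cmod (of_real h * (\<Sum>j\<in>{m1..m2}. gauss_wave u (of_real (z0 + h * of_int j)))
       - integral {-R..R} (\<lambda>x. gauss_wave u (Complex x b)))
    \<le> sqrt (2 * pi) * exp (b\<^sup>2 / 2) * (exp (u * b) + exp (- (u * b))) / (exp (2 * pi * b / h) - 1)
       + 2 * (exp (- R\<^sup>2 / 2 + b\<^sup>2 / 2 + \<bar>u\<bar> * b) * (2 * b))"
proof -
  let ?F = "\<lambda>z. gauss_wave u z / (grid_kernel h z0 z - 1)"
  define q where "q = exp (2 * pi * b / h)"
  have q1: "q > 1" using h b by (simp add: q_def)
  have qi: "exp (- 2 * pi * b / h) = 1 / q" by (simp add: q_def exp_minus divide_inverse)
  have up: "cmod (grid_kernel h z0 (Complex x b)) = 1 / q" for x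
    by (simp only: norm_grid_kernel qi)
  have down: "cmod (grid_kernel h z0 (Complex x (-b))) = q" for x
    by (simp add: norm_grid_kernel q_def)
  have ne: "grid_kernel h z0 (Complex x b) - 1 \<noteq> 0" "grid_kernel h z0 (Complex x (-b)) - 1 \<noteq> 0" for x
    using up[of x] down[of x] q1 by auto
  have neg: "grid_kernel h z0 (Complex x y) - 1 \<noteq> 0" if "x = R \<or> x = -R" for x y
  proof -
    have "\<exists>m::int. x = z0 + h * (of_int m - 1/2)"
      using that
    proof
      assume "x = R" then show ?thesis by (intro exI[of _ "m2 + 1"]) (simp add: R2)
    next
      assume "x = -R" then show ?thesis by (intro exI[of _ m1]) (simp add: R1)
    qed
    then obtain m :: int where "x = z0 + h * (of_int m - 1/2)" by blast
    from grid_kernel_midpoint[OF h this, of y]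
    have "grid_kernel h z0 (Complex x y) - 1 = of_real (- exp (- 2 * pi * y / h) - 1)" by simp
    moreover have "- exp (- 2 * pi * y / h) - 1 < 0" using exp_gt_zero[of "- 2 * pi * y / h"] by linarith
    ultimately show ?thesis by (metis of_real_eq_0_iff less_irrefl)
  qed
  let ?S = "of_real h * (\<Sum>j\<in>{m1..m2}. gauss_wave u (of_real (z0 + h * of_int j)))"
  have "continuous_on (path_image (rectpath (Complex (-R) (-b)) (Complex R b))) ?F"
  proof (intro continuous_intros holomorphic_on_imp_continuous_on holomorphic_gauss_wave holomorphic_grid_kernel h ballI)
    fix z assume "z \<in> path_image (rectpath (Complex (-R) (-b)) (Complex R b))"
    then have "Re z = R \<or> Re z = -R \<or> Im z = b \<or> Im z = -b"
      using R b by (subst (asm) path_image_rectpath) auto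
    then show "grid_kernel h z0 z - 1 \<noteq> 0"
      using neg[of "Re z" "Im z"] ne[of "Re z"] by (metis complex.collapse)
  qed
  note split = contour_integral_rectpath_split[OF this]
  have horiz: "contour_integral (linepath (Complex (-R) y) (Complex R y)) ?F = integral {-R..R} (\<lambda>x. ?F (Complex x y))" for y
    using R by (intro contour_integral_linepath_horizontal) auto
  define V1 V2 where "V1 = contour_integral (linepath (Complex (-R) (-b)) (Complex (-R) b)) ?F"
    and "V2 = contour_integral (linepath (Complex R (-b)) (Complex R b)) ?F"
  have V: "cmod V1 \<le> exp (- R\<^sup>2 / 2 + b\<^sup>2 / 2 + \<bar>u\<bar> * b) * (2 * b)"
     "cmod V2 \<le> exp (- R\<^sup>2 / 2 + b\<^sup>2 / 2 + \<bar>u\<bar> * b) * (2 * b)"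
  proof -
    show "cmod V1 \<le> exp (- R\<^sup>2 / 2 + b\<^sup>2 / 2 + \<bar>u\<bar> * b) * (2 * b)"
      using vertical_side_bound[OF h b R1, of u] by (simp add: V1_def)
    have "R = z0 + h * (of_int (m2 + 1) - 1/2)" by (simp add: R2)
    from vertical_side_bound[OF h b this, of u]
    show "cmod V2 \<le> exp (- R\<^sup>2 / 2 + b\<^sup>2 / 2 + \<bar>u\<bar> * b) * (2 * b)"
      by (simp only: V2_def)
  qed
  have cF: "(\<lambda>x. ?F (Complex x b)) integrable_on {-R..R}" "(\<lambda>x. ?F (Complex x (-b))) integrable_on {-R..R}"
    "(\<lambda>x. gauss_wave u (Complex x y)) integrable_on {-R..R}"
    "(\<lambda>x. cmod (gauss_wave u (Complex x y)) / (q - 1)) integrable_on {-R..R}" for y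
    using ne q1 by (intro integrable_continuous_interval continuous_intros continuous_gauss_wave_line
        continuous_grid_kernel_line h; simp)+
  have "?S = integral {-R..R} (\<lambda>x. ?F (Complex x (-b))) + V2 - integral {-R..R} (\<lambda>x. ?F (Complex x b)) - V1"
    using rectangle_grid_sum[OF h b m R1 R2, of u] split R b
    unfolding horiz V1_def V2_def by simp
  \<comment> \<open>Minus the top integral is rewritten as the integral of the wave minus that of
    the small quantity F + wave.\<close>
  then have "?S - integral {-R..R} (\<lambda>x. gauss_wave u (Complex x b))
     = integral {-R..R} (\<lambda>x. ?F (Complex x (-b)))
       - integral {-R..R} (\<lambda>x. ?F (Complex x b) + gauss_wave u (Complex x b)) + (V2 - V1)"
    by (subst Henstock_Kurzweil_Integration.integral_add[OF cF(1,3)]) simp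
  then have "cmod (?S - integral {-R..R} (\<lambda>x. gauss_wave u (Complex x b)))
     \<le> cmod (integral {-R..R} (\<lambda>x. ?F (Complex x (-b))))
       + cmod (integral {-R..R} (\<lambda>x. ?F (Complex x b) + gauss_wave u (Complex x b))) + (cmod V2 + cmod V1)"
    by (simp only:) (intro norm_triangle_le add_mono norm_triangle_ineq4 norm_triangle_ineq)
  also have "cmod (integral {-R..R} (\<lambda>x. ?F (Complex x (-b)))) \<le>
      integral {-R..R} (\<lambda>x. cmod (gauss_wave u (Complex x (-b))) / (q - 1))"
    using cF by (intro integral_norm_bound_integral norm_divide_grid_le q1 down) auto
  also have "\<dots> = integral {-R..R} (\<lambda>x. cmod (gauss_wave u (Complex x (-b)))) / (q - 1)" by simp
  also have "\<dots> \<le> sqrt (2 * pi) * exp (b\<^sup>2 / 2 - u * b) / (q - 1)"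
    using gauss_wave_line_norm_integral[of R u "-b"] q1 by (intro divide_right_mono) auto
  also have "cmod (integral {-R..R} (\<lambda>x. ?F (Complex x b) + gauss_wave u (Complex x b))) \<le>
      integral {-R..R} (\<lambda>x. cmod (gauss_wave u (Complex x b)) / (q - 1))"
    using cF by (intro integral_norm_bound_integral norm_divide_grid_le' q1 up)
      (auto intro!: Henstock_Kurzweil_Integration.integrable_add)
  also have "\<dots> = integral {-R..R} (\<lambda>x. cmod (gauss_wave u (Complex x b))) / (q - 1)" by simp
  also have "\<dots> \<le> sqrt (2 * pi) * exp (b\<^sup>2 / 2 + u * b) / (q - 1)"
    using gauss_wave_line_norm_integral[of R u b] q1 by (intro divide_right_mono) auto
  finally have "cmod (?S - integral {-R..R} (\<lambda>x. gauss_wave u (Complex x b)))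
     \<le> sqrt (2 * pi) * exp (b\<^sup>2 / 2 - u * b) / (q - 1) + sqrt (2 * pi) * exp (b\<^sup>2 / 2 + u * b) / (q - 1)
       + 2 * (exp (- R\<^sup>2 / 2 + b\<^sup>2 / 2 + \<bar>u\<bar> * b) * (2 * b))"
    using V by simp
  also have "sqrt (2 * pi) * exp (b\<^sup>2 / 2 - u * b) / (q - 1) + sqrt (2 * pi) * exp (b\<^sup>2 / 2 + u * b) / (q - 1)
     = sqrt (2 * pi) * exp (b\<^sup>2 / 2) * (exp (u * b) + exp (- (u * b))) / (q - 1)"
  proof -
    have e: "exp (b\<^sup>2 / 2 - u * b) = exp (b\<^sup>2 / 2) * exp (- (u * b))" "exp (b\<^sup>2 / 2 + u * b) = exp (b\<^sup>2 / 2) * exp (u * b)"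
      unfolding exp_add[symmetric] by simp_all
    show ?thesis unfolding e add_divide_distrib[symmetric] by (simp add: algebra_simps)
  qed
  finally show ?thesis by (simp add: q_def)
qed

section \<open>Truncation of the infinite grid\<close>

lemma gauss_half_integral:
  assumes "T \<ge> 0" shows "integral {0..T} (\<lambda>s. exp (- s\<^sup>2 / 2)) \<le> sqrt (2 * pi) / 2"
proof -
  let ?g = "\<lambda>s::real. exp (- s\<^sup>2 / 2)"
  have i: "?g integrable_on S" if "S = {a..b}" for a b S
    unfolding that by (intro integrable_continuous_interval continuous_intros) auto
  have "integral {-T..0} ?g = integral {0..T} ?g"
    using Henstock_Kurzweil_Integration.integral_reflect_real[of T 0 ?g] by simp
  moreover have "integral {-T..0} ?g + integral {0..T} ?g = integral {-T..T} ?g"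
    using assms by (intro Henstock_Kurzweil_Integration.integral_combine i[OF refl]) auto
  moreover have "integral {-T..T} ?g \<le> sqrt (2 * pi)"
    using gauss_wave_line_norm_integral[of T 0 0] by (simp add: norm_gauss_wave)
  ultimately show ?thesis by simp
qed

lemma riemann_sum_gauss:
  assumes h: "h > 0"
  shows "(\<Sum>j=1..N. h * exp (- (h * real j)\<^sup>2 / 2)) \<le> integral {0..h * real N} (\<lambda>s. exp (- s\<^sup>2 / 2))"
proof (induction N)
  case (Suc N)
  let ?g = "\<lambda>s::real. exp (- s\<^sup>2 / 2)"
  have i: "?g integrable_on {a..b}" for a b
    by (intro integrable_continuous_interval continuous_intros) auto
  have "h * ?g (h * real (Suc N)) = integral {h * real N..h * real (Suc N)} (\<lambda>s. ?g (h * real (Suc N)))"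
    using h by (simp add: algebra_simps)
  also have "\<dots> \<le> integral {h * real N..h * real (Suc N)} ?g"
    using h by (intro integral_le i) (auto intro!: power_mono intro: order.trans[rotated])
  finally have "h * ?g (h * real (Suc N)) \<le> integral {h * real N..h * real (Suc N)} ?g" .
  moreover have "integral {0..h * real N} ?g + integral {h * real N..h * real (Suc N)} ?g = integral {0..h * real (Suc N)} ?g"
    using h by (intro Henstock_Kurzweil_Integration.integral_combine i) (auto simp: mult_left_mono)
  ultimately show ?case using Suc by simp
qed simp

text \<open>The inequality (Z + h j)^2 \<ge> Z^2 + (h j)^2 splits off the factor exp(-Z^2/2). What
  is left is a right-endpoint Riemann sum of a decreasing function on the half line.\<close>

lemma gauss_grid_tail:
  assumes h: "h > 0" and Z: "Z \<ge> 0"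
  shows "(\<Sum>j=1..N. h * exp (- (Z + h * real j)\<^sup>2 / 2)) \<le> sqrt (2 * pi) / 2 * exp (- Z\<^sup>2 / 2)"
proof -
  have "(\<Sum>j=1..N. h * exp (- (Z + h * real j)\<^sup>2 / 2)) \<le> (\<Sum>j=1..N. exp (- Z\<^sup>2 / 2) * (h * exp (- (h * real j)\<^sup>2 / 2)))"
  proof (rule sum_mono)
    fix j
    have "- (Z + h * real j)\<^sup>2 / 2 \<le> - Z\<^sup>2 / 2 + - (h * real j)\<^sup>2 / 2"
      using h Z by (simp add: power2_sum field_simps)
    then have "exp (- (Z + h * real j)\<^sup>2 / 2) \<le> exp (- Z\<^sup>2 / 2) * exp (- (h * real j)\<^sup>2 / 2)"
      unfolding exp_add[symmetric] by simp
    then show "h * exp (- (Z + h * real j)\<^sup>2 / 2) \<le> exp (- Z\<^sup>2 / 2) * (h * exp (- (h * real j)\<^sup>2 / 2))"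
      using h by (simp add: mult.left_commute)
  qed
  also have "\<dots> = exp (- Z\<^sup>2 / 2) * (\<Sum>j=1..N. h * exp (- (h * real j)\<^sup>2 / 2))" by (simp add: sum_distrib_left)
  also have "\<dots> \<le> exp (- Z\<^sup>2 / 2) * (sqrt (2 * pi) / 2)"
    using riemann_sum_gauss[OF h, of N] gauss_half_integral[of "h * real N"] h by (intro mult_left_mono) auto
  finally show ?thesis by (simp add: mult.commute)
qed

lemma grid_sum_split:
  fixes g :: "int \<Rightarrow> complex"
  assumes "K \<ge> 1"
  shows "(\<Sum>j\<in>{- int N..int K - 1 + int N}. g j)
     = (\<Sum>k<K. g (int k)) + (\<Sum>j=1..N. g (- int j)) + (\<Sum>j=1..N. g (int K - 1 + int j))"
proof (induction N)
  case 0
  have "{0..int K - 1} = int ` {..<K}"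
    by (auto simp: image_iff intro!: bexI[of _ "nat _"])
  then show ?case by (simp add: sum.reindex)
next
  case (Suc N)
  have "{- int (Suc N)..int K - 1 + int (Suc N)} =
     insert (- int (Suc N)) (insert (int K - 1 + int (Suc N)) {- int N..int K - 1 + int N})"
    using assms by auto
  then have "(\<Sum>j\<in>{- int (Suc N)..int K - 1 + int (Suc N)}. g j)
     = g (- int (Suc N)) + (g (int K - 1 + int (Suc N)) + (\<Sum>j\<in>{- int N..int K - 1 + int N}. g j))"
    using assms by simp
  then show ?case unfolding Suc.IH by simp
qed

text \<open>The K grid points are extended by N more on either side, and N tends to infinity. The
  vertical sides then disappear, while the added points cost at most the Gaussian tail, uniformly in
  N.\<close>

lemma truncated_grid_sum_error:
  assumes h: "h > 0" and b: "b > 0" and K: "K \<ge> 1" and Z: "Z \<ge> 0" and hZ: "h * (real K - 1) = 2 * Z"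
  shows "cmod (of_real h * (\<Sum>k<K. gauss_wave u (of_real (- Z + h * real k)))
       - of_real (sqrt (2 * pi) * exp (- u\<^sup>2 / 2)))
    \<le> sqrt (2 * pi) * exp (- Z\<^sup>2 / 2)
      + sqrt (2 * pi) * exp (b\<^sup>2 / 2) * (exp (u * b) + exp (- (u * b))) / (exp (2 * pi * b / h) - 1)"
proof -
  let ?G = "of_real h * (\<Sum>k<K. gauss_wave u (of_real (- Z + h * real k)))"
  let ?A = "sqrt (2 * pi) * exp (b\<^sup>2 / 2) * (exp (u * b) + exp (- (u * b))) / (exp (2 * pi * b / h) - 1)"
  \<comment> \<open>Half a step beyond the last added point, so that both vertical sides pass
    through midpoints.\<close>
  define R where "R N = Z + h * (real N + 1/2)" for N
  define I where "I N = integral {- R N..R N} (\<lambda>x. gauss_wave u (Complex x b))" for N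
  define V where "V N = 2 * (exp (- (R N)\<^sup>2 / 2 + b\<^sup>2 / 2 + \<bar>u\<bar> * b) * (2 * b))" for N
  have bound: "cmod (?G - I N) \<le> sqrt (2 * pi) * exp (- Z\<^sup>2 / 2) + ?A + V N" for N
  proof -
    let ?w = "\<lambda>j::int. gauss_wave u (of_real (- Z + h * of_int j))"
    let ?T = "of_real h * (\<Sum>j\<in>{- int N..int K - 1 + int N}. ?w j)"
    have "cmod (?T - I N) \<le> ?A + V N"
      unfolding I_def V_def
    proof (rule symmetric_grid_sum_error[OF h b])
      show "R N > 0" using h Z by (simp add: R_def add_nonneg_pos)
      show "- R N = - Z + h * (of_int (- int N) - 1 / 2)" by (simp add: R_def algebra_simps)
      show "R N = - Z + h * (of_int (int K - 1 + int N) + 1 / 2)" using hZ by (simp add: R_def algebra_simps)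
    qed (use K in auto)
    moreover have "cmod (?G - ?T) \<le> sqrt (2 * pi) * exp (- Z\<^sup>2 / 2)"
    proof -
      have "?G - ?T = - ((\<Sum>j=1..N. of_real h * ?w (- int j)) + (\<Sum>j=1..N. of_real h * ?w (int K - 1 + int j)))"
        unfolding grid_sum_split[OF K] by (simp add: algebra_simps sum_distrib_left)
      then have "cmod (?G - ?T) \<le> cmod (\<Sum>j=1..N. of_real h * ?w (- int j)) + cmod (\<Sum>j=1..N. of_real h * ?w (int K - 1 + int j))"
        by (simp only: norm_minus_cancel norm_triangle_ineq)
      also have "\<dots> \<le> (\<Sum>j=1..N. h * exp (- (Z + h * real j)\<^sup>2 / 2)) + (\<Sum>j=1..N. h * exp (- (Z + h * real j)\<^sup>2 / 2))"
      proof (intro add_mono sum_norm_le)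
        fix j
        have "- Z + h * of_int (- int j) = - (Z + h * real j)" by simp
        then have "cmod (?w (- int j)) = exp (- (Z + h * real j)\<^sup>2 / 2)"
          unfolding norm_gauss_wave_real by (simp only: power2_minus)
        then show "cmod (of_real h * ?w (- int j)) \<le> h * exp (- (Z + h * real j)\<^sup>2 / 2)"
          using h by (simp add: norm_mult)
        have "- Z + h * of_int (int K - 1 + int j) = Z + h * real j" using hZ by (simp add: algebra_simps)
        then have "cmod (?w (int K - 1 + int j)) = exp (- (Z + h * real j)\<^sup>2 / 2)"
          unfolding norm_gauss_wave_real by (simp only:)
        then show "cmod (of_real h * ?w (int K - 1 + int j)) \<le> h * exp (- (Z + h * real j)\<^sup>2 / 2)"
          using h by (simp add: norm_mult)
      qed
      also have "\<dots> \<le> sqrt (2 * pi) * exp (- Z\<^sup>2 / 2)" using gauss_grid_tail[OF h Z, of N] by simp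
      finally show ?thesis .
    qed
    ultimately show ?thesis using norm_triangle_ineq[of "?G - ?T" "?T - I N"] by simp
  qed
  have Rlim: "filterlim R at_top sequentially"
  proof (rule filterlim_at_top_mono)
    show "filterlim (\<lambda>N. h * real N) at_top sequentially"
      by (intro filterlim_tendsto_pos_mult_at_top[OF tendsto_const h filterlim_real_sequentially])
    show "\<forall>\<^sub>F N in sequentially. h * real N \<le> R N" using h Z by (simp add: R_def algebra_simps)
  qed
  have "I \<longlonglongrightarrow> of_real (sqrt (2 * pi) * exp (- u\<^sup>2 / 2))"
    unfolding I_def using h by (intro gauss_wave_line_limit Rlim) (auto simp: R_def)
  then have l1: "(\<lambda>N. cmod (?G - I N)) \<longlonglongrightarrow> cmod (?G - of_real (sqrt (2 * pi) * exp (- u\<^sup>2 / 2)))"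
    by (intro tendsto_intros)
  have "V \<longlonglongrightarrow> 0"
  proof -
    have "V = (\<lambda>N. 4 * b * exp (b\<^sup>2 / 2 + \<bar>u\<bar> * b) * exp (- ((R N)\<^sup>2 / 2)))"
    proof
      fix N
      have "exp (- (R N)\<^sup>2 / 2 + b\<^sup>2 / 2 + \<bar>u\<bar> * b) = exp (b\<^sup>2 / 2 + \<bar>u\<bar> * b) * exp (- ((R N)\<^sup>2 / 2))"
        unfolding exp_add[symmetric] by simp
      then show "V N = 4 * b * exp (b\<^sup>2 / 2 + \<bar>u\<bar> * b) * exp (- ((R N)\<^sup>2 / 2))" by (simp add: V_def)
    qed
    moreover have "filterlim (\<lambda>N. (R N)\<^sup>2 / 2) at_top sequentially"
      using filterlim_pow_at_top[OF _ Rlim, of 2] filterlim_tendsto_pos_mult_at_top[of "\<lambda>_. 1/2" "1/2" sequentially "\<lambda>N. (R N)\<^sup>2"]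
      by simp
    then have "(\<lambda>N. exp (- ((R N)\<^sup>2 / 2))) \<longlonglongrightarrow> 0"
      using filterlim_compose[OF exp_at_bot, of "\<lambda>N. - ((R N)\<^sup>2 / 2)" sequentially] by (simp add: filterlim_uminus_at_bot)
    ultimately show ?thesis by (simp add: tendsto_mult_right_zero)
  qed
  then have l2: "(\<lambda>N. sqrt (2 * pi) * exp (- Z\<^sup>2 / 2) + ?A + V N) \<longlonglongrightarrow> sqrt (2 * pi) * exp (- Z\<^sup>2 / 2) + ?A + 0"
    by (intro tendsto_intros)
  show ?thesis using LIMSEQ_le[OF l1 l2] bound by auto
qed

section \<open>Concentration and sampling\<close>

text \<open>\<open>embed_pmf\<close> is governed by its weights only when these are nonnegative with
  total mass 1; both conditions have to be secured before anything is known about the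
  support.\<close>

lemma set_finite_pmf:
  assumes "finite S" "\<And>x. x \<in> S \<Longrightarrow> w x \<ge> 0" "(\<Sum>x\<in>S. w x) = 1"
  shows "set_pmf (finite_pmf S w) \<subseteq> {x \<in> S. w x \<noteq> 0}"
proof -
  let ?f = "\<lambda>x. if x \<in> S then w x else 0"
  have "(\<integral>\<^sup>+x. ennreal (?f x) \<partial>count_space UNIV) = (\<Sum>x\<in>S. ennreal (?f x))"
    using assms(1) by (intro nn_integral_count_space') auto
  also have "\<dots> = ennreal (\<Sum>x\<in>S. ?f x)" using assms(2) by (intro sum_ennreal) auto
  also have "(\<Sum>x\<in>S. ?f x) = 1" using assms(3) by simp
  finally have "(\<integral>\<^sup>+x. ennreal (?f x) \<partial>count_space UNIV) = 1" by simp
  moreover have "?f x \<ge> 0" for x using assms(2) by simp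
  ultimately show ?thesis unfolding finite_pmf_def by (subst set_embed_pmf) auto
qed

text \<open>Hoeffding's lemma for one sample in [-M, M], multiplied over independent samples.
  Nonnegative integrals let the product factor without integrability conditions.\<close>

lemma replicate_pmf_exp_moment:
  assumes l: "l > 0" and bound: "\<And>z. z \<in> set_pmf p \<Longrightarrow> \<bar>f z\<bar> \<le> M"
  shows "(\<integral>\<^sup>+zs. ennreal (exp (l * (\<Sum>z\<leftarrow>zs. f z - measure_pmf.expectation p f))) \<partial>replicate_pmf N p)
     \<le> ennreal (exp (l\<^sup>2 * M\<^sup>2 / 2)) ^ N"
proof (induction N)
  case (Suc N)
  let ?\<mu> = "measure_pmf.expectation p f"
  interpret interval_bounded_random_variable "measure_pmf p" f "-M" M
    by unfold_locales (use bound in \<open>auto simp: abs_le_iff AE_measure_pmf_iff minus_le_iff\<close>)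
  have "(\<integral>\<^sup>+z. ennreal (exp (l * (f z - ?\<mu>))) \<partial>p) \<le> ennreal (exp (l\<^sup>2 * (M - - M)\<^sup>2 / 8))"
    by (rule Hoeffdings_lemma_nn_integral[OF l])
  also have "l\<^sup>2 * (M - - M)\<^sup>2 / 8 = l\<^sup>2 * M\<^sup>2 / 2" by (simp add: power2_eq_square)
  finally have 1: "(\<integral>\<^sup>+z. ennreal (exp (l * (f z - ?\<mu>))) \<partial>p) \<le> ennreal (exp (l\<^sup>2 * M\<^sup>2 / 2))" .
  have "(\<integral>\<^sup>+zs. ennreal (exp (l * (\<Sum>z\<leftarrow>zs. f z - ?\<mu>))) \<partial>replicate_pmf (Suc N) p)
      = (\<integral>\<^sup>+z. \<integral>\<^sup>+zs. ennreal (exp (l * (f z - ?\<mu>))) * ennreal (exp (l * (\<Sum>z\<leftarrow>zs. f z - ?\<mu>))) \<partial>replicate_pmf N p \<partial>p)"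
    by (simp add: distrib_left exp_add ennreal_mult')
  also have "\<dots> = (\<integral>\<^sup>+z. ennreal (exp (l * (f z - ?\<mu>))) \<partial>p) *
      (\<integral>\<^sup>+zs. ennreal (exp (l * (\<Sum>z\<leftarrow>zs. f z - ?\<mu>))) \<partial>replicate_pmf N p)"
    by (simp add: nn_integral_cmult nn_integral_multc)
  also have "\<dots> \<le> ennreal (exp (l\<^sup>2 * M\<^sup>2 / 2)) * ennreal (exp (l\<^sup>2 * M\<^sup>2 / 2)) ^ N"
    by (intro mult_mono 1 Suc.IH) auto
  finally show ?case by simp
qed simp

lemma replicate_pmf_tail:
  assumes M: "M > 0" and bound: "\<And>z. z \<in> set_pmf p \<Longrightarrow> \<bar>f z\<bar> \<le> M" and t: "t > 0"
  shows "measure_pmf.prob (replicate_pmf N p) {zs. (\<Sum>z\<leftarrow>zs. f z - measure_pmf.expectation p f) \<ge> real N * t}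
    \<le> exp (- (real N * t\<^sup>2 / (2 * M\<^sup>2)))"
proof -
  let ?S = "\<lambda>zs. \<Sum>z\<leftarrow>zs. f z - measure_pmf.expectation p f"
  \<comment> \<open>This value minimises -l N t + N l^2 M^2/2, the exponent of the Chernoff
    bound.\<close>
  define l where "l = t / M\<^sup>2"
  have l: "l > 0" using M t by (simp add: l_def)
  have "ennreal (measure_pmf.prob (replicate_pmf N p) {zs. ?S zs \<ge> real N * t})
      = emeasure (replicate_pmf N p) {zs \<in> UNIV. 1 \<le> ennreal (exp (- (l * real N * t))) * ennreal (exp (l * ?S zs))}"
  proof -
    have "1 \<le> ennreal (exp (- (l * real N * t))) * ennreal (exp (l * ?S zs)) \<longleftrightarrow> ?S zs \<ge> real N * t" for zs
    proof -
      have "1 \<le> ennreal (exp (- (l * real N * t))) * ennreal (exp (l * ?S zs))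
         \<longleftrightarrow> 1 \<le> exp (- (l * real N * t) + l * ?S zs)"
        unfolding exp_add by (subst ennreal_mult'[symmetric]) auto
      also have "\<dots> \<longleftrightarrow> l * (real N * t) \<le> l * ?S zs" by (simp add: mult.assoc)
      finally show ?thesis using l by simp
    qed
    then show ?thesis by (simp add: measure_pmf.emeasure_eq_measure)
  qed
  also have "\<dots> \<le> ennreal (exp (- (l * real N * t))) * (\<integral>\<^sup>+zs. ennreal (exp (l * ?S zs)) * indicator UNIV zs \<partial>replicate_pmf N p)"
    by (rule nn_integral_Markov_inequality) auto
  also have "\<dots> \<le> ennreal (exp (- (l * real N * t))) * ennreal (exp (l\<^sup>2 * M\<^sup>2 / 2)) ^ N"
    using replicate_pmf_exp_moment[of l p f M N, OF l bound] by (intro mult_left_mono) auto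
  also have "\<dots> = ennreal (exp (- (l * real N * t)) * exp (l\<^sup>2 * M\<^sup>2 / 2) ^ N)"
    by (simp add: ennreal_mult' ennreal_power)
  also have "exp (- (l * real N * t)) * exp (l\<^sup>2 * M\<^sup>2 / 2) ^ N = exp (- (real N * t\<^sup>2 / (2 * M\<^sup>2)))"
    unfolding exp_of_nat_mult[symmetric] exp_add[symmetric]
    using M by (intro arg_cong[where f = exp]) (simp add: l_def power2_eq_square field_simps)
  finally show ?thesis by (simp add: ennreal_le_iff)
qed

lemma avg_pmf_concentration:
  fixes p :: "complex pmf"
  assumes M: "M > 0" and bound: "\<And>z. z \<in> set_pmf p \<Longrightarrow> cmod z \<le> M" and eta: "\<eta> > 0" and N: "N > 0"
  shows "measure_pmf.prob (avg_pmf N p) {z. cmod (z - measure_pmf.expectation p (\<lambda>z. z)) > \<eta>}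
    \<le> 4 * exp (- (real N * \<eta>\<^sup>2 / (4 * M\<^sup>2)))"
proof -
  let ?E = "measure_pmf.expectation p (\<lambda>z. z)" and ?R = "replicate_pmf N p"
  \<comment> \<open>If the real and imaginary parts of the deviation are both below \<eta>/sqrt 2 in
    absolute value, its modulus is at most \<eta>. A large deviation therefore falls into one of
    four one-sided tails.\<close>
  define t where "t = \<eta> / sqrt 2"
  have t: "t > 0" "t\<^sup>2 = \<eta>\<^sup>2 / 2" using eta by (auto simp: t_def power_divide)
  define B where "B g = {zs. (\<Sum>z\<leftarrow>zs. g z - measure_pmf.expectation p g) \<ge> real N * t}" for g :: "complex \<Rightarrow> real"
  have int: "integrable (measure_pmf p) (\<lambda>z. z)"
    by (rule measure_pmf.integrable_const_bound[where B = M]) (use bound in \<open>auto simp: AE_measure_pmf_iff\<close>)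
  have tail: "measure_pmf.prob ?R (B g) \<le> exp (- (real N * \<eta>\<^sup>2 / (4 * M\<^sup>2)))"
    if "\<And>z. \<bar>g z\<bar> \<le> cmod z" for g
  proof -
    have "measure_pmf.prob ?R (B g) \<le> exp (- (real N * t\<^sup>2 / (2 * M\<^sup>2)))"
      unfolding B_def using that bound by (intro replicate_pmf_tail M t(1)) (blast intro: order.trans)
    then show ?thesis by (simp add: t(2))
  qed
  have sums: "(\<Sum>z\<leftarrow>zs. g z - measure_pmf.expectation p g) = real N * g (sum_list zs / of_nat N - ?E)"
    if "length zs = N" "bounded_linear g" for zs and g :: "complex \<Rightarrow> real"
  proof -
    interpret bounded_linear g by fact
    have e: "measure_pmf.expectation p g = g ?E" using integral_bounded_linear[OF that(2) int] by simp
    have "(\<Sum>z\<leftarrow>zs. g z - a) = g (sum_list zs) - real (length zs) * a" for a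
      by (induction zs) (auto simp: add zero algebra_simps)
    then have "(\<Sum>z\<leftarrow>zs. g z - measure_pmf.expectation p g) = g (sum_list zs) - real N * g ?E"
      unfolding e by (simp add: that(1))
    also have "sum_list zs = real N *\<^sub>R (sum_list zs / of_nat N)" using N by (simp add: scaleR_conv_of_real)
    finally show ?thesis by (simp only: scaleR diff) (simp add: algebra_simps)
  qed
  have "measure_pmf.prob (avg_pmf N p) {z. cmod (z - ?E) > \<eta>}
      = measure_pmf.prob ?R ({zs. cmod (sum_list zs / of_nat N - ?E) > \<eta>} \<inter> set_pmf ?R)"
    by (simp add: avg_pmf_def vimage_def measure_Int_set_pmf)
  also have "\<dots> \<le> measure_pmf.prob ?R ((B Re \<union> B (\<lambda>z. - Re z)) \<union> (B Im \<union> B (\<lambda>z. - Im z)))"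
  proof (rule measure_pmf.finite_measure_mono)
    show "{zs. cmod (sum_list zs / of_nat N - ?E) > \<eta>} \<inter> set_pmf ?R
        \<subseteq> (B Re \<union> B (\<lambda>z. - Re z)) \<union> (B Im \<union> B (\<lambda>z. - Im z))"
    proof
      fix zs assume "zs \<in> {zs. cmod (sum_list zs / of_nat N - ?E) > \<eta>} \<inter> set_pmf ?R"
      then have len: "length zs = N" and big: "cmod (sum_list zs / of_nat N - ?E) > \<eta>"
        by (auto simp: set_replicate_pmf)
      let ?w = "sum_list zs / of_nat N - ?E"
      have "\<not> (\<bar>Re ?w\<bar> < t \<and> \<bar>Im ?w\<bar> < t)"
      proof
        assume a: "\<bar>Re ?w\<bar> < t \<and> \<bar>Im ?w\<bar> < t"
        have "(Re ?w)\<^sup>2 \<le> t\<^sup>2" "(Im ?w)\<^sup>2 \<le> t\<^sup>2" using a t(1) by (auto simp: abs_le_square_iff[symmetric])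
        then have "(cmod ?w)\<^sup>2 \<le> \<eta>\<^sup>2" using t(2) unfolding cmod_power2 by linarith
        then have "cmod ?w \<le> \<eta>" using eta by (intro power2_le_imp_le[of "cmod ?w" \<eta>]) simp_all
        then show False using big by simp
      qed
      then have c: "Re ?w \<ge> t \<or> - Re ?w \<ge> t \<or> Im ?w \<ge> t \<or> - Im ?w \<ge> t" by linarith
      have bl: "bounded_linear (\<lambda>z. - Re z)" "bounded_linear (\<lambda>z. - Im z)"
        by (intro bounded_linear_minus bounded_linear_Re bounded_linear_Im)+
      have iff: "zs \<in> B g \<longleftrightarrow> g ?w \<ge> t" if "bounded_linear g" for g
        unfolding B_def using sums[OF len that] N by simp
      show "zs \<in> (B Re \<union> B (\<lambda>z. - Re z)) \<union> (B Im \<union> B (\<lambda>z. - Im z))"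
        using c iff[OF bounded_linear_Re] iff[OF bounded_linear_Im] iff[OF bl(1)] iff[OF bl(2)] by blast
    qed
  qed auto
  also have "\<dots> \<le> (measure_pmf.prob ?R (B Re) + measure_pmf.prob ?R (B (\<lambda>z. - Re z)))
      + (measure_pmf.prob ?R (B Im) + measure_pmf.prob ?R (B (\<lambda>z. - Im z)))"
    by (intro order.trans[OF measure_Un_le] add_mono measure_Un_le) auto
  also have "\<dots> \<le> 4 * exp (- (real N * \<eta>\<^sup>2 / (4 * M\<^sup>2)))"
    using tail[of Re] tail[of "\<lambda>z. - Re z"] tail[of Im] tail[of "\<lambda>z. - Im z"]
    by (simp add: abs_Re_le_cmod abs_Im_le_cmod)
  finally show ?thesis .
qed

lemma sum_lists_prod:
  assumes "finite A"
  shows "(\<Sum>xs | set xs \<subseteq> A \<and> length xs = k. \<Prod>x\<leftarrow>xs. f x) = (\<Sum>a\<in>A. f a :: real) ^ k"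
proof (induction k)
  case 0
  have "{xs. set xs \<subseteq> A \<and> length xs = 0} = {[]}" by auto
  then show ?case by simp
next
  case (Suc k)
  have "(\<Sum>xs | set xs \<subseteq> A \<and> length xs = Suc k. \<Prod>x\<leftarrow>xs. f x)
     = (\<Sum>(xs, a)\<in>{xs. set xs \<subseteq> A \<and> length xs = k} \<times> A. f a * (\<Prod>x\<leftarrow>xs. f x))"
    unfolding lists_length_Suc_eq by (subst sum.reindex) (auto simp: inj_on_def split_beta)
  also have "\<dots> = (\<Sum>xs | set xs \<subseteq> A \<and> length xs = k. \<Prod>x\<leftarrow>xs. f x) * (\<Sum>a\<in>A. f a)"
    by (simp add: sum_product mult.commute sum.swap[of _ A] flip: sum.cartesian_product)
  finally show ?case using Suc by (simp add: mult.commute)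
qed

section \<open>Normalisation of the random Taylor expansion\<close>

lemma finite_rte_terms: "finite (rte_terms nmax L)"
proof -
  have "rte_terms nmax L \<subseteq> Sigma {..nmax} (\<lambda>q. {ls. set ls \<subseteq> {..<L} \<and> length ls = Suc q})"
    by (auto simp: rte_terms_def)
  moreover have "finite (Sigma {..nmax} (\<lambda>q. {ls. set ls \<subseteq> {..<L} \<and> length ls = Suc q}))"
    by (intro finite_SigmaI finite_lists_length_eq) auto
  ultimately show ?thesis by (rule finite_subset)
qed

text \<open>The Pauli indices are summed with weights |c_l|/lam of total 1, so the factors (sum of
  weights)^(q+1) drop out and only the scalar series remains.\<close>

lemma rte_alpha_eq:
  assumes lam: "pauli_weight L c > 0"
  shows "rte_alpha nmax L c (pauli_weight L c) s
    = (\<Sum>q | even q \<and> q \<le> nmax. \<bar>s\<bar> ^ q / fact q * sqrt (1 + (s / real (q + 1))\<^sup>2))"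
proof -
  let ?lam = "pauli_weight L c"
  let ?t = "\<lambda>q. \<bar>s\<bar> ^ q / fact q * sqrt (1 + (s / real (q + 1))\<^sup>2)"
  have d: "rte_d c ?lam s (q, ls) = ?t q * (\<Prod>l\<leftarrow>ls. \<bar>c l\<bar> / ?lam)" for q ls
  proof -
    have "cmod (\<Prod>l\<leftarrow>ls. complex_of_real (c l / ?lam)) = (\<Prod>l\<leftarrow>ls. \<bar>c l\<bar> / ?lam)"
      using lam by (induction ls) (simp_all add: norm_mult norm_divide)
    then show ?thesis
      by (simp add: rte_d_def rte_coef_def norm_mult norm_divide norm_power)
  qed
  have "rte_terms nmax L = Sigma {q. even q \<and> q \<le> nmax} (\<lambda>q. {ls. set ls \<subseteq> {..<L} \<and> length ls = Suc q})"
    by (auto simp: rte_terms_def)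
  then have "rte_alpha nmax L c ?lam s = (\<Sum>q | even q \<and> q \<le> nmax. \<Sum>ls | set ls \<subseteq> {..<L} \<and> length ls = Suc q. rte_d c ?lam s (q, ls))"
    unfolding rte_alpha_def by (simp add: sum.Sigma finite_lists_length_eq)
  also have "\<dots> = (\<Sum>q | even q \<and> q \<le> nmax. ?t q * (\<Sum>l<L. \<bar>c l\<bar> / ?lam) ^ Suc q)"
    unfolding d by (simp only: sum_distrib_left[symmetric] sum_lists_prod[OF finite_lessThan])
  also have "(\<Sum>l<L. \<bar>c l\<bar> / ?lam) = 1"
    using lam by (simp add: pauli_weight_def flip: sum_divide_distrib)
  finally show ?thesis by simp
qed

lemma rte_alpha_pos:
  assumes lam: "pauli_weight L c > 0"
  shows "rte_alpha nmax L c (pauli_weight L c) s > 0"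
proof -
  let ?t = "\<lambda>q. \<bar>s\<bar> ^ q / fact q * sqrt (1 + (s / real (q + 1))\<^sup>2)"
  have "?t 0 \<le> (\<Sum>q | even q \<and> q \<le> nmax. ?t q)"
    by (intro member_le_sum[of 0 "{q. even q \<and> q \<le> nmax}" ?t]) auto
  moreover have "?t 0 > 0" by (simp add: add_pos_nonneg)
  ultimately show ?thesis unfolding rte_alpha_eq[OF lam] by linarith
qed

text \<open>Bounding the square root by 1 + u/2 splits term k into x^k/(2k)! and a part
  \<open>v k\<close> of order x^(k+1), where x = s^2. The second part of term k and the first part
  of term k + 1 are each at most half of x^(k+1)/(k+1)!, so together they fit under one term of the
  exponential series.\<close>

lemma even_series_le_exp:
  fixes s :: real
  shows "(\<Sum>k\<le>n. \<bar>s\<bar> ^ (2 * k) / fact (2 * k) * sqrt (1 + (s / real (2 * k + 1))\<^sup>2)) \<le> exp (s\<^sup>2)"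
proof -
  define x where "x = s\<^sup>2"
  have x0: "x \<ge> 0" by (simp add: x_def)
  define v where "v k = x ^ Suc k / (2 * (fact (2 * k + 1) * real (2 * k + 1)))" for k
  have term_le: "\<bar>s\<bar> ^ (2 * k) / fact (2 * k) * sqrt (1 + (s / real (2 * k + 1))\<^sup>2) \<le> x ^ k / fact (2 * k) + v k" for k
  proof -
    let ?u = "(s / real (2 * k + 1))\<^sup>2"
    have "sqrt (1 + ?u) \<le> 1 + ?u / 2"
    proof (rule real_le_lsqrt)
      show "1 + ?u \<le> (1 + ?u / 2)\<^sup>2" by (simp add: power2_sum)
    qed auto
    then have "\<bar>s\<bar> ^ (2 * k) / fact (2 * k) * sqrt (1 + ?u) \<le> \<bar>s\<bar> ^ (2 * k) / fact (2 * k) * (1 + ?u / 2)"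
      by (intro mult_left_mono) auto
    also have xk: "\<bar>s\<bar> ^ (2 * k) = x ^ k" by (simp add: x_def power_mult)
    also have "x ^ k / fact (2 * k) * (1 + ?u / 2) = x ^ k / fact (2 * k) + v k"
    proof -
      define m F where "m = real (2 * k + 1)" and "F = (fact (2 * k) :: real)"
      have mF: "m > 0" "F > 0" by (simp_all add: m_def F_def)
      have "fact (2 * k + 1) = m * F" by (simp add: m_def F_def)
      then have "v k = x ^ Suc k / (2 * (m * F * m))" by (simp add: v_def m_def)
      moreover have "x ^ k / F * (1 + (s / m)\<^sup>2 / 2) = x ^ k / F + x ^ Suc k / (2 * (m * F * m))"
        using mF by (simp add: x_def field_simps power2_eq_square)
      ultimately show ?thesis by (simp only: m_def F_def)
    qed
    finally show ?thesis unfolding xk .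
  qed
  have v_le: "v k \<le> x ^ Suc k / fact (Suc k) / 2" for k
  proof -
    have "(fact (Suc k) :: real) \<le> fact (2 * k + 1)" by (intro fact_mono) auto
    also have "\<dots> \<le> fact (2 * k + 1) * real (2 * k + 1)" by simp
    finally have f: "(fact (Suc k) :: real) \<le> fact (2 * k + 1) * real (2 * k + 1)" .
    show ?thesis unfolding v_def divide_divide_eq_left
      using x0 f by (intro divide_left_mono) (auto simp: mult.commute intro!: mult_pos_pos)
  qed
  have u_le: "x ^ Suc k / fact (2 * Suc k) \<le> x ^ Suc k / fact (Suc k) / 2" for k
  proof -
    have "(2::real) * fact (Suc k) \<le> real (2 * Suc k) * fact (2 * k + 1)"
      by (intro mult_mono fact_mono) auto
    also have "\<dots> = fact (2 * Suc k)" by simp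
    finally show ?thesis unfolding divide_divide_eq_left
      using x0 by (intro divide_left_mono) (auto simp: mult.commute)
  qed
  \<comment> \<open>The surplus \<open>v n\<close> is carried through the induction and finally
    covered by the next term of the exponential series.\<close>
  have claim: "(\<Sum>k\<le>n. x ^ k / fact (2 * k) + v k) \<le> (\<Sum>k\<le>n. x ^ k / fact k) + v n" for n
  proof (induction n)
    case (Suc n)
    have "(\<Sum>k\<le>Suc n. x ^ k / fact (2 * k) + v k)
        = (\<Sum>k\<le>n. x ^ k / fact (2 * k) + v k) + (x ^ Suc n / fact (2 * Suc n) + v (Suc n))"
      by (rule sum.atMost_Suc)
    moreover have "(\<Sum>k\<le>Suc n. x ^ k / fact k) = (\<Sum>k\<le>n. x ^ k / fact k) + x ^ Suc n / fact (Suc n)"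
      by (rule sum.atMost_Suc)
    ultimately show ?case using Suc u_le[of n] v_le[of n] by linarith
  qed simp
  have "(\<Sum>k\<le>n. \<bar>s\<bar> ^ (2 * k) / fact (2 * k) * sqrt (1 + (s / real (2 * k + 1))\<^sup>2))
      \<le> (\<Sum>k\<le>n. x ^ k / fact (2 * k) + v k)" by (intro sum_mono term_le)
  also have "\<dots> \<le> (\<Sum>k\<le>n. x ^ k / fact k) + v n" by (rule claim)
  also have "v n \<le> x ^ Suc n / fact (Suc n)"
  proof -
    have "x ^ Suc n / fact (Suc n) \<ge> 0" using x0 by simp
    moreover have "a / 2 \<le> a" if "a \<ge> 0" for a :: real using that by simp
    ultimately show ?thesis using order.trans[OF v_le[of n]] by blast
  qed
  also have "(\<Sum>k\<le>n. x ^ k / fact k) + x ^ Suc n / fact (Suc n) = (\<Sum>k<Suc (Suc n). x ^ k /\<^sub>R fact k)"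
    by (simp add: divide_inverse mult.commute lessThan_Suc_atMost)
  also have "\<dots> \<le> (\<Sum>k. x ^ k /\<^sub>R fact k)"
    using x0 by (intro sum_le_suminf summable_exp_generic) auto
  finally show ?thesis by (simp add: exp_def x_def)
qed

lemma rte_alpha_le:
  assumes lam: "pauli_weight L c > 0"
  shows "rte_alpha nmax L c (pauli_weight L c) s \<le> exp (s\<^sup>2)"
proof -
  let ?t = "\<lambda>q. \<bar>s\<bar> ^ q / fact q * sqrt (1 + (s / real (q + 1))\<^sup>2)"
  have "(\<Sum>q | even q \<and> q \<le> nmax. ?t q) = (\<Sum>k\<le>nmax div 2. ?t (2 * k))"
  proof -
    have "{q. even q \<and> q \<le> nmax} = (\<lambda>k. 2 * k) ` {..nmax div 2}" by (auto elim!: evenE)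
    then show ?thesis by (simp add: sum.reindex inj_on_def)
  qed
  then show ?thesis unfolding rte_alpha_eq[OF lam] using even_series_le_exp[of s "nmax div 2"] by simp
qed

text \<open>The r factors with argument \<tau>/r contribute r (\<tau>/r)^2 = \<tau>^2/r to the
  exponent, which is why splitting the evolution time pays.\<close>

lemma rte_alpha_power_le:
  assumes lam: "pauli_weight L c > 0" and r: "r \<ge> 1" and tau: "\<bar>\<tau>\<bar> \<le> T"
  shows "rte_alpha nmax L c (pauli_weight L c) (\<tau> / real r) ^ r \<le> exp (T\<^sup>2 / real r)"
proof -
  have "rte_alpha nmax L c (pauli_weight L c) (\<tau> / real r) ^ r \<le> exp ((\<tau> / real r)\<^sup>2) ^ r"
    using rte_alpha_pos[OF lam] rte_alpha_le[OF lam] by (intro power_mono) (auto intro: less_imp_le)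
  also have "\<dots> = exp (\<tau>\<^sup>2 / real r)"
    unfolding exp_of_nat_mult[symmetric] using r by (simp add: power2_eq_square)
  also have "\<dots> \<le> exp (T\<^sup>2 / real r)"
    using tau r by (auto intro!: divide_right_mono simp: abs_le_square_iff[symmetric])
  finally show ?thesis .
qed

lemma set_rte_pmf:
  assumes lam: "pauli_weight L c > 0"
  shows "set_pmf (finite_pmf (rte_terms nmax L) (\<lambda>m. rte_d c (pauli_weight L c) s m / rte_alpha nmax L c (pauli_weight L c) s))
    \<subseteq> {m \<in> rte_terms nmax L. rte_d c (pauli_weight L c) s m \<noteq> 0}"
proof -
  have "set_pmf (finite_pmf (rte_terms nmax L) (\<lambda>m. rte_d c (pauli_weight L c) s m / rte_alpha nmax L c (pauli_weight L c) s))
    \<subseteq> {m \<in> rte_terms nmax L. rte_d c (pauli_weight L c) s m / rte_alpha nmax L c (pauli_weight L c) s \<noteq> 0}"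
    using rte_alpha_pos[OF lam, of nmax s]
    by (intro set_finite_pmf finite_rte_terms)
       (auto simp: rte_d_def rte_alpha_def less_imp_le simp flip: sum_divide_distrib)
  then show ?thesis by auto
qed

section \<open>Error of the scalar quadrature\<close>

lemma norm_fs_alpha:
  "cmod (fs_alpha kt eT eD j k)
    = (1 / sqrt (2 * pi) * \<bar>wy kt eT eD j\<bar>) * \<bar>dz kt eT eD * zk kt eT eD k * exp (- (zk kt eT eD k)\<^sup>2 / 2)\<bar>"
  by (simp add: fs_alpha_def norm_mult norm_divide abs_mult del: of_real_mult of_real_exp)

lemma sum_norm_fs_alpha:
  "(\<Sum>(j, k)\<in>{..<Jpar kt eT eD} \<times> {..<Kpar kt eT eD}. cmod (fs_alpha kt eT eD j k)) = Ny kt eT eD * Nz kt eT eD"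
proof -
  have "Ny kt eT eD = (\<Sum>j<Jpar kt eT eD. 1 / sqrt (2 * pi) * \<bar>wy kt eT eD j\<bar>)"
    by (simp only: Ny_def sum_distrib_left)
  then show ?thesis
    unfolding norm_fs_alpha sum.cartesian_product[symmetric] Nz_def by (simp only: sum_product)
qed

lemma Ny_nonneg: "Ny kt eT eD \<ge> 0" and Nz_nonneg: "Nz kt eT eD \<ge> 0"
  by (auto simp: Ny_def Nz_def intro!: mult_nonneg_nonneg sum_nonneg)

lemma norm_I_scalar_le: "cmod (I_scalar kt eT eD x) \<le> Ny kt eT eD * Nz kt eT eD"
  unfolding I_scalar_def sum_norm_fs_alpha[symmetric]
  by (intro sum_norm_le) (auto simp: norm_mult)

lemma zmax_facts:
  assumes "0 < eT" "eT < 3 * kt"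
  shows zmax_pos: "zmax kt eT > 0" and zmax_sq: "(zmax kt eT)\<^sup>2 = 2 * ln (3 * kt / eT)"
    and exp_zmax: "exp (- (zmax kt eT)\<^sup>2 / 2) = eT / (3 * kt)"
proof -
  have l: "ln (3 * kt / eT) > 0" using assms by (intro ln_gt_zero) (simp add: field_simps)
  then show "zmax kt eT > 0" and sq: "(zmax kt eT)\<^sup>2 = 2 * ln (3 * kt / eT)" by (simp_all add: zmax_def)
  have "- (zmax kt eT)\<^sup>2 / 2 = - ln (3 * kt / eT)" by (simp add: sq)
  then have "exp (- (zmax kt eT)\<^sup>2 / 2) = inverse (exp (ln (3 * kt / eT)))" by (simp only: exp_minus)
  also have "exp (ln (3 * kt / eT)) = 3 * kt / eT" using assms by (intro exp_ln) auto
  finally show "exp (- (zmax kt eT)\<^sup>2 / 2) = eT / (3 * kt)" by simp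
qed

lemma abs_zk_le:
  assumes Z: "zmax kt eT > 0" and K: "Kpar kt eT eD \<ge> 2" and k: "k < Kpar kt eT eD"
  shows "\<bar>zk kt eT eD k\<bar> \<le> zmax kt eT"
proof -
  define K' where "K' = real (Kpar kt eT eD) - 1"
  have K': "K' > 0" "real k \<le> K'" using K k by (auto simp: K'_def)
  have "\<bar>real k - K' / 2\<bar> \<le> K' / 2" using K' by (auto simp: abs_if)
  then have "2 * zmax kt eT / K' * \<bar>real k - K' / 2\<bar> \<le> 2 * zmax kt eT / K' * (K' / 2)"
    using Z K' by (intro mult_left_mono) auto
  moreover have "\<bar>zk kt eT eD k\<bar> = 2 * zmax kt eT / K' * \<bar>real k - K' / 2\<bar>"
    using Z K' by (simp add: zk_def dz_def K'_def[symmetric] abs_mult)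
  moreover have "2 * zmax kt eT / K' * (K' / 2) = zmax kt eT" using K' by simp
  ultimately show ?thesis by linarith
qed

lemma Ny_le:
  assumes Y: "ymax kt eT \<ge> 0"
  shows "Ny kt eT eD \<le> ymax kt eT / sqrt (2 * pi)"
proof -
  have "(\<Sum>j<Jpar kt eT eD. \<bar>wy kt eT eD j\<bar>) = ymax kt eT / 2 * (\<Sum>j<Jpar kt eT eD. gauss_weight (Jpar kt eT eD) j)"
    unfolding sum_distrib_left using legendre_root_bounds(4)[of _ "Jpar kt eT eD"] Y
    by (intro sum.cong refl) (auto simp: wy_def abs_mult abs_of_pos)
  also have "\<dots> \<le> ymax kt eT"
    using sum_gauss_weight[of "Jpar kt eT eD"] Y by (cases "Jpar kt eT eD = 0") auto
  finally have "(\<Sum>j<Jpar kt eT eD. \<bar>wy kt eT eD j\<bar>) \<le> ymax kt eT" .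
  then show ?thesis unfolding Ny_def by (simp add: divide_right_mono)
qed

text \<open>A crude bound by K terms of size at most \<open>dz\<close> times \<open>zmax\<close>; it
  yields the same ratio K/(K - 1) that occurs in \<open>Jpar\<close>.\<close>

lemma Nz_le:
  assumes Z: "zmax kt eT > 0" and K: "Kpar kt eT eD \<ge> 2"
  shows "Nz kt eT eD \<le> 2 * (zmax kt eT)\<^sup>2 * (real (Kpar kt eT eD) / (real (Kpar kt eT eD) - 1))"
proof -
  let ?Z = "zmax kt eT" and ?h = "dz kt eT eD"
  have h: "?h > 0" using Z K by (simp add: dz_def)
  have "Nz kt eT eD \<le> (\<Sum>k<Kpar kt eT eD. ?h * ?Z)"
    unfolding Nz_def
  proof (rule sum_mono)
    fix k assume "k \<in> {..<Kpar kt eT eD}"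
    then have z: "\<bar>zk kt eT eD k\<bar> \<le> ?Z" using abs_zk_le[OF Z K] by simp
    have "\<bar>zk kt eT eD k\<bar> * exp (- (zk kt eT eD k)\<^sup>2 / 2) \<le> ?Z * 1"
      using z Z by (intro mult_mono) auto
    then show "\<bar>?h * zk kt eT eD k * exp (- (zk kt eT eD k)\<^sup>2 / 2)\<bar> \<le> ?h * ?Z"
      using h by (simp add: abs_mult mult.assoc)
  qed
  also have "\<dots> = 2 * ?Z\<^sup>2 * (real (Kpar kt eT eD) / (real (Kpar kt eT eD) - 1))"
    by (simp add: dz_def power2_eq_square)
  finally show ?thesis .
qed

text \<open>With one grid point the spacing \<open>dz\<close> is a quotient by zero and hence 0;
  with none the sum is empty.\<close>

lemma Nz_eq_0: "Kpar kt eT eD \<le> 1 \<Longrightarrow> Nz kt eT eD = 0"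
proof -
  assume "Kpar kt eT eD \<le> 1"
  then consider "Kpar kt eT eD = 0" | "Kpar kt eT eD = 1" by linarith
  then show ?thesis by cases (simp_all add: Nz_def dz_def)
qed

lemma sqrt_2pi_bounds: "2 \<le> sqrt (2 * pi)" "sqrt (2 * pi) \<le> 4"
proof -
  show "2 \<le> sqrt (2 * pi)" by (rule real_le_rsqrt) (use pi_gt3 in simp)
  show "sqrt (2 * pi) \<le> 4" by (rule real_le_lsqrt) (use pi_less_4 in auto)
qed

text \<open>Rational estimates sharp enough for the aliasing budget; 125/8 is (5/2)^3, with 5/2
  below e and 3 below pi.\<close>

lemma exp_1_bounds: "exp (1::real) \<le> 3" "exp (- 1 / 2 :: real) \<le> 8 / 13" "exp pi \<ge> 125 / 8"
proof -
  show "exp (1::real) \<le> 3" by (rule exp_le)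
  have "13 / 8 \<le> exp (1 / 2 :: real)" using exp_lower_Taylor_quadratic[of "1/2"] by (simp add: power2_eq_square)
  then show "exp (- 1 / 2 :: real) \<le> 8 / 13" by (simp add: exp_minus field_simps)
  have "5 / 2 \<le> exp (1 :: real)" using exp_lower_Taylor_quadratic[of 1] by simp
  then have "(5 / 2) ^ 3 \<le> exp (1 :: real) ^ 3" by (intro power_mono) auto
  also have "\<dots> = exp 3" by (simp flip: exp_of_nat_mult)
  also have "\<dots> \<le> exp pi" using pi_gt3 by simp
  finally show "exp pi \<ge> 125 / 8" by (simp add: power3_eq_cube)
qed

text \<open>The bracket in the formula for K. It is compared with pi (K - 1), which is the exponent
  2 pi b/h for contour height b = \<open>zmax\<close> and spacing h = \<open>dz\<close>.\<close>

definition K_log :: "real \<Rightarrow> real \<Rightarrow> real \<Rightarrow> real" where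
  "K_log kt eT eD = ln 2 + (zmax kt eT)\<^sup>2 / 2 + 2 * kt * ln (3 * kt / eT)
       + ln (2 / eD) + ln (1 + 2 / (zmax kt eT * sqrt (2 * pi)))"

lemma Kpar_ge: "K_log kt eT eD \<le> pi * (real (Kpar kt eT eD) - 1)"
proof -
  have "1 + (1 / pi) * K_log kt eT eD \<le> real (Kpar kt eT eD)"
    unfolding Kpar_def K_log_def by (rule of_nat_ceiling)
  then have "(1 / pi) * K_log kt eT eD * pi \<le> (real (Kpar kt eT eD) - 1) * pi" by (intro mult_right_mono) auto
  then show ?thesis by (simp add: mult.commute)
qed

lemma Kpar_le_1: "Kpar kt eT eD \<le> 1 \<Longrightarrow> K_log kt eT eD \<le> 0"
proof -
  assume "Kpar kt eT eD \<le> 1"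
  then have "\<lceil>1 + (1 / pi) * K_log kt eT eD\<rceil> \<le> 1"
    unfolding Kpar_def K_log_def by linarith
  then have "1 + (1 / pi) * K_log kt eT eD \<le> 1" by linarith
  then show ?thesis using pi_gt_zero by (auto simp: divide_le_0_iff)
qed

text \<open>The terms ln 2 and ln (2 / eD) together give 4/eD. The last logarithm is positive and is
  given away.\<close>

lemma exp_K_log_ge:
  assumes eT: "0 < eT" "eT < 3 * kt" and eD: "eD > 0"
  shows "4 / eD * exp ((zmax kt eT)\<^sup>2 / 2 + kt * (zmax kt eT)\<^sup>2) \<le> exp (K_log kt eT eD)"
proof -
  let ?Z = "zmax kt eT"
  note Z = zmax_pos[OF eT] and Z2 = zmax_sq[OF eT]
  have e: "2 * kt * ln (3 * kt / eT) = kt * ?Z\<^sup>2" by (simp add: Z2)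
  have "4 / eD * exp (?Z\<^sup>2 / 2 + kt * ?Z\<^sup>2) * 1 \<le> 4 / eD * exp (?Z\<^sup>2 / 2 + kt * ?Z\<^sup>2) * (1 + 2 / (?Z * sqrt (2 * pi)))"
    using eD Z by (intro mult_left_mono) auto
  also have "\<dots> = exp (ln 2) * exp (?Z\<^sup>2 / 2) * exp (kt * ?Z\<^sup>2) * exp (ln (2 / eD)) * exp (ln (1 + 2 / (?Z * sqrt (2 * pi))))"
  proof -
    have "exp (ln (2 / eD)) = 2 / eD" using eD by (intro exp_ln) auto
    moreover have "exp (ln (1 + 2 / (?Z * sqrt (2 * pi)))) = 1 + 2 / (?Z * sqrt (2 * pi))"
      using Z by (intro exp_ln add_pos_nonneg) auto
    moreover have "exp (ln 2) = (2::real)" by (intro exp_ln) auto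
    ultimately show ?thesis by (simp add: exp_add)
  qed
  also have "\<dots> = exp (K_log kt eT eD)" unfolding K_log_def e exp_add ..
  finally show ?thesis by simp
qed

text \<open>A single term of the series of exp(2 \<sigma>) gives exp(2 \<sigma>)/4^J. Put c = 3
  \<sigma>/(2 sqrt 2), the exponent occurring in J. As 2 sqrt 2 \<le> 3, one factor exp \<sigma> is
  at most exp c; the other is covered by one of the two factors 2^J, because \<sigma> \<le> c \<le>
  J ln 2.\<close>

lemma taylor_coefficient_bound:
  fixes \<sigma> :: real
  assumes s: "\<sigma> \<ge> 0" and J: "3 * \<sigma> / (2 * sqrt 2) \<le> real J * ln 2"
  shows "\<sigma> ^ (2 * J) / fact (2 * J) \<le> exp (3 * \<sigma> / (2 * sqrt 2)) / 2 ^ J"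
proof -
  let ?c = "3 * \<sigma> / (2 * sqrt 2)"
  have "(2 * \<sigma>) ^ (2 * J) / fact (2 * J) \<le> exp (2 * \<sigma>)"
  proof -
    have "(\<Sum>k\<in>{2 * J}. (2 * \<sigma>) ^ k /\<^sub>R fact k) \<le> (\<Sum>k. (2 * \<sigma>) ^ k /\<^sub>R fact k)"
      using s by (intro sum_le_suminf summable_exp_generic) auto
    then show ?thesis by (simp add: exp_def divide_inverse mult.commute)
  qed
  then have "\<sigma> ^ (2 * J) / fact (2 * J) \<le> exp (2 * \<sigma>) / (2 ^ J * 2 ^ J)"
  proof -
    assume "(2 * \<sigma>) ^ (2 * J) / fact (2 * J) \<le> exp (2 * \<sigma>)"
    moreover have "(2::real) ^ J * 2 ^ J = 2 ^ (2 * J)" by (simp add: mult_2 power_add)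
    ultimately show ?thesis by (simp add: power_mult_distrib field_simps)
  qed
  also have "\<dots> \<le> exp ?c / 2 ^ J"
  proof -
    have "\<sigma> * sqrt 2 \<le> \<sigma> * (3 / 2)"
      using s by (intro mult_left_mono real_le_lsqrt) (auto simp: power2_eq_square)
    then have "\<sigma> \<le> ?c" by (simp add: field_simps)
    then have "2 * \<sigma> \<le> ?c + real J * ln 2" using J by simp
    then have "exp (2 * \<sigma>) \<le> exp (?c + real J * ln 2)" by simp
    also have "\<dots> = exp ?c * 2 ^ J" by (simp add: exp_add exp_of_nat_mult)
    finally show ?thesis by (simp add: field_simps)
  qed
  finally show ?thesis .
qed

text \<open>The Gauss--Legendre nodes are moved to [0, Y], where the sum approximates z times the
  integral of exp(-i x y z) over y. The subtracted quotient is the exact value of that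
  expression.\<close>

lemma y_quadrature:
  fixes x z Y :: real
  assumes J: "J > 0" and x: "x \<noteq> 0" and Y: "Y > 0" and b: "\<bar>x * Y * z / 2\<bar> \<le> \<sigma>"
  shows "cmod (of_real z * (\<Sum>j<J. of_real (Y / 2 * gauss_weight J j) * iexp (- (Y * (1 + legendre_root J j) / 2 * z * x)))
      - (1 - iexp (- (x * Y * z))) / (\<i> * of_real x)) \<le> \<bar>z\<bar> * (2 * Y * (\<sigma> ^ (2 * J) / fact (2 * J)))"
proof -
  define \<beta> where "\<beta> = x * Y * z / 2"
  define S where "S = (\<Sum>j<J. of_real (gauss_weight J j) * iexp (- \<beta> * legendre_root J j))"
  define I where "I = integral {-1..1} (\<lambda>s. iexp (- \<beta> * s))"
  have S: "(\<Sum>j<J. of_real (Y / 2 * gauss_weight J j) * iexp (- (Y * (1 + legendre_root J j) / 2 * z * x)))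
     = of_real (Y / 2) * iexp (- \<beta>) * S"
  proof -
    have "iexp (- (Y * (1 + t) / 2 * z * x)) = iexp (- \<beta>) * iexp (- \<beta> * t)" for t
      unfolding exp_add[symmetric] by (rule arg_cong[where f = exp]) (simp add: \<beta>_def field_simps)
    then show ?thesis unfolding S_def sum_distrib_left by (intro sum.cong refl) (simp add: mult_ac)
  qed
  \<comment> \<open>Kept as a product because \<beta> may be zero, namely at a grid point z =
    0.\<close>
  have I: "\<i> * of_real \<beta> * I = iexp \<beta> - iexp (- \<beta>)"
  proof -
    have "((\<lambda>s. - \<i> * of_real \<beta> * iexp (- \<beta> * s)) has_integral (iexp (- \<beta> * 1) - iexp (- \<beta> * (-1)))) {-1..1}"
    proof (rule fundamental_theorem_of_calculus)
      fix s :: real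
      show "((\<lambda>s. iexp (- \<beta> * s)) has_vector_derivative - \<i> * of_real \<beta> * iexp (- \<beta> * s)) (at s within {-1..1})"
      proof -
        have "((\<lambda>s. exp (- (\<i> * of_real \<beta>) * of_real s)) has_vector_derivative
            - (\<i> * of_real \<beta>) * exp (- (\<i> * of_real \<beta>) * of_real s)) (at s within {-1..1})"
          by (rule has_vector_derivative_real_field) (auto intro!: derivative_eq_intros)
        then show ?thesis by (simp add: mult.assoc)
      qed
    qed simp
    then have "integral {-1..1} (\<lambda>s. - \<i> * of_real \<beta> * iexp (- \<beta> * s)) = iexp (- \<beta> * 1) - iexp (- \<beta> * (-1))"
      by (rule integral_unique)
    then have "- (\<i> * of_real \<beta>) * I = iexp (- \<beta>) - iexp \<beta>"
      unfolding I_def by (simp only: Henstock_Kurzweil_Integration.integral_mult_right) simp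
    then show ?thesis by (simp add: algebra_simps)
  qed
  have "of_real z * (of_real (Y / 2) * iexp (- \<beta>) * I) = (1 - iexp (- (x * Y * z))) / (\<i> * of_real x)"
  proof -
    have ix: "\<i> * complex_of_real x \<noteq> 0" using x by simp
    have "of_real z * (of_real (Y / 2) * iexp (- \<beta>) * I) * (\<i> * of_real x) = iexp (- \<beta>) * (\<i> * of_real \<beta> * I)"
      by (simp add: \<beta>_def)
    also have "\<dots> = iexp (- \<beta>) * iexp \<beta> - iexp (- \<beta>) * iexp (- \<beta>)" unfolding I by (simp add: right_diff_distrib)
    also have "iexp (- \<beta>) * iexp \<beta> = 1" unfolding exp_add[symmetric] by simp
    also have "iexp (- \<beta>) * iexp (- \<beta>) = iexp (- (x * Y * z))"
      unfolding exp_add[symmetric] by (rule arg_cong[where f = exp]) (simp add: \<beta>_def)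
    finally show ?thesis using ix by (simp add: eq_divide_eq)
  qed
  then have eq: "of_real z * (of_real (Y / 2) * iexp (- \<beta>) * S) - (1 - iexp (- (x * Y * z))) / (\<i> * of_real x)
     = of_real z * (of_real (Y / 2) * iexp (- \<beta>)) * (S - I)"
    by (simp add: algebra_simps)
  have "cmod (of_real z * (of_real (Y / 2) * iexp (- \<beta>)) * (S - I)) = \<bar>z\<bar> * (Y / 2) * cmod (S - I)"
    using Y by (simp add: norm_mult norm_divide)
  then have N: "cmod (of_real z * (of_real (Y / 2) * iexp (- \<beta>) * S) - (1 - iexp (- (x * Y * z))) / (\<i> * of_real x))
     = \<bar>z\<bar> * (Y / 2) * cmod (S - I)" by (simp only: eq)
  have "cmod (S - I) \<le> 4 * \<bar>- \<beta>\<bar> ^ (2 * J) / fact (2 * J)"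
    unfolding S_def I_def by (rule gauss_legendre_exp_error[OF J])
  also have "\<dots> \<le> 4 * \<sigma> ^ (2 * J) / fact (2 * J)"
    using b by (intro divide_right_mono mult_left_mono power_mono) (auto simp: \<beta>_def)
  finally have "cmod (S - I) \<le> 4 * (\<sigma> ^ (2 * J) / fact (2 * J))" by simp
  then have "\<bar>z\<bar> * (Y / 2) * cmod (S - I) \<le> \<bar>z\<bar> * (Y / 2) * (4 * (\<sigma> ^ (2 * J) / fact (2 * J)))"
    using Y by (intro mult_left_mono) auto
  also have "\<dots> = \<bar>z\<bar> * (2 * Y * (\<sigma> ^ (2 * J) / fact (2 * J)))" by simp
  finally show ?thesis unfolding S N .
qed

text \<open>Here a stands for kt |x|. The factor kt/a, large when |x| is small, is absorbed by the
  gap between exp(a \<open>Z2\<close>) and exp(kt \<open>Z2\<close>), so the number of grid points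
  need not account for it.\<close>

lemma aliasing_bound:
  fixes kt a Z2 :: real
  assumes kt: "kt \<ge> 1" and a: "1 \<le> a" "a \<le> kt" and Z2: "Z2 \<ge> 1 / 2" and eD: "eD > 0"
    and q: "q \<ge> 125 / 8" "4 / eD * exp (Z2 / 2 + kt * Z2) \<le> q"
  shows "kt / a * (exp (Z2 / 2) * (2 + exp (a * Z2) + exp (- (a * Z2))) / (q - 1)) \<le> 7 / 8 * eD"
proof -
  define b where "b = kt - a"
  have b: "b \<ge> 0" using a by (simp add: b_def)
  have "kt / a \<le> 1 + b"
  proof -
    have "kt = a + b" by (simp add: b_def)
    also have "\<dots> \<le> a * (1 + b)" using a b mult_right_mono[of 1 a b] by (simp add: distrib_left)
    finally show ?thesis using a by (simp add: divide_le_eq mult.commute)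
  qed
  \<comment> \<open>The rate 1/2 is the largest that \<open>Z2\<close> \<ge> 1/2 permits, and 2
    exp((b - 1)/2) is the exponential of this rate that touches 1 + b, at b = 1.\<close>
  also have "1 + b \<le> 2 * exp ((b - 1) / 2)"
  proof -
    have "1 + b = 2 * (1 + (b - 1) / 2)" by (simp add: field_simps)
    also have "\<dots> \<le> 2 * exp ((b - 1) / 2)" by (intro mult_left_mono exp_ge_add_one_self) simp
    finally show ?thesis .
  qed
  also have "exp ((b - 1) / 2) = exp (- 1 / 2) * exp (b / 2)"
    unfolding exp_add[symmetric] by (rule arg_cong[where f = exp]) (simp add: field_simps)
  also have "2 * (exp (- 1 / 2) * exp (b / 2)) \<le> 2 * (8 / 13 * exp (b * Z2))"
  proof -
    have "b / 2 \<le> b * Z2" using mult_left_mono[OF Z2 b] by simp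
    then have "exp (b / 2) \<le> exp (b * Z2)" by (simp only: exp_le_cancel_iff)
    then show ?thesis by (intro mult_left_mono mult_mono exp_1_bounds(2)) simp_all
  qed
  finally have k1: "kt / a \<le> 16 / 13 * exp (b * Z2)" by simp
  have w: "exp (- (a * Z2)) \<le> 8 / 13"
  proof -
    have "1 * (1 / 2) \<le> a * Z2" using a Z2 by (intro mult_mono) auto
    then have "exp (- (a * Z2)) \<le> exp (- 1 / 2)" by simp
    then show ?thesis using exp_1_bounds(2) by linarith
  qed
  have "2 + exp (a * Z2) + exp (- (a * Z2)) = exp (a * Z2) * (1 + exp (- (a * Z2)))\<^sup>2"
    by (simp add: power2_eq_square algebra_simps exp_add[symmetric])
  also have "\<dots> \<le> exp (a * Z2) * (1 + 8 / 13)\<^sup>2"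
    using w by (intro mult_left_mono power_mono) (auto simp: add_nonneg_nonneg)
  finally have k2: "2 + exp (a * Z2) + exp (- (a * Z2)) \<le> 441 / 169 * exp (a * Z2)" by (simp add: power2_eq_square)
  have "kt / a * (exp (Z2 / 2) * (2 + exp (a * Z2) + exp (- (a * Z2))))
      \<le> (16 / 13 * exp (b * Z2)) * (exp (Z2 / 2) * (441 / 169 * exp (a * Z2)))"
    using k1 k2 a kt by (intro mult_mono) auto
  also have "\<dots> = 7056 / 2197 * exp (Z2 / 2 + kt * Z2)"
  proof -
    have "exp (Z2 / 2 + kt * Z2) = exp (b * Z2) * exp (Z2 / 2) * exp (a * Z2)"
      unfolding exp_add[symmetric] by (simp add: b_def algebra_simps)
    then show ?thesis by simp
  qed
  also have "\<dots> \<le> 7056 / 2197 * (q * eD / 4)"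
    using q(2) eD by (intro mult_left_mono) (auto simp: field_simps)
  \<comment> \<open>Numerically 7056/8788 is about 0.803, while 7/8 (1 - 1/q) is at least 0.819 for
    q \<ge> 125/8.\<close>
  also have "\<dots> \<le> 7 / 8 * eD * (q - 1)"
  proof -
    have "7056 / 2197 * (q / 4) \<le> 7 / 8 * (q - 1)" using q(1) by simp
    then have "7056 / 2197 * (q / 4) * eD \<le> 7 / 8 * (q - 1) * eD" using eD by (intro mult_right_mono) auto
    then show ?thesis by (simp add: mult_ac)
  qed
  finally have "kt / a * (exp (Z2 / 2) * (2 + exp (a * Z2) + exp (- (a * Z2)))) / (q - 1) \<le> 7 / 8 * eD"
    using q(1) by (subst pos_divide_le_eq) simp_all
  then show ?thesis by (simp only: times_divide_eq_right)
qed

lemma gauss_wave_phase: "gauss_wave u (of_real z) = of_real (exp (- z\<^sup>2 / 2)) * iexp (- (u * z))"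
proof -
  have "gauss_wave u (of_real z) = exp (of_real (- z\<^sup>2 / 2) + \<i> * of_real (- (u * z)))"
    unfolding gauss_wave_def by (rule arg_cong[where f = exp]) simp
  then show ?thesis by (simp only: exp_add exp_of_real)
qed

text \<open>The hypothesis \<open>big\<close> says that the quantity q below exceeds 1, which keeps
  J positive, and Z^2 \<ge> 1/2 is the condition of \<open>aliasing_bound\<close>. The budget is
  eD/8 for the quadrature in y, 7 eD/8 for aliasing, and eT for three Gaussian truncations.\<close>

lemma I_scalar_error_main:
  assumes kt: "kt \<ge> 1" and eT: "0 < eT" "eT < 3 * kt" and eD: "eD > 0"
    and x: "1 / kt \<le> \<bar>x\<bar>" "\<bar>x\<bar> \<le> 1" and K: "Kpar kt eT eD \<ge> 2" and Z2: "(zmax kt eT)\<^sup>2 \<ge> 1 / 2"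
    and big: "sqrt (2 * pi) * eD < 32 * ymax kt eT * (zmax kt eT)\<^sup>2 * (real (Kpar kt eT eD) / (real (Kpar kt eT eD) - 1))"
  shows "cmod (I_scalar kt eT eD x - 1 / of_real x) \<le> eT + eD"
proof -
  define Z Y h s where "Z = zmax kt eT" and "Y = ymax kt eT" and "h = dz kt eT eD" and "s = sqrt (2 * pi)"
  define J KK where "J = Jpar kt eT eD" and "KK = Kpar kt eT eD"
  define z where "z k = zk kt eT eD k" for k
  define \<sigma> where "\<sigma> = kt * ln (3 * kt / eT)"
  define c where "c = 3 * \<sigma> / (2 * sqrt 2)"
  \<comment> \<open>The first two logarithms in the formula for J add up to ln q, so that 2^J \<ge>
    q exp c.\<close>
  define q where "q = real KK / (real KK - 1) * (32 * Y * Z\<^sup>2 / (eD * s))"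
  define u where "u = x * Y"
  have Z: "Z > 0" unfolding Z_def by (rule zmax_pos[OF eT])
  have Zsq: "Z\<^sup>2 = 2 * ln (3 * kt / eT)" unfolding Z_def by (rule zmax_sq[OF eT])
  have Y: "Y > 0" "Y = kt * Z" using Z kt by (auto simp: Y_def ymax_def Z_def)
  have K1: "real KK - 1 > 0" "real KK \<ge> 2" using K by (auto simp: KK_def)
  have h: "h > 0" using Z K1 by (simp add: h_def dz_def Z_def KK_def[symmetric])
  have s: "s > 0" by (simp add: s_def)
  have x0: "x \<noteq> 0" "\<bar>x\<bar> > 0" using x kt by auto
  have sig: "\<sigma> = Y * Z / 2" using Zsq by (simp add: \<sigma>_def Y(2) power2_eq_square[symmetric] mult.assoc)
  have sig0: "\<sigma> \<ge> 0" unfolding sig using Y(1) Z by simp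
  have zle: "\<bar>z k\<bar> \<le> Z" if "k < KK" for k
    using abs_zk_le[of kt eT eD k] Z K that by (simp add: Z_def z_def KK_def)
  have z_eq: "z k = - Z + h * real k" for k
    using K1 by (simp add: z_def zk_def h_def dz_def Z_def KK_def[symmetric] field_simps)
  have q1: "q > 1"
  proof -
    have "q = 32 * Y * Z\<^sup>2 * (real KK / (real KK - 1)) / (s * eD)" by (simp add: q_def mult_ac)
    moreover have sp: "s * eD > 0" using s eD by simp
    moreover have "s * eD < 32 * Y * Z\<^sup>2 * (real KK / (real KK - 1))"
      using big by (simp only: s_def Y_def Z_def KK_def)
    ultimately show ?thesis by (simp only: pos_less_divide_eq[OF sp] mult_1_left)
  qed
  have J: "J > 0" and Jc: "c \<le> real J * ln 2" and Jq: "q * exp c \<le> 2 ^ J"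
  proof -
    have "ln q = ln (real KK / (real KK - 1)) + ln (32 * Y * Z\<^sup>2 / (eD * s))"
      unfolding q_def using K1 Y Z eD s by (intro ln_mult_pos) auto
    then have "(1 / ln 2) * (ln q + c) \<le> real J"
      unfolding J_def Jpar_def Let_def c_def \<sigma>_def
      using of_nat_ceiling[of "(1 / ln 2) * (ln (real KK / (real KK - 1)) + ln (32 * Y * Z\<^sup>2 / (eD * s)) + 3 * kt * ln (3 * kt / eT) / (2 * sqrt 2))"]
      by (simp add: KK_def Y_def Z_def s_def mult.assoc)
    then have "(1 / ln 2) * (ln q + c) * ln 2 \<le> real J * ln 2" by (intro mult_right_mono) auto
    then have Jl: "ln q + c \<le> real J * ln 2" by simp
    have c0: "c \<ge> 0" using sig0 by (simp add: c_def)
    have lq: "ln q > 0" using q1 by simp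
    show "c \<le> real J * ln 2" using Jl lq by simp
    have "real J * ln 2 > 0" using Jl lq c0 by linarith
    then show "J > 0" by (cases "J = 0") auto
    have "exp (ln q + c) \<le> exp (real J * ln 2)" using Jl by simp
    then show "q * exp c \<le> 2 ^ J" using q1 by (simp add: exp_add exp_of_nat_mult)
  qed
  define V where "V k = of_real (z k) * (\<Sum>j<J. of_real (Y / 2 * gauss_weight J j) * iexp (- (Y * (1 + legendre_root J j) / 2 * z k * x)))" for k
  define W where "W k = (1 - iexp (- (x * Y * z k))) / (\<i> * of_real x)" for k
  define A where "A k = \<i> / of_real s * of_real (h * exp (- (z k)\<^sup>2 / 2))" for k
  have I_eq: "I_scalar kt eT eD x = (\<Sum>k<KK. A k * V k)"
  proof -
    have "I_scalar kt eT eD x = (\<Sum>k<KK. \<Sum>j<J. fs_alpha kt eT eD j k * iexp (- (fs_t kt eT eD j k * x)))"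
      unfolding I_scalar_def sum.cartesian_product[symmetric] J_def KK_def by (rule sum.swap)
    also have "\<dots> = (\<Sum>k<KK. A k * V k)"
      unfolding V_def sum_distrib_left
      by (intro sum.cong refl) (simp add: fs_alpha_def fs_t_def A_def wy_def yj_def Y_def[symmetric] J_def[symmetric]
          h_def[symmetric] z_def[symmetric] s_def mult_ac)
    finally show ?thesis .
  qed
  have nA: "cmod (A k) = h * exp (- (z k)\<^sup>2 / 2) / s" for k
    using h s by (simp add: A_def norm_mult norm_divide)
  \<comment> \<open>The value of q is matched to K \<open>dz\<close> = 2 Z K/(K - 1): the total
    error is 4 Y Z^2 K/((K - 1) q sqrt(2 pi)) = eD/8.\<close>
  have quad: "cmod (\<Sum>k<KK. A k * V k - A k * W k) \<le> eD / 8"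
  proof -
    have VW: "cmod (V k - W k) \<le> \<bar>z k\<bar> * (2 * Y * (\<sigma> ^ (2 * J) / fact (2 * J)))" if "k < KK" for k
      unfolding V_def W_def
    proof (rule y_quadrature[OF J x0(1) Y(1)])
      have "\<bar>x\<bar> * Y * \<bar>z k\<bar> \<le> 1 * Y * Z" using x zle[OF that] Y Z by (intro mult_mono) auto
      then show "\<bar>x * Y * z k / 2\<bar> \<le> \<sigma>" using Y(1) by (simp add: sig abs_mult)
    qed
    have tay: "\<sigma> ^ (2 * J) / fact (2 * J) \<le> 1 / q"
    proof -
      have "\<sigma> ^ (2 * J) / fact (2 * J) \<le> exp c / 2 ^ J"
        unfolding c_def by (rule taylor_coefficient_bound[OF sig0]) (use Jc in \<open>simp add: c_def\<close>)
      also have "\<dots> \<le> 1 / q" using Jq q1 by (simp add: field_simps)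
      finally show ?thesis .
    qed
    have "cmod (\<Sum>k<KK. A k * V k - A k * W k) \<le> (\<Sum>k<KK. h * Z * (2 * Y / (q * s)))"
    proof (rule sum_norm_le)
      fix k assume "k \<in> {..<KK}"
      then have k: "k < KK" by simp
      have "cmod (A k * V k - A k * W k) = cmod (A k) * cmod (V k - W k)"
        by (simp add: norm_mult flip: right_diff_distrib)
      also have "\<dots> \<le> (h * 1 / s) * (Z * (2 * Y * (1 / q)))"
      proof (intro mult_mono)
        show "cmod (A k) \<le> h * 1 / s" unfolding nA using h s by (intro divide_right_mono mult_left_mono) auto
        show "cmod (V k - W k) \<le> Z * (2 * Y * (1 / q))"
          using Y Z sig0 by (intro order.trans[OF VW[OF k]] mult_mono zle k tay) auto
      qed (use h s in auto)
      finally show "cmod (A k * V k - A k * W k) \<le> h * Z * (2 * Y / (q * s))" by (simp add: field_simps)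
    qed
    also have "\<dots> = eD / 8"
    proof -
      have hK: "real KK * h = 2 * Z * (real KK / (real KK - 1))"
        by (simp add: h_def dz_def Z_def KK_def)
      have "(\<Sum>k<KK. h * Z * (2 * Y / (q * s))) = (real KK * h) * (Z * (2 * Y / (q * s)))" by simp
      also have "\<dots> = eD / 8" unfolding hK q_def
      proof -
        have "2 * Z * p * (Z * (2 * Y / (p * (32 * Y * Z\<^sup>2 / (eD * s)) * s))) = eD / 8" if "p > 0" for p
          using that Y(1) Z eD s by (simp add: power2_eq_square field_simps)
        moreover have "real KK / (real KK - 1) > 0" using K1 by simp
        ultimately show "2 * Z * (real KK / (real KK - 1)) * (Z * (2 * Y / (real KK / (real KK - 1) * (32 * Y * Z\<^sup>2 / (eD * s)) * s))) = eD / 8"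
          by blast
      qed
      finally show ?thesis .
    qed
    finally show ?thesis .
  qed
  define G where "G v = of_real h * (\<Sum>k<KK. gauss_wave v (of_real (- Z + h * real k)))" for v
  \<comment> \<open>The factors i cancel, and 1 - exp(-i u z) splits every term into waves of
    frequencies 0 and u = x Y.\<close>
  have AW: "(\<Sum>k<KK. A k * W k) = (G 0 - G u) / of_real (x * s)"
  proof -
    have "A k * W k = of_real h * (gauss_wave 0 (of_real (z k)) - gauss_wave u (of_real (z k))) / of_real (x * s)" for k
      unfolding gauss_wave_phase A_def W_def u_def using x0 s by (simp add: field_simps)
    then show ?thesis unfolding G_def z_eq
      by (simp add: sum_divide_distrib sum_distrib_left right_diff_distrib diff_divide_distrib sum_subtractf)
  qed
  \<comment> \<open>The bound of \<open>truncated_grid_sum_error\<close> at contour height Z, where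
    2 pi Z/h = pi (K - 1).\<close>
  define B where "B v = s * exp (- Z\<^sup>2 / 2) + s * exp (Z\<^sup>2 / 2) * (exp (v * Z) + exp (- (v * Z))) / (exp (pi * (real KK - 1)) - 1)" for v
  have GB: "cmod (G v - of_real (s * exp (- v\<^sup>2 / 2))) \<le> B v" for v
  proof -
    have hK: "h * (real KK - 1) = 2 * Z" using K1 by (simp add: h_def dz_def Z_def KK_def)
    have "2 * pi * Z / h = pi * (real KK - 1)" using hK h by (simp add: field_simps)
    then show ?thesis
      using truncated_grid_sum_error[OF h Z _ _ hK, of v] K1 Z
      unfolding G_def B_def s_def[symmetric] by simp
  qed
  \<comment> \<open>Frequency 0 has the Gaussian integral sqrt(2 pi) and produces 1/x. The integral
    at frequency u, with its factor exp(-u^2/2), is the price of cutting y at Y.\<close>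
  have "(G 0 - G u) / of_real (x * s) - 1 / of_real x
     = ((G 0 - of_real (s * exp (- 0\<^sup>2 / 2))) - (G u - of_real (s * exp (- u\<^sup>2 / 2))) - of_real (s * exp (- u\<^sup>2 / 2))) / of_real (x * s)"
    using x0 s by (simp add: field_simps)
  then have "cmod ((G 0 - G u) / of_real (x * s) - 1 / of_real x)
     = cmod ((G 0 - of_real (s * exp (- 0\<^sup>2 / 2))) - (G u - of_real (s * exp (- u\<^sup>2 / 2))) - of_real (s * exp (- u\<^sup>2 / 2))) / (\<bar>x\<bar> * s)"
    using s by (simp only: norm_divide norm_of_real abs_mult abs_of_pos)
  also have "\<dots> \<le> (B 0 + B u + s * exp (- u\<^sup>2 / 2)) / (\<bar>x\<bar> * s)"
  proof (intro divide_right_mono)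
    have "cmod (of_real (s * exp (- u\<^sup>2 / 2))) = s * exp (- u\<^sup>2 / 2)" using s by (simp only: norm_of_real abs_mult abs_of_pos abs_exp_cancel)
    moreover have "cmod (p - q - r) \<le> cmod p + cmod q + cmod r" for p q r :: complex
      using norm_triangle_ineq4[of "p - q" r] norm_triangle_ineq4[of p q] by linarith
    ultimately show "cmod ((G 0 - of_real (s * exp (- 0\<^sup>2 / 2))) - (G u - of_real (s * exp (- u\<^sup>2 / 2))) - of_real (s * exp (- u\<^sup>2 / 2)))
        \<le> B 0 + B u + s * exp (- u\<^sup>2 / 2)"
      using GB[of 0] GB[of u] by (smt (verit))
  qed (use s in auto)
  also have "\<dots> \<le> eT + 7 / 8 * eD"
  proof -
    define a where "a = \<bar>x\<bar> * kt"
    have a: "1 \<le> a" "a \<le> kt" using x kt by (auto simp: a_def field_simps mult_left_le_one_le)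
    have ka: "kt / a = 1 / \<bar>x\<bar>" using kt x0 by (simp add: a_def)
    define q' where "q' = exp (pi * (real KK - 1))"
    have ez: "exp (- Z\<^sup>2 / 2) = eT / (3 * kt)" unfolding Z_def by (rule exp_zmax[OF eT])
    have uZ: "\<bar>u\<bar> = a * Z" using Z by (simp add: u_def a_def Y(2) abs_mult kt mult_ac) (use kt in simp)
    have "exp (u * Z) + exp (- (u * Z)) = exp (a * Z\<^sup>2) + exp (- (a * Z\<^sup>2))"
    proof (cases "u \<ge> 0")
      case True then have "u * Z = a * Z\<^sup>2" using uZ by (simp add: power2_eq_square)
      then show ?thesis by simp
    next
      case False then have "u = - (a * Z)" using uZ by simp
      then have "u * Z = - (a * Z\<^sup>2)" by (simp add: power2_eq_square)
      then show ?thesis by simp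
    qed
    then have Bsum: "B 0 + B u = s * (2 * exp (- Z\<^sup>2 / 2) + exp (Z\<^sup>2 / 2) * (2 + exp (a * Z\<^sup>2) + exp (- (a * Z\<^sup>2))) / (q' - 1))"
      by (simp add: B_def q'_def distrib_left add_divide_distrib)
    have eu: "exp (- u\<^sup>2 / 2) \<le> exp (- Z\<^sup>2 / 2)"
    proof -
      have "1 * Z \<le> a * Z" using a Z by (intro mult_right_mono) auto
      then have "Z \<le> \<bar>u\<bar>" using uZ by simp
      then have "Z\<^sup>2 \<le> \<bar>u\<bar>\<^sup>2" using Z by (intro power_mono) auto
      then show ?thesis by simp
    qed
    have "(B 0 + B u + s * exp (- u\<^sup>2 / 2)) / (\<bar>x\<bar> * s)
       = 1 / \<bar>x\<bar> * (2 * exp (- Z\<^sup>2 / 2) + exp (- u\<^sup>2 / 2)) + kt / a * (exp (Z\<^sup>2 / 2) * (2 + exp (a * Z\<^sup>2) + exp (- (a * Z\<^sup>2))) / (q' - 1))"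
    proof -
      have "(s * (E1 + E2) + s * E3) / (\<bar>x\<bar> * s) = 1 / \<bar>x\<bar> * (E1 + E3) + 1 / \<bar>x\<bar> * E2" for E1 E2 E3
        using s x0 by (simp add: field_simps)
      then show ?thesis unfolding Bsum ka by blast
    qed
    \<comment> \<open>Two truncations of z and one of y, each at most exp(-Z^2/2); the factor 3
      inside \<open>zmax\<close> exists for these three terms.\<close>
    also have "1 / \<bar>x\<bar> * (2 * exp (- Z\<^sup>2 / 2) + exp (- u\<^sup>2 / 2)) \<le> kt * (3 * exp (- Z\<^sup>2 / 2))"
    proof (intro mult_mono)
      show "1 / \<bar>x\<bar> \<le> kt" using x x0 kt by (simp add: field_simps)
    qed (use eu kt in \<open>auto intro: add_nonneg_nonneg\<close>)
    also have "kt * (3 * exp (- Z\<^sup>2 / 2)) = eT" unfolding ez using kt by simp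
    also have "kt / a * (exp (Z\<^sup>2 / 2) * (2 + exp (a * Z\<^sup>2) + exp (- (a * Z\<^sup>2))) / (q' - 1)) \<le> 7 / 8 * eD"
    proof (rule aliasing_bound[OF kt a _ eD])
      show "1 / 2 \<le> Z\<^sup>2" using Z2 by (simp add: Z_def)
      have "pi \<le> pi * (real KK - 1)" using K1 by simp
      then have "exp pi \<le> q'" unfolding q'_def by (simp only: exp_le_cancel_iff)
      then show "125 / 8 \<le> q'" using exp_1_bounds(3) by linarith
      have "4 / eD * exp (Z\<^sup>2 / 2 + kt * Z\<^sup>2) \<le> exp (K_log kt eT eD)" unfolding Z_def by (rule exp_K_log_ge[OF eT eD])
      also have "\<dots> \<le> q'" unfolding q'_def KK_def using Kpar_ge by simp
      finally show "4 / eD * exp (Z\<^sup>2 / 2 + kt * Z\<^sup>2) \<le> q'" .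
    qed
    finally show ?thesis by simp
  qed
  finally have trap: "cmod ((\<Sum>k<KK. A k * W k) - 1 / of_real x) \<le> eT + 7 / 8 * eD" unfolding AW .
  have split: "I_scalar kt eT eD x - 1 / of_real x = (\<Sum>k<KK. A k * V k - A k * W k) + ((\<Sum>k<KK. A k * W k) - 1 / of_real x)"
    unfolding I_eq by (simp add: sum_subtractf)
  have "cmod (p + r) \<le> eT + eD" if "cmod p \<le> eD / 8" "cmod r \<le> eT + 7 / 8 * eD" for p r :: complex
    using norm_triangle_ineq[of p r] that by linarith
  from this[OF quad trap] show ?thesis unfolding split .
qed

text \<open>Outside the main regime one of the tolerances already dominates \<open>kt \<ge> 1 / \<bar>x\<bar>\<close>, and the trivial
  bound \<open>Ny * Nz\<close> on the quadrature sum suffices. This covers degenerate grids with at most one point.\<close>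

lemma I_scalar_error:
  assumes kt: "kt \<ge> 1" and eT: "0 < eT" "eT < 3 * kt" and eD: "eD > 0"
    and x: "1 / kt \<le> \<bar>x\<bar>" "\<bar>x\<bar> \<le> 1"
  shows "cmod (I_scalar kt eT eD x - 1 / of_real x) \<le> eT + eD"
proof -
  define Z Y where "Z = zmax kt eT" and "Y = ymax kt eT"
  have Z: "Z > 0" unfolding Z_def by (rule zmax_pos[OF eT])
  have Zsq: "Z\<^sup>2 = 2 * ln (3 * kt / eT)" unfolding Z_def by (rule zmax_sq[OF eT])
  have Y: "Y > 0" "Y = kt * Z" using Z kt by (auto simp: Y_def ymax_def Z_def)
  have x0: "\<bar>x\<bar> > 0" using x kt by (smt (verit) divide_pos_pos)
  have inv: "cmod (1 / of_real x) \<le> kt" using x x0 kt by (simp add: norm_divide field_simps)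
  have eT_eq: "eT = 3 * kt * exp (- Z\<^sup>2 / 2)" unfolding Z_def exp_zmax[OF eT] using kt by simp
  have tri: "cmod (I_scalar kt eT eD x - 1 / of_real x) \<le> Ny kt eT eD * Nz kt eT eD + kt"
    using norm_triangle_ineq4[of "I_scalar kt eT eD x" "1 / of_real x"] norm_I_scalar_le[of kt eT eD x] inv by linarith
  show ?thesis
  proof (cases "Kpar kt eT eD \<le> 1")
    case True
    have "kt \<le> eT + eD"
    \<comment> \<open>For Z^2 \<ge> 2 a nonpositive \<open>K_log\<close> forces eD above kt. For
      smaller Z the tolerance eT = 3 kt exp(-Z^2/2) is at least 3 kt/e, hence at least kt.\<close>
    proof (cases "Z\<^sup>2 / 2 \<ge> 1")
      case True
      have "4 / eD * exp (Z\<^sup>2 / 2 + kt * Z\<^sup>2) \<le> exp (K_log kt eT eD)" unfolding Z_def by (rule exp_K_log_ge[OF eT eD])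
      also have "\<dots> \<le> 1" using Kpar_le_1[OF \<open>Kpar kt eT eD \<le> 1\<close>] by simp
      finally have "4 * exp (Z\<^sup>2 / 2 + kt * Z\<^sup>2) \<le> eD" using eD by (simp add: field_simps)
      moreover have "kt * 1 \<le> kt * Z\<^sup>2" using True kt by (intro mult_left_mono) auto
      then have "kt \<le> exp (Z\<^sup>2 / 2 + kt * Z\<^sup>2)"
        using exp_ge_add_one_self[of "Z\<^sup>2 / 2 + kt * Z\<^sup>2"] True by linarith
      ultimately show ?thesis using eT kt by linarith
    next
      case False
      then have "exp (- 1) \<le> exp (- Z\<^sup>2 / 2)" by simp
      moreover have "exp (- 1 :: real) \<ge> 1 / 3" using exp_1_bounds(1) by (simp add: exp_minus field_simps)
      ultimately have "1 \<le> 3 * exp (- Z\<^sup>2 / 2)" by linarith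
      then have "kt * 1 \<le> kt * (3 * exp (- Z\<^sup>2 / 2))" using kt by (intro mult_left_mono) auto
      then show ?thesis using eT_eq eD by simp
    qed
    then show ?thesis using tri Nz_eq_0[OF True] by simp
  next
    case False
    then have K: "Kpar kt eT eD \<ge> 2" by simp
    define \<rho> where "\<rho> = real (Kpar kt eT eD) / (real (Kpar kt eT eD) - 1)"
    have rho: "1 \<le> \<rho>" "\<rho> \<le> 2" using K by (auto simp: \<rho>_def field_simps)
    have NN: "Ny kt eT eD * Nz kt eT eD \<le> Y / sqrt (2 * pi) * (2 * Z\<^sup>2 * \<rho>)"
    proof (intro mult_mono Nz_nonneg)
      show "Ny kt eT eD \<le> Y / sqrt (2 * pi)" unfolding Y_def by (rule Ny_le[OF less_imp_le[OF Y(1)[unfolded Y_def]]])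
      show "Nz kt eT eD \<le> 2 * Z\<^sup>2 * \<rho>" unfolding Z_def \<rho>_def by (rule Nz_le[OF Z[unfolded Z_def] K])
      show "0 \<le> Y / sqrt (2 * pi)" using Y(1) by simp
    qed
    \<comment> \<open>For small Z the trivial bound is 2 kt and eT \<ge> 2 kt. In the loose case the
      formula for J gives no control, but then eD \<ge> 2 kt, and Ny Nz is at most eD/16.\<close>
    consider (small) "Z\<^sup>2 < 1 / 2" | (loose) "Z\<^sup>2 \<ge> 1 / 2" "32 * Y * Z\<^sup>2 * \<rho> \<le> sqrt (2 * pi) * eD"
      | (main) "Z\<^sup>2 \<ge> 1 / 2" "sqrt (2 * pi) * eD < 32 * Y * Z\<^sup>2 * \<rho>" by linarith
    then show ?thesis
    proof cases
      case small
      have Z1: "Z \<le> 1"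
      proof (rule power2_le_imp_le)
        show "Z\<^sup>2 \<le> 1\<^sup>2" unfolding one_power2 using small by linarith
      qed simp
      have "Y / sqrt (2 * pi) * (2 * Z\<^sup>2 * \<rho>) \<le> kt * 1 / 2 * (2 * (1 / 2) * 2)"
      proof (intro mult_mono frac_le)
        show "Y \<le> kt * 1" unfolding Y(2) using kt Z1 by (intro mult_left_mono) auto
      qed (use Y(1) Z kt small rho sqrt_2pi_bounds(1) in auto)
      then have "Ny kt eT eD * Nz kt eT eD \<le> kt" using NN by simp
      moreover have "2 * kt \<le> eT"
      proof -
        have "3 / 4 \<le> exp (- Z\<^sup>2 / 2)"
          by (rule order.trans[OF _ exp_ge_add_one_self]) (use small in simp)
        then have "kt * (3 / 4) \<le> kt * exp (- Z\<^sup>2 / 2)" using kt by (intro mult_left_mono) auto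
        then show ?thesis using eT_eq kt by linarith
      qed
      ultimately show ?thesis using tri eD by linarith
    next
      case loose
      have sp: "sqrt (2 * pi) > 0" by simp
      have "Y / sqrt (2 * pi) * (2 * Z\<^sup>2 * \<rho>) = 32 * Y * Z\<^sup>2 * \<rho> / (16 * sqrt (2 * pi))" by simp
      also have "\<dots> \<le> sqrt (2 * pi) * eD / (16 * sqrt (2 * pi))" using loose by (intro divide_right_mono) auto
      also have "\<dots> = eD / 16" by simp
      finally have a: "Ny kt eT eD * Nz kt eT eD \<le> eD / 16" using NN by linarith
      have "1 / 2 \<le> Z"
      proof (rule power2_le_imp_le)
        have "(1 / 2 :: real)\<^sup>2 = 1 / 4" by (simp add: power2_eq_square)
        then show "(1 / 2)\<^sup>2 \<le> Z\<^sup>2" using loose(1) by linarith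
      qed (use Z in simp)
      then have "kt * (1 / 2) * (1 / 2) * 1 \<le> Y * Z\<^sup>2 * \<rho>"
        unfolding Y(2) using kt loose rho Z by (intro mult_mono) auto
      then have "8 * kt \<le> 32 * Y * Z\<^sup>2 * \<rho>" by (simp add: mult_ac)
      also have "\<dots> \<le> 4 * eD" using loose(2) mult_right_mono[OF sqrt_2pi_bounds(2), of eD] eD by linarith
      finally show ?thesis using tri a eT by linarith
    next
      case main
      then show ?thesis
        using I_scalar_error_main[OF kt eT eD x K] by (simp add: Z_def Y_def \<rho>_def)
    qed
  qed
qed

section \<open>Error of the estimator\<close>

lemma L2_set_sum_le:
  "L2_set (\<lambda>i. \<Sum>l\<in>S. g l i) A \<le> (\<Sum>l\<in>S. L2_set (g l) A)"
proof (induction S rule: infinite_finite_induct)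
  case (insert l S)
  then show ?case
    using L2_set_triangle_ineq[of "g l" "\<lambda>i. \<Sum>l\<in>S. g l i" A] by simp
qed (simp_all add: L2_set_0')

lemma vnorm_pauli_mat:
  assumes l: "length ps = n" and v: "v \<in> carrier_vec (2 ^ n)"
  shows "vnorm (pauli_mat ps *\<^sub>v v) = vnorm v"
proof -
  note P = pauli_mat_carrier'[OF l]
  have "pauli_mat ps *\<^sub>v (pauli_mat ps *\<^sub>v v) = (pauli_mat ps * pauli_mat ps) *\<^sub>v v"
    using P v by (intro assoc_mult_mat_vec[symmetric]) auto
  also have "\<dots> = v" using pauli_mat_square[of ps] l v by simp
  finally have "cinner (pauli_mat ps *\<^sub>v v) (pauli_mat ps *\<^sub>v v) = cinner v v"
    using cinner_mult_adjoint[OF P v mult_mat_vec_carrier[OF P v]] by (simp add: pauli_mat_self_adjoint)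
  then have "(vnorm (pauli_mat ps *\<^sub>v v))\<^sup>2 = (vnorm v)\<^sup>2" by (simp only: cinner_self of_real_eq_iff)
  then show ?thesis by (simp add: power2_eq_iff_nonneg)
qed

text \<open>Pauli strings are isometries, so the Pauli weight bounds the operator norm. Together
  with \<open>op_norm A \<ge> 1\<close> this gives lam \<ge> 1, and it places the spectrum of A/lam
  in [-1, 1].\<close>

lemma vnorm_pauli_sum:
  assumes P: "\<forall>l<L. length (P l) = n" and v: "v \<in> carrier_vec (2 ^ n)"
  shows "vnorm (mat_sum (2 ^ n) (\<lambda>l. complex_of_real (c l) \<cdot>\<^sub>m pauli_mat (P l)) {..<L} *\<^sub>v v)
    \<le> pauli_weight L c * vnorm v"
proof -
  let ?m = "2 ^ n :: nat"
  let ?A = "mat_sum ?m (\<lambda>l. complex_of_real (c l) \<cdot>\<^sub>m pauli_mat (P l)) {..<L}"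
  have Pc: "pauli_mat (P l) \<in> carrier_mat ?m ?m" if "l < L" for l using P that by (intro pauli_mat_carrier') auto
  have dim: "dim_vec (?A *\<^sub>v v) = ?m" using carrier_matD(1)[OF mat_sum_carrier] by simp
  have "vnorm (?A *\<^sub>v v) = L2_set (\<lambda>i. cmod ((?A *\<^sub>v v) $ i)) {..<?m}" unfolding vnorm_L2 dim ..
  also have "\<dots> \<le> L2_set (\<lambda>i. \<Sum>l<L. \<bar>c l\<bar> * cmod ((pauli_mat (P l) *\<^sub>v v) $ i)) {..<?m}"
  proof (rule L2_set_mono)
    fix i assume "i \<in> {..<?m}"
    then have i: "i < ?m" by simp
    have "(?A *\<^sub>v v) $ i = (\<Sum>l<L. ((complex_of_real (c l) \<cdot>\<^sub>m pauli_mat (P l)) *\<^sub>v v) $ i)"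
      using Pc by (intro mat_sum_mult_vec v i) auto
    also have "\<dots> = (\<Sum>l<L. of_real (c l) * (pauli_mat (P l) *\<^sub>v v) $ i)"
    proof (rule sum.cong[OF refl])
      fix l assume "l \<in> {..<L}"
      then have "pauli_mat (P l) \<in> carrier_mat ?m ?m" using Pc by simp
      then show "((complex_of_real (c l) \<cdot>\<^sub>m pauli_mat (P l)) *\<^sub>v v) $ i = of_real (c l) * (pauli_mat (P l) *\<^sub>v v) $ i"
        using v i carrier_matD(1) by (subst smult_mat_mult_vec) auto
    qed
    finally show "cmod ((?A *\<^sub>v v) $ i) \<le> (\<Sum>l<L. \<bar>c l\<bar> * cmod ((pauli_mat (P l) *\<^sub>v v) $ i))"
      by (simp only:) (intro sum_norm_le, simp add: norm_mult)
  qed auto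
  also have "\<dots> \<le> (\<Sum>l<L. L2_set (\<lambda>i. \<bar>c l\<bar> * cmod ((pauli_mat (P l) *\<^sub>v v) $ i)) {..<?m})"
    by (rule L2_set_sum_le)
  also have "\<dots> = (\<Sum>l<L. \<bar>c l\<bar> * vnorm v)"
  proof (rule sum.cong[OF refl])
    fix l assume "l \<in> {..<L}"
    then have l: "l < L" by simp
    have "dim_vec (pauli_mat (P l) *\<^sub>v v) = ?m" using carrier_matD(1)[OF Pc[OF l]] by simp
    then have "L2_set (\<lambda>i. cmod ((pauli_mat (P l) *\<^sub>v v) $ i)) {..<?m} = vnorm v"
      using vnorm_pauli_mat[of "P l" n v] P l v by (simp add: vnorm_L2)
    then show "L2_set (\<lambda>i. \<bar>c l\<bar> * cmod ((pauli_mat (P l) *\<^sub>v v) $ i)) {..<?m} = \<bar>c l\<bar> * vnorm v"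
      by (simp add: L2_set_right_distrib[symmetric])
  qed
  finally show ?thesis by (simp add: pauli_weight_def sum_distrib_right)
qed

lemma braket_add_smult:
  assumes "phi \<in> carrier_vec N" "psi \<in> carrier_vec N" "M \<in> carrier_mat N N" "M' \<in> carrier_mat N N"
  shows "braket phi (M + a \<cdot>\<^sub>m M') psi = braket phi M psi + a * braket phi M' psi"
proof -
  have "(M + a \<cdot>\<^sub>m M') *\<^sub>v psi = M *\<^sub>v psi + a \<cdot>\<^sub>v (M' *\<^sub>v psi)"
    using assms by (simp add: add_mult_distrib_mat_vec[of _ N N] smult_mat_mult_vec)
  then show ?thesis using assms
    by (simp add: braket_def distrib_left sum.distrib sum_distrib_left mult_ac)
qed

text \<open>On an eigenvector of A with eigenvalue e both operators are scalars, and x = e/lam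
  satisfies 1/kt \<le> |x| \<le> 1: the upper bound comes from the Pauli weight, the lower one from
  the norm of the inverse. The final division by lam \<ge> 1 cannot increase the error.\<close>

lemma quadrature_solution_error:
  assumes A: "A \<in> carrier_mat (2 ^ n) (2 ^ n)" "mat_adjoint A = A"
    and Ainv: "Ainv \<in> carrier_mat (2 ^ n) (2 ^ n)" "Ainv * A = 1\<^sub>m (2 ^ n)"
    and A_norm: "op_norm A \<ge> 1"
    and P: "\<forall>l<L. length (P l) = n"
    and decomp: "A = mat_sum (2 ^ n) (\<lambda>l. complex_of_real (c l) \<cdot>\<^sub>m pauli_mat (P l)) {..<L}"
    and kstar: "kstar \<ge> op_norm A * op_norm Ainv"
    and psi: "psi \<in> carrier_vec (2 ^ n)" "vnorm psi = 1" and phi: "phi \<in> carrier_vec (2 ^ n)" "vnorm phi = 1"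
    and eD: "eD > 0" and eT: "0 < eT" "eT < 3 * (pauli_weight L c * kstar)"
  shows "pauli_weight L c \<ge> 1"
    and "cmod (braket phi (I_D (pauli_weight L c * kstar) eT eD ((1 / complex_of_real (pauli_weight L c)) \<cdot>\<^sub>m A)) psi
        / complex_of_real (pauli_weight L c) - braket phi Ainv psi) \<le> eT + eD"
proof -
  let ?m = "2 ^ n :: nat"
  define lam kt where "lam = pauli_weight L c" and "kt = lam * kstar"
  have Av: "vnorm (A *\<^sub>v v) \<le> lam * vnorm v" if "v \<in> carrier_vec ?m" for v
    unfolding decomp lam_def by (rule vnorm_pauli_sum[OF P that])
  have "op_norm A \<le> lam" using Av by (intro op_norm_le[OF A(1)]) force+
  with A_norm have lam1: "lam \<ge> 1" by simp
  then show "pauli_weight L c \<ge> 1" by (simp add: lam_def)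
  have kpos: "kstar > 0"
  proof -
    have "lam * kstar > 0" using eT by (simp add: lam_def)
    then show ?thesis using lam1 by (simp add: zero_less_mult_iff)
  qed
  define At where "At = (1 / complex_of_real lam) \<cdot>\<^sub>m A"
  \<comment> \<open>The inverse of A/lam is lam times \<open>Ainv\<close>.\<close>
  define F where "F = I_D kt eT eD At + (- of_real lam) \<cdot>\<^sub>m Ainv"
  have Atc: "At \<in> carrier_mat ?m ?m" using A by (simp add: At_def)
  have Ic: "I_D kt eT eD At \<in> carrier_mat ?m ?m" using carrier_matD(1)[OF Atc] by (simp add: I_D_def)
  have Fc: "F \<in> carrier_mat ?m ?m" using Ic Ainv by (simp add: F_def)
  have "vnorm (F *\<^sub>v psi) \<le> (eT + eD) * vnorm psi"
  proof (rule hermitian_function_norm_bound[OF A Fc _ psi(1)])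
    fix e u assume u: "eigen_of A ?m (complex_of_real e) u" and u0: "u \<noteq> 0\<^sub>v ?m"
    have uc: "u \<in> carrier_vec ?m" and Au: "A *\<^sub>v u = of_real e \<cdot>\<^sub>v u" using u by (auto simp: eigen_of_def)
    have nu: "vnorm u > 0" using vnorm_eq_0[OF uc] u0 vnorm_nonneg[of u] by (simp add: less_le)
    have "Ainv *\<^sub>v (A *\<^sub>v u) = (Ainv * A) *\<^sub>v u" using Ainv A uc by (intro assoc_mult_mat_vec[symmetric]) auto
    also have "\<dots> = u" using Ainv uc by simp
    finally have AiAu: "of_real e \<cdot>\<^sub>v (Ainv *\<^sub>v u) = u" unfolding Au using Ainv uc by (simp add: mult_mat_vec)
    then have "\<bar>e\<bar> * vnorm (Ainv *\<^sub>v u) = vnorm u" by (metis vnorm_smult norm_of_real)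
    moreover have "vnorm (Ainv *\<^sub>v u) \<le> op_norm Ainv * vnorm u" by (rule op_norm_bound[OF Ainv(1) uc])
    \<comment> \<open>Since \<open>op_norm A \<ge> 1\<close>, a bound on the condition number is
      also one on the norm of the inverse.\<close>
    moreover have "op_norm Ainv \<le> kstar"
    proof -
      have "op_norm Ainv \<ge> 0" by (rule op_norm_nonneg[OF Ainv(1)]) simp
      then have "1 * op_norm Ainv \<le> op_norm A * op_norm Ainv" using A_norm by (intro mult_right_mono) auto
      then show ?thesis using kstar by simp
    qed
    ultimately have "vnorm u \<le> \<bar>e\<bar> * (kstar * vnorm u)"
      by (smt (verit) abs_ge_zero mult_left_mono mult_right_mono vnorm_nonneg)
    then have ek: "1 \<le> \<bar>e\<bar> * kstar" using nu by simp
    then have e0: "e \<noteq> 0" by auto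
    have "\<bar>e\<bar> * vnorm u = vnorm (A *\<^sub>v u)" unfolding Au vnorm_smult by simp
    also have "\<dots> \<le> lam * vnorm u" by (rule Av[OF uc])
    finally have el: "\<bar>e\<bar> \<le> lam" using nu by simp
    define x where "x = e / lam"
    have x: "1 / kt \<le> \<bar>x\<bar>" "\<bar>x\<bar> \<le> 1"
      using ek el lam1 kpos by (simp_all add: x_def kt_def field_simps)
    \<comment> \<open>The existence of an eigenvalue with 1/kt \<le> |x| \<le> 1 already entails kt
      \<ge> 1.\<close>
    have kt1: "kt \<ge> 1"
    proof -
      have "1 / kt \<le> 1" using x by linarith
      moreover have "kt > 0" using kpos lam1 by (simp add: kt_def)
      ultimately show ?thesis by (simp add: divide_le_eq)
    qed
    have "eigen_of At ?m (of_real x) u"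
      using uc A lam1 unfolding eigen_of_def At_def x_def
      by (simp add: smult_mat_mult_vec[of _ ?m] Au smult_smult_assoc)
    then have Iu: "I_D kt eT eD At *\<^sub>v u = I_scalar kt eT eD x \<cdot>\<^sub>v u" by (rule I_D_eigen[OF Atc])
    have Aiu: "Ainv *\<^sub>v u = (1 / of_real e) \<cdot>\<^sub>v u"
    proof -
      have "(1 / of_real e) \<cdot>\<^sub>v (of_real e \<cdot>\<^sub>v (Ainv *\<^sub>v u)) = Ainv *\<^sub>v u"
        using e0 by (simp add: smult_smult_assoc)
      then show ?thesis unfolding AiAu by simp
    qed
    have "F *\<^sub>v u = I_D kt eT eD At *\<^sub>v u + (- of_real lam) \<cdot>\<^sub>v (Ainv *\<^sub>v u)"
      unfolding F_def using Ic Ainv uc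
      by (subst add_mult_distrib_mat_vec[of _ ?m ?m]) (auto simp: smult_mat_mult_vec[of _ ?m])
    also have "\<dots> = (I_scalar kt eT eD x - 1 / of_real x) \<cdot>\<^sub>v u"
      unfolding Iu Aiu using uc e0 lam1 by (intro eq_vecI) (auto simp: x_def left_diff_distrib)
    finally show "F *\<^sub>v u = (I_scalar kt eT eD (e / lam) - 1 / of_real (e / lam)) \<cdot>\<^sub>v u
        \<and> cmod (I_scalar kt eT eD (e / lam) - 1 / of_real (e / lam)) \<le> eT + eD"
      using I_scalar_error[OF kt1 eT(1) _ eD x] eT by (simp add: x_def kt_def lam_def)
  qed (use eT eD in auto)
  then have "cmod (braket phi F psi) \<le> eT + eD"
    using braket_bound[OF phi(1) Fc psi(1)] psi phi by simp
  moreover have "braket phi F psi = braket phi (I_D kt eT eD At) psi + (- of_real lam) * braket phi Ainv psi"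
    unfolding F_def by (rule braket_add_smult[OF phi(1) psi(1) Ic Ainv(1)])
  moreover have "braket phi (I_D kt eT eD At) psi / of_real lam - braket phi Ainv psi
      = (braket phi (I_D kt eT eD At) psi + (- of_real lam) * braket phi Ainv psi) / of_real lam"
    using lam1 by (simp add: field_simps)
  ultimately have "cmod (braket phi (I_D kt eT eD At) psi / of_real lam - braket phi Ainv psi) \<le> (eT + eD) / lam"
    using lam1 by (simp add: norm_divide divide_right_mono)
  also have "\<dots> \<le> eT + eD" using lam1 eT eD by (simp add: divide_le_eq mult_left_le)
  finally show "cmod (braket phi (I_D (pauli_weight L c * kstar) eT eD ((1 / complex_of_real (pauli_weight L c)) \<cdot>\<^sub>m A)) psi
        / complex_of_real (pauli_weight L c) - braket phi Ainv psi) \<le> eT + eD"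
    by (simp add: At_def kt_def lam_def)
qed

lemma set_sample_U:
  assumes lam: "pauli_weight L c > 0" and x: "x \<in> set_pmf (sample_U n L c P kt eT eD r nmax)"
  obtains j k ms where
    "(j, k) \<in> set_pmf (finite_pmf ({..<Jpar kt eT eD} \<times> {..<Kpar kt eT eD})
           (\<lambda>(j, k). cmod (fs_alpha kt eT eD j k) / (Ny kt eT eD * Nz kt eT eD)))"
    "set ms \<subseteq> rte_terms nmax L" "length ms = r"
    "x = (fs_alpha kt eT eD j k / complex_of_real (cmod (fs_alpha kt eT eD j k)),
      rte_alpha nmax L c (pauli_weight L c) (fs_t kt eT eD j k / real r) ^ r,
      mat_prod_list (2 ^ n) (map (rte_U n c (pauli_weight L c) P (fs_t kt eT eD j k / real r)) ms))"
proof -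
  from x obtain j k ms where 1: "(j, k) \<in> set_pmf (finite_pmf ({..<Jpar kt eT eD} \<times> {..<Kpar kt eT eD})
           (\<lambda>(j, k). cmod (fs_alpha kt eT eD j k) / (Ny kt eT eD * Nz kt eT eD)))"
    and 2: "ms \<in> set_pmf (replicate_pmf r (finite_pmf (rte_terms nmax L)
       (\<lambda>m. rte_d c (pauli_weight L c) (fs_t kt eT eD j k / real r) m / rte_alpha nmax L c (pauli_weight L c) (fs_t kt eT eD j k / real r))))"
    and 3: "x = (fs_alpha kt eT eD j k / complex_of_real (cmod (fs_alpha kt eT eD j k)),
      rte_alpha nmax L c (pauli_weight L c) (fs_t kt eT eD j k / real r) ^ r,
      mat_prod_list (2 ^ n) (map (rte_U n c (pauli_weight L c) P (fs_t kt eT eD j k / real r)) ms))"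
    unfolding sample_U_def Let_def by auto
  from 2 have "length ms = r" "set ms \<subseteq> rte_terms nmax L"
    using set_rte_pmf[OF lam, of nmax "fs_t kt eT eD j k / real r"] by (auto simp: set_replicate_pmf in_lists_conv_set)
  with 1 3 show ?thesis using that by blast
qed

lemma set_pm1_pmf: "set_pmf (pm1_pmf a) \<subseteq> {1, -1}"
  by (auto simp: pm1_pmf_def)

text \<open>X and Y are signs, so X + iY has modulus sqrt 2. The factor \<open>NRTE\<close> is
  controlled through |t_jk| \<le> ymax zmax, and this product is 2 kt ln(3 kt/eT), the number
  t_max.\<close>

lemma sample_norm_bound:
  assumes lam: "pauli_weight L c > 0" and eT: "0 < eT" "eT < 3 * kt" and kt: "kt > 0" and r: "r \<ge> 1"
    and z: "z \<in> set_pmf (Zb_pmf n L c P psi phi kt eT eD r nmax)"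
  shows "cmod z \<le> sqrt 2 * (exp ((2 * kt * ln (3 * kt / eT))\<^sup>2 / real r) * Ny kt eT eD * Nz kt eT eD / pauli_weight L c)"
proof -
  let ?NN = "Ny kt eT eD * Nz kt eT eD" and ?T = "2 * kt * ln (3 * kt / eT)"
  have NN0: "?NN \<ge> 0" using Ny_nonneg Nz_nonneg by simp
  from z obtain x where x0: "x \<in> set_pmf (sample_U n L c P kt eT eD r nmax)"
    and zx: "z \<in> set_pmf (case x of (omega, NRTE, U) \<Rightarrow>
       bind_pmf (pm1_pmf (Re (braket phi U psi))) (\<lambda>X.
         bind_pmf (pm1_pmf (Im (braket phi U psi))) (\<lambda>Y.
           return_pmf (omega * complex_of_real (NRTE * Ny kt eT eD * Nz kt eT eD / pauli_weight L c)
                       * (complex_of_real X + \<i> * complex_of_real Y)))))"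
    unfolding Zb_pmf_def set_bind_pmf by (rule UN_E)
  obtain omega NRTE U where x_eq: "x = (omega, NRTE, U)" by (rule prod_cases3)
  have s: "(omega, NRTE, U) \<in> set_pmf (sample_U n L c P kt eT eD r nmax)" using x0 x_eq by simp
  obtain X Y where "X \<in> set_pmf (pm1_pmf (Re (braket phi U psi)))" "Y \<in> set_pmf (pm1_pmf (Im (braket phi U psi)))"
    and z_eq: "z = omega * complex_of_real (NRTE * Ny kt eT eD * Nz kt eT eD / pauli_weight L c)
                       * (complex_of_real X + \<i> * complex_of_real Y)"
    using zx unfolding x_eq prod.case set_bind_pmf set_return_pmf by blast
  then have XY: "X \<in> {1, -1}" "Y \<in> {1, -1}" using set_pm1_pmf by blast+
  have nXY: "cmod (complex_of_real X + \<i> * complex_of_real Y) = sqrt 2"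
    using XY by (auto simp: cmod_def)
  have zn: "cmod z = cmod omega * \<bar>NRTE\<bar> * (?NN / pauli_weight L c) * sqrt 2"
    unfolding z_eq norm_mult nXY norm_of_real using lam Ny_nonneg Nz_nonneg
    by (simp add: abs_mult)
  show ?thesis
  \<comment> \<open>If Ny Nz = 0, the weights of the first draw do not form a probability
    distribution and nothing is known about j and k; but the factor Ny Nz makes every sample
    zero.\<close>
  proof (cases "?NN = 0")
    case True
    then show ?thesis unfolding zn by auto
  next
    case False
    then have NN: "?NN > 0" using NN0 by linarith
    obtain j k ms where jk: "(j, k) \<in> set_pmf (finite_pmf ({..<Jpar kt eT eD} \<times> {..<Kpar kt eT eD})
           (\<lambda>(j, k). cmod (fs_alpha kt eT eD j k) / ?NN))"
      and x: "(omega, NRTE, U) = (fs_alpha kt eT eD j k / complex_of_real (cmod (fs_alpha kt eT eD j k)),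
      rte_alpha nmax L c (pauli_weight L c) (fs_t kt eT eD j k / real r) ^ r,
      mat_prod_list (2 ^ n) (map (rte_U n c (pauli_weight L c) P (fs_t kt eT eD j k / real r)) ms))"
      by (rule set_sample_U[OF lam s])
    have "set_pmf (finite_pmf ({..<Jpar kt eT eD} \<times> {..<Kpar kt eT eD})
           (\<lambda>(j, k). cmod (fs_alpha kt eT eD j k) / ?NN)) \<subseteq> {..<Jpar kt eT eD} \<times> {..<Kpar kt eT eD}"
    proof (rule order.trans[OF set_finite_pmf])
      show "(\<Sum>x\<in>{..<Jpar kt eT eD} \<times> {..<Kpar kt eT eD}. case x of (j, k) \<Rightarrow> cmod (fs_alpha kt eT eD j k) / ?NN) = 1"
        using sum_norm_fs_alpha[of kt eT eD] NN
        by (auto simp: case_prod_unfold simp flip: sum_divide_distrib)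
    qed (use NN in auto)
    with jk have j: "j < Jpar kt eT eD" and k: "k < Kpar kt eT eD" by auto
    have K: "Kpar kt eT eD \<ge> 2"
    proof (rule ccontr)
      assume "\<not> ?thesis"
      then have "Nz kt eT eD = 0" by (intro Nz_eq_0) simp
      then show False using NN by simp
    qed
    have Z: "zmax kt eT > 0" by (rule zmax_pos[OF eT])
    have "\<bar>fs_t kt eT eD j k\<bar> \<le> ymax kt eT * zmax kt eT"
      unfolding fs_t_def abs_mult
    proof (intro mult_mono)
      have y0: "ymax kt eT > 0" using kt Z by (simp add: ymax_def)
      have "ymax kt eT * (1 + legendre_root (Jpar kt eT eD) j) \<le> ymax kt eT * 2"
        using legendre_root_bounds(3)[OF j] y0 by (intro mult_left_mono) auto
      moreover have "ymax kt eT * (1 + legendre_root (Jpar kt eT eD) j) \<ge> 0"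
        using legendre_root_bounds(2)[OF j] y0 by simp
      ultimately show "\<bar>yj kt eT eD j\<bar> \<le> ymax kt eT" by (simp add: yj_def)
      show "0 \<le> ymax kt eT" using y0 by simp
    qed (use abs_zk_le[OF Z K k] in auto)
    also have "ymax kt eT * zmax kt eT = ?T"
      using zmax_sq[OF eT] by (simp add: ymax_def power2_eq_square)
    finally have "NRTE \<le> exp (?T\<^sup>2 / real r)" using rte_alpha_power_le[OF lam r] x by auto
    moreover have "NRTE \<ge> 0" using rte_alpha_pos[OF lam] x by (auto intro: less_imp_le)
    moreover have "cmod omega \<le> 1" using x by (simp add: norm_divide)
    ultimately have "cmod omega * \<bar>NRTE\<bar> \<le> 1 * exp (?T\<^sup>2 / real r)" by (intro mult_mono) auto
    then have "cmod omega * \<bar>NRTE\<bar> * (?NN / pauli_weight L c * sqrt 2) \<le> 1 * exp (?T\<^sup>2 / real r) * (?NN / pauli_weight L c * sqrt 2)"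
      using NN lam by (intro mult_right_mono) auto
    then show ?thesis unfolding zn by (simp add: mult_ac)
  qed
qed

theorem theorem11:
  fixes n L r nmax :: nat
    and c :: "nat \<Rightarrow> real" and P :: "nat \<Rightarrow> pauli list"
    and A Ainv :: "complex mat" and psi phi :: "complex vec"
    and kstar eT eD eps delta :: real
  assumes n: "n \<ge> 1"
    and A_carrier: "A \<in> carrier_mat (2 ^ n) (2 ^ n)"
    and A_herm: "mat_adjoint A = A"
    and Ainv_carrier: "Ainv \<in> carrier_mat (2 ^ n) (2 ^ n)"
    and A_inv: "A * Ainv = 1\<^sub>m (2 ^ n)" "Ainv * A = 1\<^sub>m (2 ^ n)"
    and A_norm: "op_norm A \<ge> 1"
    and P_len: "\<forall>l<L. length (P l) = n"
    and decomp: "A = mat_sum (2 ^ n) (\<lambda>l. complex_of_real (c l) \<cdot>\<^sub>m pauli_mat (P l)) {..<L}"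
    and kstar: "kstar \<ge> op_norm A * op_norm Ainv"
    and psi: "psi \<in> carrier_vec (2 ^ n)" "vnorm psi = 1"
    and phi: "phi \<in> carrier_vec (2 ^ n)" "vnorm phi = 1"
    and eD: "eD > 0"
    and eT: "0 < eT" "eT < 3 * (pauli_weight L c * kstar)"
    and eps: "eps > 0"
    and delta: "0 < delta" "delta < 1"
    and eTD: "eT + eD \<le> eps / 2"
    and r: "r \<ge> 1" and nmax: "nmax \<ge> 1"
    and bias: "cmod (braket phi (I_D (pauli_weight L c * kstar) eT eD
                    ((1 / complex_of_real (pauli_weight L c)) \<cdot>\<^sub>m A)) psi / complex_of_real (pauli_weight L c)
                  - measure_pmf.expectation (Zb_pmf n L c P psi phi (pauli_weight L c * kstar) eT eD r nmax) (\<lambda>z. z))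
               < eps / 2"
  shows "(let lam = pauli_weight L c; kt = lam * kstar;
              B = braket phi (I_D kt eT eD ((1 / complex_of_real lam) \<cdot>\<^sub>m A)) psi / complex_of_real lam
                  - measure_pmf.expectation (Zb_pmf n L c P psi phi kt eT eD r nmax) (\<lambda>z. z);
              tmax = 2 * kt * ln (3 * kt / eT);
              NS = nat \<lceil>1 + ln (2 / delta) * (16 * (exp (tmax\<^sup>2 / real r) * Ny kt eT eD * Nz kt eT eD)\<^sup>2)
                         / (lam\<^sup>2 * (eps / 2 - cmod B)\<^sup>2)\<rceil>
          in measure_pmf.prob (avg_pmf NS (Zb_pmf n L c P psi phi kt eT eD r nmax))
               {z. cmod (z - braket phi Ainv psi) \<le> eps} \<ge> 1 - delta
           \<and> (\<forall>x \<in> set_pmf (sample_U n L c P kt eT eD r nmax).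
                \<exists>C0 GCs. length GCs \<le> r \<and> is_clifford (Suc n) C0
                  \<and> (\<forall>(G, C) \<in> set GCs. is_ctrl_pauli_rot (Suc n) G \<and> is_clifford (Suc n) C)
                  \<and> ctrl_mat (2 ^ n) (snd (snd x)) = circuit (Suc n) C0 GCs))"
proof -
  define lam kt where "lam = pauli_weight L c" and "kt = lam * kstar"
  define p where "p = Zb_pmf n L c P psi phi kt eT eD r nmax"
  define E where "E = measure_pmf.expectation p (\<lambda>z. z)"
  define Q where "Q = braket phi (I_D kt eT eD ((1 / complex_of_real lam) \<cdot>\<^sub>m A)) psi / complex_of_real lam"
  define T where "T = 2 * kt * ln (3 * kt / eT)"
  \<comment> \<open>What the bias leaves of one half of the error budget; the other half pays for eT
    + eD.\<close>
  define \<eta> where "\<eta> = eps / 2 - cmod (Q - E)"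
  define R where "R = exp (T\<^sup>2 / real r) * Ny kt eT eD * Nz kt eT eD"
  \<comment> \<open>Origin of the 16: if the squared sample bound is M^2 = 2 R^2/lam^2, the tail
    exponent N \<eta>^2/(4 M^2) equals 2 ln(2/delta) at N = a.\<close>
  define a where "a = ln (2 / delta) * (16 * R\<^sup>2) / (lam\<^sup>2 * \<eta>\<^sup>2)"
  define NS where "NS = nat \<lceil>1 + a\<rceil>"
  note solution = quadrature_solution_error[OF A_carrier A_herm Ainv_carrier A_inv(2) A_norm P_len decomp kstar psi phi eD eT]
  have lam: "lam \<ge> 1" using solution(1) by (simp add: lam_def)
  have Qerr: "cmod (Q - braket phi Ainv psi) \<le> eps / 2"
    using solution(2) eTD by (simp add: Q_def kt_def lam_def)
  have eta: "\<eta> > 0" using bias by (simp add: \<eta>_def Q_def E_def p_def kt_def lam_def)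
  have kt: "kt > 0" and eT': "eT < 3 * kt" using eT by (simp_all add: kt_def lam_def)
  have ld: "ln (2 / delta) > 0" using delta by (intro ln_gt_zero) (simp add: field_simps)
  have a0: "a \<ge> 0" unfolding a_def using ld by (intro divide_nonneg_nonneg mult_nonneg_nonneg) auto
  \<comment> \<open>The summand 1 guarantees at least one sample even when R = 0.\<close>
  have NSa: "1 + a \<le> real NS" unfolding NS_def by (rule of_nat_ceiling)
  then have NS0: "NS > 0" using a0 by (cases "NS = 0") auto
  text \<open>The bound \<open>M\<close> on a sample is chosen so that the tail bound becomes \<open>delta\<^sup>2\<close>; this also covers
    the case of an identically vanishing estimator.\<close>
  define M where "M = sqrt (real NS * \<eta>\<^sup>2 / (8 * ln (2 / delta)))"
  have Msq: "M\<^sup>2 = real NS * \<eta>\<^sup>2 / (8 * ln (2 / delta))" unfolding M_def using ld by simp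
  have M0: "M > 0" unfolding M_def using NS0 eta ld by simp
  have bound: "cmod z \<le> M" if "z \<in> set_pmf p" for z
  proof -
    have "cmod z \<le> sqrt 2 * (R / lam)"
      using sample_norm_bound[OF _ eT(1) eT' kt r, of L c z n P psi phi eD nmax] that lam
      by (simp add: p_def R_def T_def lam_def)
    also have "\<dots> \<le> M"
    proof (rule power2_le_imp_le)
      have "(sqrt 2 * (R / lam))\<^sup>2 = a * \<eta>\<^sup>2 / (8 * ln (2 / delta))"
        using eta lam ld by (simp add: a_def power_mult_distrib power_divide field_simps)
      also have "\<dots> \<le> M\<^sup>2" unfolding Msq using NSa ld
        by (intro divide_right_mono mult_right_mono) auto
      finally show "(sqrt 2 * (R / lam))\<^sup>2 \<le> M\<^sup>2" .
    qed (use M0 in simp)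
    finally show ?thesis .
  qed
  have "measure_pmf.prob (avg_pmf NS p) {z. cmod (z - E) > \<eta>} \<le> 4 * exp (- (real NS * \<eta>\<^sup>2 / (4 * M\<^sup>2)))"
    unfolding E_def by (rule avg_pmf_concentration[OF M0 bound eta NS0])
  also have "real NS * \<eta>\<^sup>2 / (4 * M\<^sup>2) = 2 * ln (2 / delta)"
    unfolding Msq using NS0 eta ld by (simp add: field_simps)
  \<comment> \<open>Four tails of (delta/2)^2 each.\<close>
  also have "4 * exp (- (2 * ln (2 / delta))) = delta\<^sup>2"
  proof -
    have "- (2 * ln (2 / delta)) = ln (delta / 2) + ln (delta / 2)" using delta by (simp add: ln_div)
    then have "exp (- (2 * ln (2 / delta))) = delta / 2 * (delta / 2)"
      using delta by (simp only: exp_add) simp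
    then show ?thesis by (simp add: power2_eq_square)
  qed
  also have "delta\<^sup>2 \<le> delta" using delta by (simp add: power2_eq_square mult_left_le)
  finally have tail: "measure_pmf.prob (avg_pmf NS p) {z. cmod (z - E) > \<eta>} \<le> delta" .
  have "1 - delta \<le> measure_pmf.prob (avg_pmf NS p) {z. cmod (z - E) \<le> \<eta>}"
  proof -
    have "{z. cmod (z - E) \<le> \<eta>} = space (measure_pmf (avg_pmf NS p)) - {z. cmod (z - E) > \<eta>}" by auto
    then show ?thesis using tail measure_pmf.prob_compl[of "{z. cmod (z - E) > \<eta>}" "avg_pmf NS p"] by simp
  qed
  also have "\<dots> \<le> measure_pmf.prob (avg_pmf NS p) {z. cmod (z - braket phi Ainv psi) \<le> eps}"
  proof (rule measure_pmf.finite_measure_mono)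
    show "{z. cmod (z - E) \<le> \<eta>} \<subseteq> {z. cmod (z - braket phi Ainv psi) \<le> eps}"
    proof
      fix z assume "z \<in> {z. cmod (z - E) \<le> \<eta>}"
      then have z: "cmod (z - E) \<le> \<eta>" by simp
      have "cmod (z - braket phi Ainv psi) = cmod ((z - E) - (Q - E) + (Q - braket phi Ainv psi))" by simp
      also have "\<dots> \<le> cmod (z - E) + cmod (Q - E) + cmod (Q - braket phi Ainv psi)"
        by (intro order.trans[OF norm_triangle_ineq] add_right_mono norm_triangle_ineq4)
      also have "\<dots> \<le> eps" using z Qerr by (simp add: \<eta>_def)
      finally show "z \<in> {z. cmod (z - braket phi Ainv psi) \<le> eps}" by simp
    qed
  qed simp
  finally have prob: "1 - delta \<le> measure_pmf.prob (avg_pmf NS p) {z. cmod (z - braket phi Ainv psi) \<le> eps}" .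
  have circuits: "\<exists>C0 GCs. length GCs \<le> r \<and> is_clifford (Suc n) C0
      \<and> (\<forall>(G, C) \<in> set GCs. is_ctrl_pauli_rot (Suc n) G \<and> is_clifford (Suc n) C)
      \<and> ctrl_mat (2 ^ n) (snd (snd x)) = circuit (Suc n) C0 GCs"
    if x: "x \<in> set_pmf (sample_U n L c P kt eT eD r nmax)" for x
  proof -
    have "pauli_weight L c > 0" using lam by (simp add: lam_def)
    then obtain j k ms where ms: "set ms \<subseteq> rte_terms nmax L" "length ms = r"
      and x_eq: "x = (fs_alpha kt eT eD j k / complex_of_real (cmod (fs_alpha kt eT eD j k)),
      rte_alpha nmax L c (pauli_weight L c) (fs_t kt eT eD j k / real r) ^ r,
      mat_prod_list (2 ^ n) (map (rte_U n c (pauli_weight L c) P (fs_t kt eT eD j k / real r)) ms))"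
      by (rule set_sample_U[OF _ x])
    show ?thesis
      using ctrl_product_circuit[OF n P_len ms(1), of c "pauli_weight L c" "fs_t kt eT eD j k / real r"] ms(2)
      unfolding x_eq snd_conv by (metis order.refl)
  qed
  show ?thesis
    unfolding Let_def lam_def[symmetric] kt_def[symmetric] p_def[symmetric] E_def[symmetric] Q_def[symmetric]
      T_def[symmetric] \<eta>_def[symmetric] R_def[symmetric] a_def[symmetric] NS_def[symmetric]
    using prob circuits by blast
qed

end
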